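(* Let $\mathbf{B}$ be a Mal'cev algebra on a three-element set. Then $\mathbf{B}$ is isomorphic to an algebra $\mathbf{A}$ with universe $\{0,1,2\}$ and monolith $\mu$ such that either (1) $\mu=1_A$, and $\mathrm{Clo}(\mathbf{A})=\mathrm{Pol}(\Gamma)$ where $\Gamma$ consists of all subuniverses of $\mathbf{A}$ together with $$\{\varphi,\psi_2,\psi_0',\psi_1',\psi_2',\varphi_0',\ldots,\varphi_5',T,T_0',T_1',T_2'\}\cap\mathrm{Inv}(\mathbf{A});$$ or (2) $\mu=\mu_2$, and $\mathrm{Clo}(\mathbf{A})=\mathrm{Pol}(\Gamma)$ where $\Gamma$ consists of all subuniverses of $\mathbf{A}$ together with $$\{\mu_2,\rho_2,\tau_0,\tau_1,\psi_2,\psi_2',T_2,T_2',T^{\mu_2},S_{01}\}\cap\mathrm{Inv}(\mathbf{A}).$$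
   Context: A Mal'cev algebra is an algebra with a term operation $d$ satisfying $d(y,x,x)\approx d(x,x,y)\approx y$. $\mathrm{Clo}(\mathbf{A})$ is the clone of term operations of $\mathbf{A}$; $\mathrm{Inv}(\mathbf{A})$ is the set of all relations on $A$ preserved by all operations of $\mathbf{A}$; $\mathrm{Pol}(\Gamma)$ is the clone of operations preserving all relations in $\Gamma$. A subuniverse is a (unary) subset closed under the operations. The monolith of $\mathbf{A}$ is the least congruence strictly above the equality relation $0_A$ (equal to $1_A=A^2$ when $\mathbf{A}$ is simple). Relations on $\{0,1,2\}$: $\mu_i$ is the equivalence relation with classes $\{i\}$ and $\{0,1,2\}\setminus\{i\}$; $\rho_i=\{0,1,2\}^2\setminus\mu_i$; $\psi_i$ is the graph of the transposition of $\{0,1,2\}$ fixing $i$, and $\psi_i'$ is its restriction to $\{0,1,2\}\setminus\{i\}$ (e.g. $\psi_2=\{(0,1),(1,0),(2,2)\}$, $\psi_2'=\{(0,1),(1,0)\}$); $\varphi=\{(0,1),(1,2),(2,0)\}$; $\varphi_0'=\{(1,2),(2,0)\}$, $\varphi_1'=\{(0,1),(2,0)\}$, $\varphi_2'=\{(0,1),(1,2)\}$, $\varphi_3'=\{(1,2),(0,0)\}$, $\varphi_4'=\{(0,2),(1,1)\}$, $\varphi_5'=\{(0,1),(2,2)\}$; $\tau_0=\{(0,0),(1,0),(2,1)\}$, $\tau_1=\{(0,1),(1,1),(2,0)\}$. Let $\mathrm{min}$ denote the minority operation on a two-element set ($\mathrm{min}(x,y,y)=\mathrm{min}(y,x,y)=\mathrm{min}(y,y,x)=x$).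 Then $T=\{(x,y,z,x-y+z\bmod 3):x,y,z\in\{0,1,2\}\}$; $T_i'=\{(x,y,z,\mathrm{min}(x,y,z)):x,y,z\in\{0,1,2\}\setminus\{i\}\}$; $T_i=T_i'\cup\{(i,i,i,i)\}$; $T^{\mu_2}=\{(x,y,z,u):u/\mu_2=\mathrm{min}(x/\mu_2,y/\mu_2,z/\mu_2)\}$ (minority on the two $\mu_2$-classes); and $S_{01}=\{(0,0,0),(0,0,1),(1,1,0),(1,1,1),(0,1,2),(1,0,2)\}$. *)

theory Defs
  imports Main "HOL-Library.Numeral_Type"
begin

text \<open>An algebra with universe the type 'a and signature 'i is given by an arity
function ar and a family F of basic operations; F i is an (ar i)-ary operation,
applied to argument lists of length ar i (values on other lists are irrelevant).
Finitary relations are pairs (m, R) of an arity m and a set R of lists of length m.\<close>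

type_synonym 'a relation = "nat \<times> 'a list set"

inductive_set term_ops :: "('i \<Rightarrow> nat) \<Rightarrow> ('i \<Rightarrow> 'a list \<Rightarrow> 'a) \<Rightarrow> nat \<Rightarrow> ('a list \<Rightarrow> 'a) set"
  for ar :: "'i \<Rightarrow> nat" and F :: "'i \<Rightarrow> 'a list \<Rightarrow> 'a" and n :: nat
where
  proj: "k < n \<Longrightarrow> (\<lambda>xs. xs ! k) \<in> term_ops ar F n"
| comp: "length gs = ar i \<Longrightarrow> (\<forall>g\<in>set gs. g \<in> term_ops ar F n)
          \<Longrightarrow> (\<lambda>xs. F i (map (\<lambda>g. g xs) gs)) \<in> term_ops ar F n"

definition Clo :: "('i \<Rightarrow> nat) \<Rightarrow> ('i \<Rightarrow> 'a list \<Rightarrow> 'a) \<Rightarrow> (nat \<times> ('a list \<Rightarrow> 'a)) set" where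
  "Clo ar F = {(n, f). 1 \<le> n \<and>
      (\<exists>g \<in> term_ops ar F n. \<forall>xs. length xs = n \<longrightarrow> f xs = g xs)}"

definition preserves :: "nat \<Rightarrow> ('a list \<Rightarrow> 'a) \<Rightarrow> 'a relation \<Rightarrow> bool" where
  "preserves n f Rel = (case Rel of (m, R) \<Rightarrow>
      \<forall>rs. length rs = n \<and> set rs \<subseteq> R \<longrightarrow>
           map (\<lambda>j. f (map (\<lambda>r. r ! j) rs)) [0..<m] \<in> R)"

definition Pol :: "'a relation set \<Rightarrow> (nat \<times> ('a list \<Rightarrow> 'a)) set" where
  "Pol \<Gamma> = {(n, f). 1 \<le> n \<and> (\<forall>Rel\<in>\<Gamma>. preserves n f Rel)}"

definition Inv :: "('i \<Rightarrow> nat) \<Rightarrow> ('i \<Rightarrow> 'a list \<Rightarrow> 'a) \<Rightarrow> 'a relation set" where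
  "Inv ar F = {Rel. \<forall>i. preserves (ar i) (F i) Rel}"

definition subuniverse :: "('i \<Rightarrow> nat) \<Rightarrow> ('i \<Rightarrow> 'a list \<Rightarrow> 'a) \<Rightarrow> 'a set \<Rightarrow> bool" where
  "subuniverse ar F S = (\<forall>i xs. length xs = ar i \<and> set xs \<subseteq> S \<longrightarrow> F i xs \<in> S)"

definition unary_rel :: "'a set \<Rightarrow> 'a relation" where
  "unary_rel S = (1, {[x] | x. x \<in> S})"

definition bin_rel :: "('a \<times> 'a) set \<Rightarrow> 'a relation" where
  "bin_rel R = (2, {[x, y] | x y. (x, y) \<in> R})"

definition subuniverse_rels :: "('i \<Rightarrow> nat) \<Rightarrow> ('i \<Rightarrow> 'a list \<Rightarrow> 'a) \<Rightarrow> 'a relation set" where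
  "subuniverse_rels ar F = {unary_rel S | S. subuniverse ar F S}"

definition malcev :: "('i \<Rightarrow> nat) \<Rightarrow> ('i \<Rightarrow> 'a list \<Rightarrow> 'a) \<Rightarrow> bool" where
  "malcev ar F = (\<exists>d. (3, d) \<in> Clo ar F \<and> (\<forall>x y. d [y, x, x] = y \<and> d [x, x, y] = y))"

definition congruence :: "('i \<Rightarrow> nat) \<Rightarrow> ('i \<Rightarrow> 'a list \<Rightarrow> 'a) \<Rightarrow> ('a \<times> 'a) set \<Rightarrow> bool" where
  "congruence ar F \<theta> = (equiv UNIV \<theta> \<and> (\<forall>i. preserves (ar i) (F i) (bin_rel \<theta>)))"

definition is_monolith :: "('i \<Rightarrow> nat) \<Rightarrow> ('i \<Rightarrow> 'a list \<Rightarrow> 'a) \<Rightarrow> ('a \<times> 'a) set \<Rightarrow> bool" where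
  "is_monolith ar F \<mu> = (congruence ar F \<mu> \<and> \<mu> \<noteq> Id \<and>
      (\<forall>\<theta>. congruence ar F \<theta> \<and> \<theta> \<noteq> Id \<longrightarrow> \<mu> \<subseteq> \<theta>))"

definition isomorphism :: "('i \<Rightarrow> nat) \<Rightarrow> ('i \<Rightarrow> 'a list \<Rightarrow> 'a) \<Rightarrow> ('i \<Rightarrow> 'b list \<Rightarrow> 'b)
     \<Rightarrow> ('a \<Rightarrow> 'b) \<Rightarrow> bool" where
  "isomorphism ar F G h = (bij h \<and>
      (\<forall>i xs. length xs = ar i \<longrightarrow> h (F i xs) = G i (map h xs)))"

section \<open>The relations on {0,1,2} (the type 3 of Numeral_Type, arithmetic mod 3)\<close>

definition mu3 :: "3 \<Rightarrow> (3 \<times> 3) set" where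
  "mu3 i = {(x, y). (x = i) = (y = i)}"
definition rho3 :: "3 \<Rightarrow> (3 \<times> 3) set" where
  "rho3 i = UNIV - mu3 i"
definition psi3 :: "3 \<Rightarrow> (3 \<times> 3) set" where
  "psi3 i = {(x, y). (x = i \<and> y = i) \<or> (x \<noteq> i \<and> y \<noteq> i \<and> x \<noteq> y)}"
definition psi3' :: "3 \<Rightarrow> (3 \<times> 3) set" where
  "psi3' i = {(x, y). x \<noteq> i \<and> y \<noteq> i \<and> x \<noteq> y}"
definition phi3 :: "(3 \<times> 3) set" where
  "phi3 = {(0, 1), (1, 2), (2, 0)}"
definition phi3' :: "nat \<Rightarrow> (3 \<times> 3) set" where
  "phi3' k = (if k = 0 then {(1, 2), (2, 0)}
         else if k = 1 then {(0, 1), (2, 0)}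
         else if k = 2 then {(0, 1), (1, 2)}
         else if k = 3 then {(1, 2), (0, 0)}
         else if k = 4 then {(0, 2), (1, 1)}
         else {(0, 1), (2, 2)})"
definition tau3_0 :: "(3 \<times> 3) set" where
  "tau3_0 = {(0, 0), (1, 0), (2, 1)}"
definition tau3_1 :: "(3 \<times> 3) set" where
  "tau3_1 = {(0, 1), (1, 1), (2, 0)}"

text \<open>minority operation on a two-element set\<close>
definition minority :: "'a \<Rightarrow> 'a \<Rightarrow> 'a \<Rightarrow> 'a" where
  "minority x y z = (if x = y then z else if x = z then y else x)"

definition T3 :: "3 relation" where
  "T3 = (4, {[x, y, z, x - y + z] | x y z. True})"
definition T3' :: "3 \<Rightarrow> 3 relation" where
  "T3' i = (4, {[x, y, z, minority x y z] | x y z. x \<noteq> i \<and> y \<noteq> i \<and> z \<noteq> i})"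
definition T3i :: "3 \<Rightarrow> 3 relation" where
  "T3i i = (4, snd (T3' i) \<union> {[i, i, i, i]})"
definition T3_mu2 :: "3 relation" where
  "T3_mu2 = (4, {[x, y, z, u] | x y z u. (u = 2) = minority (x = 2) (y = 2) (z = 2)})"
definition S01 :: "3 relation" where
  "S01 = (3, {[0,0,0], [0,0,1], [1,1,0], [1,1,1], [0,1,2], [1,0,2]})"

definition Gamma1_candidates :: "3 relation set" where
  "Gamma1_candidates = {bin_rel phi3, bin_rel (psi3 2), bin_rel (psi3' 0), bin_rel (psi3' 1),
     bin_rel (psi3' 2)} \<union> {bin_rel (phi3' k) | k. k \<le> 5} \<union> {T3, T3' 0, T3' 1, T3' 2}"

definition Gamma2_candidates :: "3 relation set" where
  "Gamma2_candidates = {bin_rel (mu3 2), bin_rel (rho3 2), bin_rel tau3_0, bin_rel tau3_1,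
     bin_rel (psi3 2), bin_rel (psi3' 2), T3i 2, T3' 2, T3_mu2, S01}"

end

theory Submission
  imports Defs
begin

text \<open>A term operation interpolates \<open>f\<close> on any two points because every invariant binary relation
  of a three-element Mal'cev algebra is built from subuniverses and candidate relations. If no term
  operation agrees with \<open>f\<close> everywhere, take a minimal set \<open>Y\<close> of argument tuples on which
  interpolation fails; it has at least three elements, and for each \<open>y \<in> Y\<close> some term operation
  agrees with \<open>f\<close> on \<open>Y\<close> exactly off \<open>y\<close>. Such forks make the monolith of the section of the algebra
  seen at \<open>y\<close> abelian, as for the critical relations of Kearnes and Szendrei. On at most three
  elements the blocks of an abelian monolith are affine over \<open>Z\<^sub>2\<close> or \<open>Z\<^sub>3\<close>, which puts one of the
  candidate relations of arity 3 or 4 into \<open>Inv\<close>. Hence \<open>f\<close> is affine on tuples from such a block,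
  and an affine function that agrees with a term operation on the diagonal agrees with some term
  operation on all these tuples.\<close>

text \<open>Abelianness comes from the two further elements \<open>z\<close>, \<open>w\<close> of
  \<open>Y\<close>. The fork at \<open>y\<close>, formed by \<open>f y\<close> and the wrong value
  there of a term operation that is right elsewhere, is realised by term operations differing only
  on \<open>{y, z}\<close>, and again by ones differing only on \<open>{y, w}\<close>. Moves of the
  first kind leave \<open>w\<close> alone, those of the second kind leave \<open>z\<close> alone, so
  combining them by \<open>d\<close> in either order gives the same result off \<open>y\<close>:
  this is the term condition. A two-element \<open>Y\<close> gives nothing of the sort, hence the
  prior study of binary relations.

  Affine functions are corrected by \<open>d (h xs) (xs ! l) (xs ! k)\<close>, which adds the
  difference of two input coordinates to the value. Such corrections vanish on constant tuples, so
  agreement on the diagonal has to come from two-point interpolation.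

  The remaining obstacle is that one term operation must serve all of \<open>Y\<close>, whose tuples
  may live on different blocks. Invariant relations between blocks (some \<open>phi3'\<close>, or
  \<open>S01\<close>) carry agreement from one block to another, and agreement is needed only modulo
  a congruence at each coordinate.\<close>

lemma ex3: "(x::3) = 0 \<or> x = 1 \<or> x = 2"
proof (cases x)
  case (of_int z)
  then have "z = 0 \<or> z = 1 \<or> z = 2" by auto
  with of_int show ?thesis by auto
qed

lemma ex2: "(x::2) = 0 \<or> x = 1"
proof (cases x)
  case (of_int z)
  then have "z = 0 \<or> z = 1" by auto
  with of_int show ?thesis by auto
qed

lemma ex3': "(\<exists>x::3. P x) \<longleftrightarrow> P 0 \<or> P 1 \<or> P 2"
  using ex3 by metis

lemma all3: "(\<forall>x::3. P x) \<longleftrightarrow> P 0 \<and> P 1 \<and> P 2"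
  using ex3 by metis

subsection \<open>Preservation of relations\<close>

text \<open>Transposed view of \<open>preserves\<close>: the \<open>m\<close> rows of
  \<open>M\<close> are argument tuples and its \<open>n\<close> columns are the members of
  \<open>R\<close>. Later arguments compare the values of operations at a few tuples, which is the
  row view.\<close>

lemma preserves_matrixD:
  assumes "preserves n f (m, R)" and "length M = m" and "\<And>xs. xs \<in> set M \<Longrightarrow> length xs = n"
    and "\<And>k. k < n \<Longrightarrow> map (\<lambda>xs. xs ! k) M \<in> R"
  shows "map f M \<in> R"
proof -
  define rs where "rs = map (\<lambda>k. map (\<lambda>xs. xs ! k) M) [0..<n]"
  have rs: "length rs = n" "set rs \<subseteq> R" using assms(4) by (auto simp: rs_def)
  have "map (\<lambda>j. f (map (\<lambda>r. r ! j) rs)) [0..<m] \<in> R"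
    using assms(1) rs by (auto simp: preserves_def)
  moreover have "map (\<lambda>j. f (map (\<lambda>r. r ! j) rs)) [0..<m] = map f M"
  proof (rule nth_equalityI)
    fix j assume "j < length (map (\<lambda>j. f (map (\<lambda>r. r ! j) rs)) [0..<m])"
    then have j: "j < m" by simp
    have "map (\<lambda>r. r ! j) rs = M ! j"
      using j assms(2,3) by (intro nth_equalityI) (auto simp: rs_def)
    with j assms(2) show "map (\<lambda>j. f (map (\<lambda>r. r ! j) rs)) [0..<m] ! j = map f M ! j" by simp
  qed (use assms(2) in simp)
  ultimately show ?thesis by simp
qed

text \<open>The length hypothesis recovers a member of \<open>R\<close> from its first
  \<open>m\<close> entries; if \<open>R\<close> held lists of another length, even a projection
  could fail to preserve \<open>(m, R)\<close>.\<close>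

lemma preserves_matrixI:
  assumes "\<And>r. r \<in> R \<Longrightarrow> length r = m"
    and "\<And>M. length M = m \<Longrightarrow> (\<And>xs. xs \<in> set M \<Longrightarrow> length xs = n) \<Longrightarrow>
              (\<And>k. k < n \<Longrightarrow> map (\<lambda>xs. xs ! k) M \<in> R) \<Longrightarrow> map f M \<in> R"
  shows "preserves n f (m, R)"
  unfolding preserves_def
proof (clarify)
  fix rs assume rs: "n = length rs" "set rs \<subseteq> R"
  define M where "M = map (\<lambda>j. map (\<lambda>r. r ! j) rs) [0..<m]"
  have "map (\<lambda>xs. xs ! k) M = rs ! k" if "k < n" for k
  proof (rule nth_equalityI)
    have "rs ! k \<in> R" using that rs by auto
    then show "length (map (\<lambda>xs. xs ! k) M) = length (rs ! k)" using assms(1) by (simp add: M_def)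
  qed (use that rs in \<open>simp add: M_def\<close>)
  then have "map f M \<in> R"
    using rs by (intro assms(2)) (auto simp: M_def)
  moreover have "map f M = map (\<lambda>j. f (map (\<lambda>r. r ! j) rs)) [0..<m]"
    by (simp add: M_def)
  ultimately show "map (\<lambda>j. f (map (\<lambda>r. r ! j) rs)) [0..<m] \<in> R" by simp
qed

lemma preserves_unary_rel:
  "preserves n f (unary_rel S) \<longleftrightarrow> (\<forall>xs. length xs = n \<and> set xs \<subseteq> S \<longrightarrow> f xs \<in> S)"
proof
  assume "preserves n f (unary_rel S)"
  then have *: "preserves n f (1, {[x] | x. x \<in> S})" by (simp add: unary_rel_def)
  show "\<forall>xs. length xs = n \<and> set xs \<subseteq> S \<longrightarrow> f xs \<in> S"
    using preserves_matrixD[OF *, of "[xs]" for xs] by fastforce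
next
  assume *: "\<forall>xs. length xs = n \<and> set xs \<subseteq> S \<longrightarrow> f xs \<in> S"
  show "preserves n f (unary_rel S)"
    unfolding unary_rel_def
  proof (rule preserves_matrixI, goal_cases)
    case (2 M)
    then obtain xs where M: "M = [xs]" by (auto simp: length_Suc_conv)
    with 2 have "length xs = n" "set xs \<subseteq> S" by (auto simp: set_conv_nth)
    with * M show ?case by auto
  qed auto
qed

lemma preserves_bin_rel:
  "preserves n f (bin_rel R) \<longleftrightarrow> (\<forall>xs ys. length xs = n \<and> length ys = n \<and>
     (\<forall>k<n. (xs ! k, ys ! k) \<in> R) \<longrightarrow> (f xs, f ys) \<in> R)"
proof
  assume "preserves n f (bin_rel R)"
  then have *: "preserves n f (2, {[x, y] | x y. (x, y) \<in> R})" by (simp add: bin_rel_def)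
  show "\<forall>xs ys. length xs = n \<and> length ys = n \<and>
     (\<forall>k<n. (xs ! k, ys ! k) \<in> R) \<longrightarrow> (f xs, f ys) \<in> R"
    using preserves_matrixD[OF *, of "[xs, ys]" for xs ys] by fastforce
next
  assume *: "\<forall>xs ys. length xs = n \<and> length ys = n \<and>
     (\<forall>k<n. (xs ! k, ys ! k) \<in> R) \<longrightarrow> (f xs, f ys) \<in> R"
  show "preserves n f (bin_rel R)"
    unfolding bin_rel_def
  proof (rule preserves_matrixI, goal_cases)
    case (2 M)
    then obtain xs ys where M: "M = [xs, ys]" by (auto simp: length_Suc_conv numeral_2_eq_2)
    with 2 have "length xs = n" "length ys = n" "\<And>k. k < n \<Longrightarrow> (xs ! k, ys ! k) \<in> R" by auto
    with * M show ?case by auto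
  qed auto
qed

lemma preserves_ternary:
  assumes "\<And>r. r \<in> R \<Longrightarrow> length r = 3"
  shows "preserves n f (3, R) \<longleftrightarrow> (\<forall>xs ys zs. length xs = n \<and> length ys = n \<and> length zs = n \<and>
     (\<forall>k<n. [xs ! k, ys ! k, zs ! k] \<in> R) \<longrightarrow> [f xs, f ys, f zs] \<in> R)"
proof
  assume *: "preserves n f (3, R)"
  show "\<forall>xs ys zs. length xs = n \<and> length ys = n \<and> length zs = n \<and>
     (\<forall>k<n. [xs ! k, ys ! k, zs ! k] \<in> R) \<longrightarrow> [f xs, f ys, f zs] \<in> R"
    using preserves_matrixD[OF *, of "[xs, ys, zs]" for xs ys zs] by fastforce
next
  assume *: "\<forall>xs ys zs. length xs = n \<and> length ys = n \<and> length zs = n \<and>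
     (\<forall>k<n. [xs ! k, ys ! k, zs ! k] \<in> R) \<longrightarrow> [f xs, f ys, f zs] \<in> R"
  show "preserves n f (3, R)"
  proof (rule preserves_matrixI[OF assms], goal_cases)
    case (2 M)
    then obtain xs ys zs where M: "M = [xs, ys, zs]" by (auto simp: length_Suc_conv numeral_3_eq_3)
    with 2 have "length xs = n" "length ys = n" "length zs = n"
      "\<And>k. k < n \<Longrightarrow> [xs ! k, ys ! k, zs ! k] \<in> R" by auto
    with * M show ?case by auto
  qed
qed

lemma preserves_quaternary:
  assumes "\<And>r. r \<in> R \<Longrightarrow> length r = 4"
  shows "preserves n f (4, R) \<longleftrightarrow> (\<forall>xs ys zs us. length xs = n \<and> length ys = n \<and>
     length zs = n \<and> length us = n \<and>
     (\<forall>k<n. [xs ! k, ys ! k, zs ! k, us ! k] \<in> R) \<longrightarrow> [f xs, f ys, f zs, f us] \<in> R)"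
proof
  assume *: "preserves n f (4, R)"
  show "\<forall>xs ys zs us. length xs = n \<and> length ys = n \<and> length zs = n \<and> length us = n \<and>
     (\<forall>k<n. [xs ! k, ys ! k, zs ! k, us ! k] \<in> R) \<longrightarrow> [f xs, f ys, f zs, f us] \<in> R"
    using preserves_matrixD[OF *, of "[xs, ys, zs, us]" for xs ys zs us] by fastforce
next
  assume *: "\<forall>xs ys zs us. length xs = n \<and> length ys = n \<and> length zs = n \<and> length us = n \<and>
     (\<forall>k<n. [xs ! k, ys ! k, zs ! k, us ! k] \<in> R) \<longrightarrow> [f xs, f ys, f zs, f us] \<in> R"
  show "preserves n f (4, R)"
  proof (rule preserves_matrixI[OF assms], goal_cases)
    case (2 M)
    then obtain xs ys zs us where M: "M = [xs, ys, zs, us]"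
      by (auto simp: length_Suc_conv eval_nat_numeral)
    with 2 have "length xs = n" "length ys = n" "length zs = n" "length us = n"
      "\<And>k. k < n \<Longrightarrow> [xs ! k, ys ! k, zs ! k, us ! k] \<in> R" by auto
    with * M show ?case by auto
  qed
qed

lemma preserves_ternaryD:
  assumes "preserves n f (3, R)" "length xs = n" "length ys = n" "length zs = n"
    and "\<And>k. k < n \<Longrightarrow> [xs ! k, ys ! k, zs ! k] \<in> R"
  shows "[f xs, f ys, f zs] \<in> R"
  using preserves_matrixD[OF assms(1), of "[xs, ys, zs]"] assms(2-) by auto

lemma preserves_quaternaryD:
  assumes "preserves n f (4, R)" "length xs = n" "length ys = n" "length zs = n" "length us = n"
    and "\<And>k. k < n \<Longrightarrow> [xs ! k, ys ! k, zs ! k, us ! k] \<in> R"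
  shows "[f xs, f ys, f zs, f us] \<in> R"
  using preserves_matrixD[OF assms(1), of "[xs, ys, zs, us]"] assms(2-) by auto

lemma preserves_converse:
  "preserves n f (bin_rel R) \<Longrightarrow> preserves n f (bin_rel (R\<inverse>))"
  by (simp add: preserves_bin_rel)

lemma preserves_relcomp:
  assumes "preserves n f (bin_rel R)" "preserves n f (bin_rel S)"
  shows "preserves n f (bin_rel (R O S))"
  unfolding preserves_bin_rel
proof clarify
  fix xs zs assume n: "n = length xs" "length zs = length xs"
    and *: "\<forall>k<length xs. (xs ! k, zs ! k) \<in> R O S"
  then have "\<forall>k. \<exists>y. k < length xs \<longrightarrow> (xs ! k, y) \<in> R \<and> (y, zs ! k) \<in> S" by blast
  then obtain y where y: "\<And>k. k < length xs \<Longrightarrow> (xs ! k, y k) \<in> R \<and> (y k, zs ! k) \<in> S" by metis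
  define ys where "ys = map y [0..<length xs]"
  have "(f xs, f ys) \<in> R" "(f ys, f zs) \<in> S"
    using assms y n unfolding preserves_bin_rel by (auto simp: ys_def)
  then show "(f xs, f zs) \<in> R O S" by blast
qed

lemma preserves_Int:
  assumes "preserves n f (bin_rel R)" "preserves n f (bin_rel S)"
  shows "preserves n f (bin_rel (R \<inter> S))"
  using assms unfolding preserves_bin_rel by simp

lemma preserves_Times:
  assumes "preserves n f (unary_rel A)" "preserves n f (unary_rel B)"
  shows "preserves n f (bin_rel (A \<times> B))"
  using assms unfolding preserves_bin_rel preserves_unary_rel
  by (auto simp: set_conv_nth)

lemma preserves_image:
  assumes "bij p" "preserves n f (bin_rel R)"
  shows "preserves n (\<lambda>xs. p (f (map (inv p) xs))) (bin_rel {(p x, p y) | x y. (x, y) \<in> R})"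
  unfolding preserves_bin_rel
proof (intro allI impI, elim conjE)
  fix xs ys assume n: "length xs = n" "length ys = n"
    and *: "\<forall>k<n. (xs ! k, ys ! k) \<in> {(p x, p y) | x y. (x, y) \<in> R}"
  have "(f (map (inv p) xs), f (map (inv p) ys)) \<in> R"
  proof (rule assms(2)[unfolded preserves_bin_rel, rule_format], intro conjI allI impI)
    fix k assume k: "k < n"
    then obtain x y where "xs ! k = p x" "ys ! k = p y" "(x, y) \<in> R" using * by auto
    then show "(map (inv p) xs ! k, map (inv p) ys ! k) \<in> R"
      using k n assms(1) by (simp add: bij_is_inj)
  qed (use n in auto)
  then show "(p (f (map (inv p) xs)), p (f (map (inv p) ys))) \<in> {(p x, p y) | x y. (x, y) \<in> R}"
    by blast
qed

subsection \<open>Term operations and invariant relations\<close>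

lemma InvD: "Rel \<in> Inv ar F \<Longrightarrow> preserves (ar i) (F i) Rel"
  by (simp add: Inv_def)

lemma subuniverse_iff: "subuniverse ar F S \<longleftrightarrow> unary_rel S \<in> Inv ar F"
  by (simp add: subuniverse_def Inv_def preserves_unary_rel)

lemma term_preserves:
  assumes "g \<in> term_ops ar F n" "(m, R) \<in> Inv ar F"
    and "length M = m" and "\<And>xs. xs \<in> set M \<Longrightarrow> length xs = n"
    and "\<And>k. k < n \<Longrightarrow> map (\<lambda>xs. xs ! k) M \<in> R"
  shows "map g M \<in> R"
  using assms(1)
proof induction
  case (proj k)
  then show ?case using assms(5) by simp
next
  case (comp gs i)
  have "preserves (ar i) (F i) (m, R)" using assms(2) by (rule InvD)
  from preserves_matrixD[OF this, of "map (\<lambda>xs. map (\<lambda>g. g xs) gs) M"] comp assms(3)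
  show ?case by (force simp: o_def)
qed

lemma term_ops_preserve:
  assumes "g \<in> term_ops ar F n" "(m, R) \<in> Inv ar F" "\<And>r. r \<in> R \<Longrightarrow> length r = m"
  shows "preserves n g (m, R)"
  by (rule preserves_matrixI[OF assms(3)]) (auto intro: term_preserves[OF assms(1,2)])

lemma term_ops_preserve_bin:
  "g \<in> term_ops ar F n \<Longrightarrow> bin_rel R \<in> Inv ar F \<Longrightarrow> preserves n g (bin_rel R)"
  unfolding bin_rel_def by (rule term_ops_preserve) auto

lemma term_ops_preserve_unary:
  "g \<in> term_ops ar F n \<Longrightarrow> unary_rel R \<in> Inv ar F \<Longrightarrow> preserves n g (unary_rel R)"
  unfolding unary_rel_def by (rule term_ops_preserve) auto

lemma term_ops_subst:
  assumes "t \<in> term_ops ar F k" "length gs = k" "set gs \<subseteq> term_ops ar F n"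
  shows "(\<lambda>xs. t (map (\<lambda>g. g xs) gs)) \<in> term_ops ar F n"
  using assms(1)
proof induction
  case (proj j)
  then have "(\<lambda>xs. map (\<lambda>g. g xs) gs ! j) = gs ! j" using assms(2) by auto
  then show ?case using assms proj by auto
next
  case (comp hs i)
  have "(\<lambda>xs. F i (map (\<lambda>g. g xs) (map (\<lambda>h xs. h (map (\<lambda>g. g xs) gs)) hs))) \<in> term_ops ar F n"
    using comp by (intro term_ops.comp) auto
  then show ?case by (simp add: o_def)
qed

lemma Inv_bin_relI:
  assumes "\<And>i xs ys. length xs = ar i \<Longrightarrow> length ys = ar i \<Longrightarrow>
     (\<And>k. k < ar i \<Longrightarrow> (xs ! k, ys ! k) \<in> R) \<Longrightarrow> (F i xs, F i ys) \<in> R"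
  shows "bin_rel R \<in> Inv ar F"
  using assms by (auto simp: Inv_def preserves_bin_rel)

lemma Inv_relcomp: "bin_rel R \<in> Inv ar F \<Longrightarrow> bin_rel S \<in> Inv ar F \<Longrightarrow> bin_rel (R O S) \<in> Inv ar F"
  by (simp add: Inv_def preserves_relcomp)

lemma Inv_converse: "bin_rel R \<in> Inv ar F \<Longrightarrow> bin_rel (R\<inverse>) \<in> Inv ar F"
  by (simp add: Inv_def preserves_converse)

lemma Inv_Domain:
  assumes "bin_rel R \<in> Inv ar F"
  shows "unary_rel (Domain R) \<in> Inv ar F"
  unfolding subuniverse_iff[symmetric] subuniverse_def
proof (clarify)
  fix i and xs assume xs: "length xs = ar i" "set xs \<subseteq> Domain R"
  then have "\<forall>k. \<exists>y. k < ar i \<longrightarrow> (xs ! k, y) \<in> R" by (metis DomainE nth_mem subsetD)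
  then obtain y where y: "\<And>k. k < ar i \<Longrightarrow> (xs ! k, y k) \<in> R" by metis
  have "(F i xs, F i (map y [0..<ar i])) \<in> R"
    using InvD[OF assms, of i] xs y unfolding preserves_bin_rel by auto
  then show "F i xs \<in> Domain R" by blast
qed

lemma Inv_Range: "bin_rel R \<in> Inv ar F \<Longrightarrow> unary_rel (Range R) \<in> Inv ar F"
  using Inv_Domain[OF Inv_converse] by simp

subsection \<open>Binary relations compatible with the monolith\<close>

lemma rel_eq_iff: "R = S \<longleftrightarrow> (\<forall>x y. (x, y) \<in> R \<longleftrightarrow> (x, y) \<in> S)"
  by auto

lemma relcomp_iff: "(x, z) \<in> R O S \<longleftrightarrow> (\<exists>y. (x, y) \<in> R \<and> (y, z) \<in> S)"
  by auto

lemma mem_mu3_2: "(x, y) \<in> mu3 2 \<longleftrightarrow> (x = 2) = (y = 2)"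
  by (simp add: mu3_def)
lemma mem_rho3_2: "(x, y) \<in> rho3 2 \<longleftrightarrow> (x = 2) \<noteq> (y = 2)"
  by (simp add: rho3_def mu3_def)
lemma mem_tau3_0: "(x, y) \<in> tau3_0 \<longleftrightarrow> (y = 0 \<and> x \<noteq> 2) \<or> (y = 1 \<and> x = 2)"
  using ex3[of x] by (auto simp: tau3_0_def)
lemma mem_tau3_1: "(x, y) \<in> tau3_1 \<longleftrightarrow> (y = 1 \<and> x \<noteq> 2) \<or> (y = 0 \<and> x = 2)"
  using ex3[of x] by (auto simp: tau3_1_def)
lemma mem_psi3_2: "(x, y) \<in> psi3 2 \<longleftrightarrow> (x = 2 \<and> y = 2) \<or> (x = 0 \<and> y = 1) \<or> (x = 1 \<and> y = 0)"
  using ex3[of x] ex3[of y] by (elim disjE) (simp_all add: psi3_def)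
lemma mem_psi3'_2: "(x, y) \<in> psi3' 2 \<longleftrightarrow> (x = 0 \<and> y = 1) \<or> (x = 1 \<and> y = 0)"
  using ex3[of x] ex3[of y] by (elim disjE) (simp_all add: psi3'_def)

lemma distinct3: "((0::3) = 0) = True" "((1::3) = 1) = True" "((2::3) = 2) = True" "((0::3) = 1) = False"
  "((0::3) = 2) = False" "((1::3) = 0) = False" "((1::3) = 2) = False" "((2::3) = 0) = False" "((2::3) = 1) = False"
  by simp_all

definition rectangular_rel :: "('a \<times> 'b) set \<Rightarrow> bool" where
  "rectangular_rel R \<longleftrightarrow> (\<forall>x y x' y'. (x, y) \<in> R \<longrightarrow> (x', y) \<in> R \<longrightarrow> (x', y') \<in> R \<longrightarrow> (x, y') \<in> R)"

lemma relcomp_mu3_left: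
  "(0, y) \<in> mu3 2 O R \<longleftrightarrow> (0, y) \<in> R \<or> (1, y) \<in> R"
  "(1, y) \<in> mu3 2 O R \<longleftrightarrow> (0, y) \<in> R \<or> (1, y) \<in> R"
  "(2, y) \<in> mu3 2 O R \<longleftrightarrow> (2, y) \<in> R"
  by (simp_all add: relcomp_iff mem_mu3_2 ex3')

lemma relcomp_mu3_right:
  "(x, 0) \<in> R O mu3 2 \<longleftrightarrow> (x, 0) \<in> R \<or> (x, 1) \<in> R"
  "(x, 1) \<in> R O mu3 2 \<longleftrightarrow> (x, 0) \<in> R \<or> (x, 1) \<in> R"
  "(x, 2) \<in> R O mu3 2 \<longleftrightarrow> (x, 2) \<in> R"
  by (simp_all add: relcomp_iff mem_mu3_2 ex3')

text \<open>Composing with \<open>mu3 2\<close> amounts to passing to the quotient on one side or on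
  both, and rectangularity there excludes the remaining relations. The second conjuncts write a
  candidate as a composite of \<open>R\<close> with \<open>mu3 2\<close>: this is how that candidate
  becomes invariant when \<open>R\<close> and \<open>mu3 2\<close> are.\<close>

lemma rel3_cases:
  fixes R :: "(3 \<times> 3) set"
  assumes "rectangular_rel R" "rectangular_rel (mu3 2 O R)" "rectangular_rel (R O mu3 2)"
    "rectangular_rel (mu3 2 O R O mu3 2)"
  shows "R = Domain R \<times> Range R \<or> R = (Domain R \<times> Range R) \<inter> mu3 2 \<or> R = psi3 2 \<or> R = psi3' 2 \<or>
    R = (Domain R \<times> Range R) \<inter> Id \<or>
    (R = (Domain R \<times> Range R) \<inter> rho3 2 \<and> mu3 2 O R O mu3 2 = rho3 2) \<or>
    (R = (Domain R \<times> Range R) \<inter> tau3_0 \<and> mu3 2 O R = tau3_0) \<or>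
    (R = (Domain R \<times> Range R) \<inter> tau3_1 \<and> mu3 2 O R = tau3_1) \<or>
    (R = (Domain R \<times> Range R) \<inter> tau3_0\<inverse> \<and> R O mu3 2 = tau3_0\<inverse>) \<or>
    (R = (Domain R \<times> Range R) \<inter> tau3_1\<inverse> \<and> R O mu3 2 = tau3_1\<inverse>)"
proof -
  note a = assms[unfolded rectangular_rel_def, rule_format]
  note a1 = a(1) and a2 = a(2) and a3 = a(3) and a4 = a(4)
  \<comment> \<open>The ground instances make the goal propositional; with the quantifiers expanded by
    the simplifier it is out of reach for \<open>argo\<close>.\<close>
  note i = a1[of 0 0 1 1] a1[of 0 0 1 2] a1[of 0 1 1 0] a1[of 0 1 1 2] a1[of 0 2 1 0] a1[of 0 2 1 1]
    a1[of 0 0 2 1] a1[of 0 0 2 2] a1[of 0 1 2 0] a1[of 0 1 2 2] a1[of 0 2 2 0] a1[of 0 2 2 1]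
    a1[of 1 0 0 1] a1[of 1 0 0 2] a1[of 1 1 0 0] a1[of 1 1 0 2] a1[of 1 2 0 0] a1[of 1 2 0 1]
    a1[of 1 0 2 1] a1[of 1 0 2 2] a1[of 1 1 2 0] a1[of 1 1 2 2] a1[of 1 2 2 0] a1[of 1 2 2 1]
    a1[of 2 0 0 1] a1[of 2 0 0 2] a1[of 2 1 0 0] a1[of 2 1 0 2] a1[of 2 2 0 0] a1[of 2 2 0 1]
    a1[of 2 0 1 1] a1[of 2 0 1 2] a1[of 2 1 1 0] a1[of 2 1 1 2] a1[of 2 2 1 0] a1[of 2 2 1 1]
    a2[of 0 0 2 1] a2[of 0 0 2 2] a2[of 0 1 2 0] a2[of 0 1 2 2] a2[of 0 2 2 0] a2[of 0 2 2 1]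
    a2[of 2 0 0 1] a2[of 2 0 0 2] a2[of 2 1 0 0] a2[of 2 1 0 2] a2[of 2 2 0 0] a2[of 2 2 0 1]
    a3[of 0 0 1 2] a3[of 0 2 1 0] a3[of 0 0 2 2] a3[of 0 2 2 0] a3[of 1 0 0 2] a3[of 1 2 0 0]
    a3[of 1 0 2 2] a3[of 1 2 2 0] a3[of 2 0 0 2] a3[of 2 2 0 0] a3[of 2 0 1 2] a3[of 2 2 1 0]
    a4[of 0 0 2 2] a4[of 0 2 2 0] a4[of 2 0 0 2] a4[of 2 2 0 0]
  note i' = i[unfolded relcomp_mu3_left relcomp_mu3_right]
  show ?thesis
    apply (simp only: rel_eq_iff all3)
    apply (simp only: relcomp_mu3_left relcomp_mu3_right Int_iff mem_Sigma_iff Domain_iff Range_iff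
        converse_iff pair_in_Id_conv mem_mu3_2 mem_rho3_2 mem_tau3_0 mem_tau3_1 mem_psi3_2 mem_psi3'_2
        ex3' distinct3 simp_thms)
    using i'
    apply argo
    done
qed

lemma two_arith1: "(a::2) \<noteq> b \<Longrightarrow> b \<noteq> e \<Longrightarrow> x \<noteq> e \<Longrightarrow> x = a - b + e"
  by (cases "a = 0"; cases "b = 0"; cases "e = 0"; cases "x = 0")
    (use ex2[of a] ex2[of b] ex2[of e] ex2[of x] in simp_all)

lemma two_arith2: "(u::2) \<noteq> u' \<Longrightarrow> p \<noteq> q \<Longrightarrow> u - p + q = u'"
  by (cases "u = 0"; cases "u' = 0"; cases "p = 0"; cases "q = 0")
    (use ex2[of u] ex2[of u'] ex2[of p] ex2[of q] in simp_all)

subsection \<open>Minimal failures of interpolation\<close>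

text \<open>That \<open>d\<close> is a term operation is expressed as closure of every
  \<open>term_ops ar F n\<close> under pointwise application of \<open>d\<close>, so that term
  operations can be combined by \<open>d\<close> directly.\<close>

locale malcev_alg =
  fixes ar :: "'i \<Rightarrow> nat" and F :: "'i \<Rightarrow> 'a list \<Rightarrow> 'a" and d :: "'a \<Rightarrow> 'a \<Rightarrow> 'a \<Rightarrow> 'a"
  assumes d_term: "\<lbrakk>g1 \<in> term_ops ar F n; g2 \<in> term_ops ar F n; g3 \<in> term_ops ar F n\<rbrakk> \<Longrightarrow>
      (\<lambda>xs. d (g1 xs) (g2 xs) (g3 xs)) \<in> term_ops ar F n"
    and d_right [simp]: "d y x x = y"
    and d_left [simp]: "d x x y = y"
begin

lemma d_bin:
  assumes "bin_rel R \<in> Inv ar F" "(x1, y1) \<in> R" "(x2, y2) \<in> R" "(x3, y3) \<in> R"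
  shows "(d x1 x2 x3, d y1 y2 y3) \<in> R"
proof -
  have "(\<lambda>xs. d (xs ! 0) (xs ! 1) (xs ! 2)) \<in> term_ops ar F 3"
    by (intro d_term term_ops.proj) auto
  from term_ops_preserve_bin[OF this assms(1), unfolded preserves_bin_rel, rule_format,
      of "[x1, x2, x3]" "[y1, y2, y3]"]
  show ?thesis using assms(2-4) by (auto simp: less_Suc_eq numeral_3_eq_3)
qed

lemma d_un:
  assumes "unary_rel S \<in> Inv ar F" "x1 \<in> S" "x2 \<in> S" "x3 \<in> S"
  shows "d x1 x2 x3 \<in> S"
proof -
  have "(\<lambda>xs. d (xs ! 0) (xs ! 1) (xs ! 2)) \<in> term_ops ar F 3"
    by (intro d_term term_ops.proj) auto
  from term_ops_preserve_unary[OF this assms(1), unfolded preserves_unary_rel, rule_format,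
      of "[x1, x2, x3]"]
  show ?thesis using assms(2-4) by auto
qed

lemma rectangular:
  assumes "bin_rel R \<in> Inv ar F" "(x, y) \<in> R" "(x', y) \<in> R" "(x', y') \<in> R"
  shows "(x, y') \<in> R"
  using d_bin[OF assms] by simp

end

text \<open>\<open>interp\<close> is the minimality of the failing set \<open>Y\<close>. In
  \<open>third\<close> the points \<open>y\<close> and \<open>z\<close> are arbitrary, so this one
  assumption yields that \<open>Y\<close> is nonempty, has a second element, and has a third
  one.\<close>

locale critical = malcev_alg ar F d
  for ar :: "'i \<Rightarrow> nat" and F :: "'i \<Rightarrow> 'a list \<Rightarrow> 'a" and d +
  fixes n :: nat and f :: "'a list \<Rightarrow> 'a" and Y :: "'a list set"
  assumes finite_Y: "finite Y"
    and len_Y: "y \<in> Y \<Longrightarrow> length y = n"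
    and no_interp: "g \<in> term_ops ar F n \<Longrightarrow> \<exists>y\<in>Y. g y \<noteq> f y"
    and interp: "y \<in> Y \<Longrightarrow> \<exists>g\<in>term_ops ar F n. \<forall>z\<in>Y - {y}. g z = f z"
    and third: "\<exists>w\<in>Y. w \<noteq> y \<and> w \<noteq> z"
begin

abbreviation "T \<equiv> term_ops ar F n"

definition B :: "'a list \<Rightarrow> 'a set" where
  "B y = {g y | g. g \<in> T}"

text \<open>With the term operations restricted to \<open>Y\<close> seen as a subpower of the algebra, \<open>\<theta> y\<close> is the
  congruence at coordinate \<open>y\<close> modulo which that subpower is saturated, and \<open>E y z\<close> contains the fork
  at \<open>y\<close>, so it covers the monolith of the section \<open>B y / \<theta> y\<close>.\<close>

definition K :: "'a list \<Rightarrow> 'a list set \<Rightarrow> ('a \<times> 'a) set" where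
  "K y Z = {(g y, g' y) | g g'. g \<in> T \<and> g' \<in> T \<and> (\<forall>x\<in>Y - Z. g x = g' x)}"

abbreviation "\<theta> y \<equiv> K y {y}"
abbreviation "E y z \<equiv> K y {y, z}"

lemma BI [intro]: "g \<in> T \<Longrightarrow> g y \<in> B y" by (auto simp: B_def)

lemma KI: "g \<in> T \<Longrightarrow> g' \<in> T \<Longrightarrow> (\<And>x. x \<in> Y \<Longrightarrow> x \<notin> Z \<Longrightarrow> g x = g' x) \<Longrightarrow> (g y, g' y) \<in> K y Z"
  by (auto simp: K_def)

lemma KE:
  assumes "(u, v) \<in> K y Z"
  obtains g g' where "g \<in> T" "g' \<in> T" "\<And>x. x \<in> Y \<Longrightarrow> x \<notin> Z \<Longrightarrow> g x = g' x" "g y = u" "g' y = v"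
  using assms by (auto simp: K_def)

lemma op_term:
  assumes "\<And>k. k < ar i \<Longrightarrow> G k \<in> T"
  shows "(\<lambda>xs. F i (map (\<lambda>k. G k xs) [0..<ar i])) \<in> T"
proof -
  have "(\<lambda>xs. F i (map (\<lambda>g. g xs) (map G [0..<ar i]))) \<in> T"
    by (rule term_ops.comp) (use assms in auto)
  then show ?thesis by (simp add: o_def)
qed

lemma map_upt_eq: "length xs = m \<Longrightarrow> (\<And>k. k < m \<Longrightarrow> G k = xs ! k) \<Longrightarrow> map G [0..<m] = xs"
  by (intro nth_equalityI) auto

lemma B_Inv: "unary_rel (B y) \<in> Inv ar F"
  unfolding subuniverse_iff[symmetric] subuniverse_def
proof clarify
  fix i xs assume xs: "length xs = ar i" "set xs \<subseteq> B y"
  then have "\<forall>k. \<exists>g. k < ar i \<longrightarrow> g \<in> T \<and> g y = xs ! k" 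
    by (smt (verit) B_def mem_Collect_eq nth_mem subsetD)
  then obtain G where G: "\<And>k. k < ar i \<Longrightarrow> G k \<in> T \<and> G k y = xs ! k" by metis
  have "(\<lambda>xs. F i (map (\<lambda>k. G k xs) [0..<ar i])) y \<in> B y" by (rule BI) (use G op_term in auto)
  moreover have "map (\<lambda>k. G k y) [0..<ar i] = xs" using xs G by (intro map_upt_eq) auto
  ultimately show "F i xs \<in> B y" by simp
qed

lemma K_Inv: "bin_rel (K y Z) \<in> Inv ar F"
proof (rule Inv_bin_relI)
  fix i xs ys assume l: "length xs = ar i" "length ys = ar i"
    and *: "\<And>k. k < ar i \<Longrightarrow> (xs ! k, ys ! k) \<in> K y Z"
  have "\<forall>k. \<exists>g g'. k < ar i \<longrightarrow> g \<in> T \<and> g' \<in> T \<and> (\<forall>x\<in>Y - Z. g x = g' x) \<and> g y = xs ! k \<and> g' y = ys ! k"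
    using * by (fastforce simp: K_def)
  then obtain G G' where G: "\<And>k. k < ar i \<Longrightarrow> G k \<in> T \<and> G' k \<in> T \<and> (\<forall>x\<in>Y - Z. G k x = G' k x)
      \<and> G k y = xs ! k \<and> G' k y = ys ! k" by metis
  have "((\<lambda>xs. F i (map (\<lambda>k. G k xs) [0..<ar i])) y, (\<lambda>xs. F i (map (\<lambda>k. G' k xs) [0..<ar i])) y) \<in> K y Z"
  proof (rule KI)
    fix x assume "x \<in> Y" "x \<notin> Z"
    then have "map (\<lambda>k. G k x) [0..<ar i] = map (\<lambda>k. G' k x) [0..<ar i]" using G by auto
    then show "F i (map (\<lambda>k. G k x) [0..<ar i]) = F i (map (\<lambda>k. G' k x) [0..<ar i])"
      by (rule arg_cong)
  qed (use G op_term in auto)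
  moreover have "map (\<lambda>k. G k y) [0..<ar i] = xs" "map (\<lambda>k. G' k y) [0..<ar i] = ys"
    using l G by (auto intro!: map_upt_eq)
  ultimately show "(F i xs, F i ys) \<in> K y Z" by simp
qed

lemma K_refl: "u \<in> B y \<Longrightarrow> (u, u) \<in> K y Z"
  by (auto simp: B_def intro: KI)

lemma K_sym: "(u, v) \<in> K y Z \<Longrightarrow> (v, u) \<in> K y Z"
  by (elim KE) (metis KI)

lemma K_B: "(u, v) \<in> K y Z \<Longrightarrow> u \<in> B y \<and> v \<in> B y"
  by (auto simp: K_def)

lemma K_trans: "(u, v) \<in> K y Z \<Longrightarrow> (v, w) \<in> K y Z \<Longrightarrow> (u, w) \<in> K y Z"
  using rectangular[OF K_Inv] K_refl K_B by metis

lemma K_mono: "Z \<subseteq> Z' \<Longrightarrow> K y Z \<subseteq> K y Z'"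
  by (auto simp: K_def)

text \<open>If \<open>h\<close> and \<open>h'\<close> witness the pair,
  \<open>d (g x) (h x) (h' x)\<close> is \<open>g x\<close> off \<open>y\<close>, where
  \<open>h\<close> and \<open>h'\<close> coincide, and is \<open>u\<close> at \<open>y\<close>,
  where \<open>h\<close> coincides with \<open>g\<close>.\<close>

lemma theta_closed:
  assumes "g \<in> T" "(g y, u) \<in> \<theta> y"
  obtains g' where "g' \<in> T" "g' y = u" "\<And>x. x \<in> Y \<Longrightarrow> x \<noteq> y \<Longrightarrow> g' x = g x"
proof -
  from assms(2) obtain h h' where h: "h \<in> T" "h' \<in> T" "\<And>x. x \<in> Y \<Longrightarrow> x \<notin> {y} \<Longrightarrow> h x = h' x"
    "h y = g y" "h' y = u" by (elim KE) blast
  show thesis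
    by (rule that[of "\<lambda>x. d (g x) (h x) (h' x)"]) (use h assms(1) d_term in auto)
qed

text \<open>By \<open>theta_closed\<close> the values of \<open>g\<close> can be corrected one
  coordinate at a time without disturbing the others. Hence it suffices to interpolate
  \<open>f\<close> modulo \<open>\<theta> x\<close> at each \<open>x\<close>.\<close>

lemma sweep:
  assumes "g \<in> T" "\<And>x. x \<in> Y \<Longrightarrow> (g x, f x) \<in> \<theta> x"
  shows False
proof -
  have "\<exists>h\<in>T. (\<forall>x\<in>X. h x = f x) \<and> (\<forall>x\<in>Y - X. h x = g x)" if "X \<subseteq> Y" for X
    using finite_subset[OF that finite_Y] that
  proof induction
    case empty
    then show ?case using assms(1) by auto
  next
    case (insert x X)
    then obtain h where h: "h \<in> T" "\<forall>x\<in>X. h x = f x" "\<forall>x\<in>Y - X. h x = g x" by auto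
    have "(h x, f x) \<in> \<theta> x" using insert assms(2)[of x] h(3) by auto
    then obtain h' where "h' \<in> T" "h' x = f x" "\<And>z. z \<in> Y \<Longrightarrow> z \<noteq> x \<Longrightarrow> h' z = h z"
      using theta_closed h(1) by metis
    moreover have "\<And>z. z \<in> X \<Longrightarrow> z \<in> Y \<and> z \<noteq> x" using insert by auto
    ultimately show ?case using h by (intro bexI[of _ h']) auto
  qed
  from this[of Y] no_interp show False by auto
qed

section \<open>Forks and the term condition\<close>

definition G :: "'a list \<Rightarrow> 'a list \<Rightarrow> 'a" where
  "G y = (SOME g. g \<in> T \<and> (\<forall>z\<in>Y - {y}. g z = f z))"

lemma G: "y \<in> Y \<Longrightarrow> G y \<in> T" "y \<in> Y \<Longrightarrow> z \<in> Y \<Longrightarrow> z \<noteq> y \<Longrightarrow> G y z = f z"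
proof -
  have *: "G y \<in> T \<and> (\<forall>z\<in>Y - {y}. G y z = f z)" if "y \<in> Y"
    using someI_ex[of "\<lambda>g. g \<in> T \<and> (\<forall>z\<in>Y - {y}. g z = f z)"] interp[OF that]
    unfolding G_def by blast
  show "y \<in> Y \<Longrightarrow> G y \<in> T" "y \<in> Y \<Longrightarrow> z \<in> Y \<Longrightarrow> z \<noteq> y \<Longrightarrow> G y z = f z"
    using * by auto
qed

lemma f_in_B: "y \<in> Y \<Longrightarrow> f y \<in> B y"
  using third[of y y] G by (metis BI)

text \<open>Otherwise \<open>theta_closed\<close> would change \<open>G y\<close> at
  \<open>y\<close> alone and produce a term operation equal to \<open>f\<close> on all of
  \<open>Y\<close>.\<close>

lemma fork_theta: "y \<in> Y \<Longrightarrow> (f y, G y y) \<notin> \<theta> y"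
proof
  assume y: "y \<in> Y" and "(f y, G y y) \<in> \<theta> y"
  then have "(G y y, f y) \<in> \<theta> y" using K_sym by blast
  then obtain g where "g \<in> T" "g y = f y" "\<And>x. x \<in> Y \<Longrightarrow> x \<noteq> y \<Longrightarrow> g x = G y x"
    using theta_closed G(1)[OF y] by metis
  then show False using no_interp G(2)[OF y] by metis
qed

text \<open>The witnesses are \<open>G z\<close> and \<open>G y\<close>: off \<open>{y, z}\<close>
  both equal \<open>f\<close>, and at \<open>y\<close> only \<open>G z\<close> is still right. The
  companion \<open>z\<close> is free, so the same fork is seen along different pairs of
  coordinates.\<close>

lemma fork_E: "y \<in> Y \<Longrightarrow> z \<in> Y \<Longrightarrow> y \<noteq> z \<Longrightarrow> (f y, G y y) \<in> E y z"
  using KI[of "G z" "G y" "{y, z}" y] G by auto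

text \<open>The invariant relation \<open>M4\<close> is the graph of \<open>d\<close> up to \<open>\<theta> y\<close>; its existence expresses that
  the congruence generated by the fork at \<open>y\<close> is abelian.\<close>

definition square :: "'a list \<Rightarrow> 'a list \<Rightarrow> 'a list \<Rightarrow> ('a list \<Rightarrow> 'a) \<Rightarrow> ('a list \<Rightarrow> 'a) \<Rightarrow>
    ('a list \<Rightarrow> 'a) \<Rightarrow> ('a list \<Rightarrow> 'a) \<Rightarrow> bool" where
  "square y z w g1 g2 g3 g4 \<longleftrightarrow> g1 \<in> T \<and> g2 \<in> T \<and> g3 \<in> T \<and> g4 \<in> T \<and>
     (\<forall>x\<in>Y - {y, w}. g1 x = g2 x) \<and> (\<forall>x\<in>Y - {y, w}. g3 x = g4 x) \<and>
     (\<forall>x\<in>Y - {y, z}. g1 x = g3 x) \<and> (\<forall>x\<in>Y - {y, z}. g2 x = g4 x)"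

definition M4 :: "'a list \<Rightarrow> 'a list \<Rightarrow> 'a list \<Rightarrow> 'a \<Rightarrow> 'a \<Rightarrow> 'a \<Rightarrow> 'a \<Rightarrow> bool" where
  "M4 y z w a b c e \<longleftrightarrow> (\<exists>g1 g2 g3 g4. square y z w g1 g2 g3 g4 \<and>
     g1 y = a \<and> g2 y = b \<and> g3 y = c \<and> g4 y = e)"

definition lift_op :: "'i \<Rightarrow> (nat \<Rightarrow> 'a list \<Rightarrow> 'a) \<Rightarrow> 'a list \<Rightarrow> 'a" where
  "lift_op i h = (\<lambda>xs. F i (map (\<lambda>k. h k xs) [0..<ar i]))"

lemma lift_op_T: "(\<And>k. k < ar i \<Longrightarrow> h k \<in> T) \<Longrightarrow> lift_op i h \<in> T"
  unfolding lift_op_def by (rule op_term)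

lemma lift_op_cong: "(\<And>k. k < ar i \<Longrightarrow> h k x = h' k x) \<Longrightarrow> lift_op i h x = lift_op i h' x"
  unfolding lift_op_def by (rule arg_cong[of _ _ "F i"]) simp

lemma lift_op_val: "length xs = ar i \<Longrightarrow> (\<And>k. k < ar i \<Longrightarrow> h k y = xs ! k) \<Longrightarrow> lift_op i h y = F i xs"
  unfolding lift_op_def by (rule arg_cong[of _ _ "F i"]) (rule map_upt_eq)

lemma square_op:
  assumes "\<And>k. k < ar i \<Longrightarrow> square y z w (g1 k) (g2 k) (g3 k) (g4 k)"
  shows "square y z w (lift_op i g1) (lift_op i g2) (lift_op i g3) (lift_op i g4)"
  unfolding square_def
  by (intro conjI ballI lift_op_T lift_op_cong) (use assms in \<open>simp_all add: square_def\<close>)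

lemma M4_op:
  assumes l: "length as = ar i" "length bs = ar i" "length cs = ar i" "length es = ar i"
    and *: "\<And>k. k < ar i \<Longrightarrow> M4 y z w (as ! k) (bs ! k) (cs ! k) (es ! k)"
  shows "M4 y z w (F i as) (F i bs) (F i cs) (F i es)"
proof -
  obtain g1 g2 g3 g4 where g: "\<And>k. k < ar i \<Longrightarrow> square y z w (g1 k) (g2 k) (g3 k) (g4 k) \<and>
     g1 k y = as ! k \<and> g2 k y = bs ! k \<and> g3 k y = cs ! k \<and> g4 k y = es ! k"
    using *[unfolded M4_def] by metis
  have "square y z w (lift_op i g1) (lift_op i g2) (lift_op i g3) (lift_op i g4)"
    by (rule square_op) (use g in blast)
  moreover have "lift_op i g1 y = F i as" "lift_op i g2 y = F i bs"
    "lift_op i g3 y = F i cs" "lift_op i g4 y = F i es"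
    using g by (auto intro!: lift_op_val l)
  ultimately show ?thesis unfolding M4_def by blast
qed

lemma M4I: "square y z w g1 g2 g3 g4 \<Longrightarrow> M4 y z w (g1 y) (g2 y) (g3 y) (g4 y)"
  unfolding M4_def by blast

text \<open>Let \<open>r\<close>, \<open>r'\<close> witness the first pair and \<open>s\<close>,
  \<open>s'\<close> the second. The corners are \<open>r\<close>, \<open>d r s s'\<close>,
  \<open>r'\<close>, \<open>d r' s s'\<close> (pointwise): replacing \<open>r\<close> by
  \<open>r'\<close> acts only on \<open>{y, z}\<close>, and applying \<open>s\<close>,
  \<open>s'\<close> acts only on \<open>{y, w}\<close>.\<close>

lemma M4_ex:
  assumes "(a, c) \<in> E y z" "(a, b) \<in> E y w" "y \<noteq> z" "y \<noteq> w" "z \<noteq> w"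
  shows "M4 y z w a b c (d c a b)"
proof -
  from assms(1) obtain r r' where r: "r \<in> T" "r' \<in> T" "\<And>x. x \<in> Y \<Longrightarrow> x \<notin> {y, z} \<Longrightarrow> r x = r' x"
    "r y = a" "r' y = c" by (elim KE) blast
  from assms(2) obtain s s' where s: "s \<in> T" "s' \<in> T" "\<And>x. x \<in> Y \<Longrightarrow> x \<notin> {y, w} \<Longrightarrow> s x = s' x"
    "s y = a" "s' y = b" by (elim KE) blast
  have "square y z w r (\<lambda>x. d (r x) (s x) (s' x)) r' (\<lambda>x. d (r' x) (s x) (s' x))"
    unfolding square_def using r s d_term by auto
  from M4I[OF this] show ?thesis using r s by simp
qed

text \<open>At \<open>w\<close> the first and third corners agree, as do the second and fourth; at
  any other point off \<open>y\<close> the first and second agree, as do the third and fourth.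
  Either way \<open>d\<close> of the first three corners is the fourth, so the two can differ only
  at \<open>y\<close>. Here \<open>z \<noteq> w\<close> is essential.\<close>

lemma M4_d:
  assumes "M4 y z w a b c e" "y \<noteq> z" "y \<noteq> w" "z \<noteq> w"
  shows "(d b a c, e) \<in> \<theta> y"
proof -
  from assms(1) obtain g1 g2 g3 g4 where sq: "square y z w g1 g2 g3 g4"
    and v: "g1 y = a" "g2 y = b" "g3 y = c" "g4 y = e"
    unfolding M4_def by blast
  note g = sq[unfolded square_def]
  have "((\<lambda>x. d (g2 x) (g1 x) (g3 x)) y, g4 y) \<in> \<theta> y"
  proof (rule KI)
    fix x assume x: "x \<in> Y" "x \<notin> {y}"
    show "d (g2 x) (g1 x) (g3 x) = g4 x"
    proof (cases "x = w")
      case True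
      then show ?thesis using g x assms by simp
    next
      case False
      then show ?thesis using g x assms by simp
    qed
  qed (use g d_term in auto)
  then show ?thesis using v by simp
qed

lemma d_theta: "(x1, y1) \<in> \<theta> y \<Longrightarrow> (x2, y2) \<in> \<theta> y \<Longrightarrow> (x3, y3) \<in> \<theta> y \<Longrightarrow>
    (d x1 x2 x3, d y1 y2 y3) \<in> \<theta> y"
  by (rule d_bin[OF K_Inv])

text \<open>\<open>M4_ex\<close> makes the last corner \<open>d c a b\<close>, and
  \<open>M4_d\<close> computes it as \<open>d b a c\<close>.\<close>

lemma d_comm:
  assumes "(a, c) \<in> E y z" "(a, b) \<in> E y w" "y \<noteq> z" "y \<noteq> w" "z \<noteq> w"
  shows "(d b a c, d c a b) \<in> \<theta> y"
  using M4_d[OF M4_ex[OF assms] assms(3-)] .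

lemma M4_flip:
  "M4 y z w a b c e \<Longrightarrow> M4 y z w c e a b"
  unfolding M4_def square_def by (elim exE conjE) (intro exI conjI; assumption?; simp)

text \<open>Translation by \<open>(e, g)\<close> carries the side \<open>a\<close>, \<open>b\<close>
  of a square to the opposite side. Reading the square from that side, \<open>M4_d\<close> recovers
  \<open>b\<close> from \<open>a\<close> and the two translates; when the translates are congruent,
  the recovered value is \<open>a\<close>.\<close>

lemma d_cancel:
  assumes "(e, g) \<in> E y z" "(a, b) \<in> E y w" "y \<noteq> z" "y \<noteq> w" "z \<noteq> w"
    and "(d a e g, d b e g) \<in> \<theta> y"
  shows "(a, b) \<in> \<theta> y"
proof -
  from assms(1) obtain r r' where r: "r \<in> T" "r' \<in> T" "\<And>x. x \<in> Y \<Longrightarrow> x \<notin> {y, z} \<Longrightarrow> r x = r' x"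
    "r y = e" "r' y = g" by (elim KE) blast
  from assms(2) obtain s s' where s: "s \<in> T" "s' \<in> T" "\<And>x. x \<in> Y \<Longrightarrow> x \<notin> {y, w} \<Longrightarrow> s x = s' x"
    "s y = a" "s' y = b" by (elim KE) blast
  have "square y z w s s' (\<lambda>x. d (s x) (r x) (r' x)) (\<lambda>x. d (s' x) (r x) (r' x))"
    unfolding square_def using r s d_term by auto
  from M4I[OF this] have "M4 y z w a b (d a e g) (d b e g)" using r s by simp
  from M4_d[OF M4_flip[OF this] assms(3-5)]
  have 1: "(d (d b e g) (d a e g) a, b) \<in> \<theta> y" .
  have "(d (d b e g) (d a e g) a, d (d b e g) (d b e g) a) \<in> \<theta> y"
    by (rule d_theta[OF K_refl assms(6) K_refl]) (use K_B[OF assms(6)] K_B[OF assms(2)] in auto)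
  then have "(d (d b e g) (d a e g) a, a) \<in> \<theta> y" by simp
  then show ?thesis using 1 K_trans K_sym by blast
qed

section \<open>Simultaneous moves at two coordinates\<close>

definition link :: "'a list \<Rightarrow> 'a list \<Rightarrow> ('a list \<Rightarrow> 'a) \<Rightarrow> ('a list \<Rightarrow> 'a) \<Rightarrow> bool" where
  "link y z g g' \<longleftrightarrow> g \<in> T \<and> g' \<in> T \<and> (\<forall>x\<in>Y - {y, z}. g x = g' x)"

text \<open>A step from \<open>u\<close> to \<open>u'\<close> at \<open>y\<close> accompanied by a
  step from \<open>v\<close> to \<open>v'\<close> at \<open>z\<close>. \<open>L\<close> is
  compatible with the operations and one step is trivial modulo \<open>\<theta>\<close> iff the
  other is; invariant relations between \<open>B y\<close> and \<open>B z\<close> are obtained from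
  this.\<close>

definition L :: "'a list \<Rightarrow> 'a list \<Rightarrow> 'a \<Rightarrow> 'a \<Rightarrow> 'a \<Rightarrow> 'a \<Rightarrow> bool" where
  "L y z u u' v v' \<longleftrightarrow> (\<exists>g g'. link y z g g' \<and> g y = u \<and> g' y = u' \<and> g z = v \<and> g' z = v')"

lemma LI: "link y z g g' \<Longrightarrow> L y z (g y) (g' y) (g z) (g' z)"
  unfolding L_def by blast

lemma L_op:
  assumes l: "length as = ar i" "length bs = ar i" "length cs = ar i" "length es = ar i"
    and *: "\<And>k. k < ar i \<Longrightarrow> L y z (as ! k) (bs ! k) (cs ! k) (es ! k)"
  shows "L y z (F i as) (F i bs) (F i cs) (F i es)"
proof -
  obtain g g' where g: "\<And>k. k < ar i \<Longrightarrow> link y z (g k) (g' k) \<and>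
     g k y = as ! k \<and> g' k y = bs ! k \<and> g k z = cs ! k \<and> g' k z = es ! k"
    using *[unfolded L_def] by metis
  have "link y z (lift_op i g) (lift_op i g')"
    unfolding link_def
    by (intro conjI ballI lift_op_T lift_op_cong) (use g in \<open>simp_all add: link_def\<close>)
  moreover have "lift_op i g y = F i as" "lift_op i g' y = F i bs"
    "lift_op i g z = F i cs" "lift_op i g' z = F i es"
    using g by (auto intro!: lift_op_val l)
  ultimately show ?thesis unfolding L_def by blast
qed

lemma L_sym: "L y z u u' v v' \<Longrightarrow> L z y v v' u u'"
  unfolding L_def link_def insert_commute[of y z] by blast

text \<open>If the step at \<open>y\<close> is trivial, \<open>theta_closed\<close> performs it
  alone; the result then differs from \<open>g'\<close> at most at \<open>z\<close>.\<close>

lemma L_theta1: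
  assumes "L y z u u' v v'" "y \<noteq> z" "(u, u') \<in> \<theta> y" "z \<in> Y"
  shows "(v, v') \<in> \<theta> z"
proof -
  from assms(1) obtain g g' where g: "g \<in> T" "g' \<in> T" "g y = u" "g' y = u'" "g z = v" "g' z = v'"
    "\<And>x. x \<in> Y - {y, z} \<Longrightarrow> g x = g' x" unfolding L_def link_def by metis
  obtain h where h: "h \<in> T" "h y = u'" "\<And>x. x \<in> Y \<Longrightarrow> x \<noteq> y \<Longrightarrow> h x = g x"
    using theta_closed[of g y u'] g assms(3) by metis
  have "(h z, g' z) \<in> \<theta> z"
  proof (rule KI)
    fix x assume "x \<in> Y" "x \<notin> {z}"
    then show "h x = g' x" using h g by (cases "x = y") auto
  qed (use h g in auto)
  then show ?thesis using assms(4) h g assms(2) by simp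
qed

lemma L_theta:
  assumes "L y z u u' v v'" "y \<noteq> z" "y \<in> Y" "z \<in> Y"
  shows "(u, u') \<in> \<theta> y \<longleftrightarrow> (v, v') \<in> \<theta> z"
  using L_theta1[OF assms(1)] L_theta1[OF L_sym[OF assms(1)]] assms(2-) by blast

lemma L_B: "L y z u u' v v' \<Longrightarrow> u \<in> B y \<and> u' \<in> B y \<and> v \<in> B z \<and> v' \<in> B z"
  unfolding L_def link_def by blast

text \<open>With witnesses \<open>h\<close>, \<open>h'\<close> of the pair at \<open>z\<close>, the
  operation \<open>d g h h'\<close> differs from \<open>g\<close> only at \<open>z\<close>: the last
  hypothesis protects the value at \<open>y\<close>, the other witness coordinate.\<close>

lemma E_trivial:
  assumes "y \<in> Y" "z \<in> Y" "y \<noteq> z" "g \<in> T" "(g z, v) \<in> E z y"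
    and "\<And>p p'. (p, p') \<in> E y z \<Longrightarrow> d (g y) p p' = g y"
  shows "(g z, v) \<in> \<theta> z"
proof -
  from assms(5) obtain h h' where h: "h \<in> T" "h' \<in> T" "\<And>x. x \<in> Y \<Longrightarrow> x \<notin> {z, y} \<Longrightarrow> h x = h' x"
    "h z = g z" "h' z = v" by (elim KE) blast
  have *: "d (g y) (h y) (h' y) = g y"
    by (rule assms(6), rule KI) (use h in auto)
  have "(g z, (\<lambda>x. d (g x) (h x) (h' x)) z) \<in> \<theta> z"
  proof (rule KI)
    fix x assume "x \<in> Y" "x \<notin> {z}"
    then show "g x = d (g x) (h x) (h' x)" using * h(3)[of x] by (cases "x = y") auto
  qed (use h assms d_term in auto)
  then show ?thesis using h by simp
qed

section \<open>Coordinates whose section has two classes\<close>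

definition section_at :: "'a list \<Rightarrow> ('a \<Rightarrow> 2) \<Rightarrow> bool" where
  "section_at y c \<longleftrightarrow> (\<forall>u\<in>B y. \<forall>v\<in>B y. (u, v) \<in> \<theta> y \<longleftrightarrow> c u = c v)"

lemma section_atD: "section_at y c \<Longrightarrow> u \<in> B y \<Longrightarrow> v \<in> B y \<Longrightarrow> (u, v) \<in> \<theta> y \<longleftrightarrow> c u = c v"
  unfolding section_at_def by blast

text \<open>The fork takes both values of \<open>c\<close>, so \<open>B y\<close> modulo
  \<open>\<theta> y\<close> has exactly two classes and \<open>c\<close> is a coordinate on it over
  the integers mod 2.\<close>

lemma section_fork:
  assumes "section_at y c" "y \<in> Y"
  shows "c (f y) \<noteq> c (G y y)"
  using section_atD[OF assms(1) f_in_B BI] fork_theta assms G by blast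

lemma neq2: "(a::2) \<noteq> b \<Longrightarrow> x = a \<or> x = b"
  using ex2[of a] ex2[of b] ex2[of x] by auto

lemma section_E:
  assumes "section_at y c" "y \<in> Y" "z \<in> Y" "y \<noteq> z" "u \<in> B y" "v \<in> B y"
  shows "(u, v) \<in> E y z"
proof -
  have fy: "f y \<in> B y" "G y y \<in> B y" using f_in_B G assms(2) by auto
  have E: "(f y, G y y) \<in> E y z" using fork_E assms by blast
  have \<theta>E: "\<theta> y \<subseteq> E y z" by (rule K_mono) auto
  have "(u, f y) \<in> E y z" if "u \<in> B y" for u
  proof -
    have "c u = c (f y) \<or> c u = c (G y y)" using neq2 section_fork[OF assms(1,2)] by blast
    then have "(u, f y) \<in> \<theta> y \<or> (u, G y y) \<in> \<theta> y"
      using section_atD[OF assms(1)] fy that by blast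
    then show ?thesis using E \<theta>E K_trans K_sym by blast
  qed
  then show ?thesis using assms(5,6) K_trans K_sym by blast
qed

lemma three:
  assumes "y \<in> Y"
  obtains z w where "z \<in> Y" "w \<in> Y" "y \<noteq> z" "y \<noteq> w" "z \<noteq> w"
  using third[of y y] third[of y] by metis

lemma B_d: "x1 \<in> B y \<Longrightarrow> x2 \<in> B y \<Longrightarrow> x3 \<in> B y \<Longrightarrow> d x1 x2 x3 \<in> B y"
  by (rule d_un[OF B_Inv])

text \<open>The Mal'cev identities fix \<open>d\<close> on two classes except where the middle class
  differs from the two equal outer ones. There \<open>d_cancel\<close>, applied against
  \<open>d x2 x2 x3\<close>, excludes the outer class, so \<open>d\<close> acts as minority.\<close>

lemma section_d:
  assumes s: "section_at y c" and y: "y \<in> Y" and x: "x1 \<in> B y" "x2 \<in> B y" "x3 \<in> B y"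
  shows "c (d x1 x2 x3) = c x1 - c x2 + c x3"
proof -
  have c: "c u = c v" if "(u, v) \<in> \<theta> y" for u v
    using section_atD[OF s] that K_B by blast
  have \<theta>: "(u, v) \<in> \<theta> y" if "c u = c v" "u \<in> B y" "v \<in> B y" for u v
    using section_atD[OF s] that by blast
  have left: "c (d a b e) = c e" if "c a = c b" "a \<in> B y" "b \<in> B y" "e \<in> B y" for a b e
    using d_theta[OF \<theta>[OF that(1-3)] K_refl K_refl, of b e] that c[of "d a b e" "d b b e"] by simp
  have right: "c (d a b e) = c a" if "c b = c e" "a \<in> B y" "b \<in> B y" "e \<in> B y" for a b e
    using d_theta[OF K_refl \<theta>[OF that(1) that(3,4)] K_refl, of a e] that c[of "d a b e" "d a e e"] by simp
  show ?thesis
  proof (cases "c x1 = c x2 \<or> c x2 = c x3")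
    case True
    then show ?thesis using left right x by auto
  next
    case False
    have "c (d x1 x2 x3) \<noteq> c x3"
    proof
      assume "c (d x1 x2 x3) = c x3"
      obtain z w where zw: "z \<in> Y" "w \<in> Y" "y \<noteq> z" "y \<noteq> w" "z \<noteq> w" using three[OF y] .
      have "(d x1 x2 x3, d x2 x2 x3) \<in> \<theta> y"
        using \<theta> B_d x \<open>c (d x1 x2 x3) = c x3\<close> by simp
      then have "(x1, x2) \<in> \<theta> y"
        using d_cancel[OF section_E[OF s y zw(1,3) x(2,3)] section_E[OF s y zw(2,4) x(1,2)] zw(3-5)]
        by blast
      then show False using c False by blast
    qed
    then show ?thesis using False by (intro two_arith1) auto
  qed
qed

text \<open>\<open>M4\<close> is compatible and contains the parallelograms of arguments, so it
  contains the square of values; \<open>M4_d\<close> and \<open>section_d\<close> then evaluate its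
  fourth corner.\<close>

lemma section_affine:
  assumes s: "section_at y c" and y: "y \<in> Y"
    and l: "length xs = ar i" "length ys = ar i" "length zs = ar i" "length us = ar i"
    and b: "set xs \<subseteq> B y" "set ys \<subseteq> B y" "set zs \<subseteq> B y" "set us \<subseteq> B y"
    and *: "\<And>k. k < ar i \<Longrightarrow> c (us ! k) = c (xs ! k) - c (ys ! k) + c (zs ! k)"
  shows "c (F i us) = c (F i xs) - c (F i ys) + c (F i zs)"
proof -
  obtain z w where zw: "z \<in> Y" "w \<in> Y" "y \<noteq> z" "y \<noteq> w" "z \<noteq> w" using three[OF y] .
  \<comment> \<open>\<open>us\<close> is a fourth corner only modulo \<open>\<theta> y\<close>;
    \<open>vs\<close> is the one that \<open>M4_ex\<close> provides, with congruent value.\<close>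
  define vs where "vs = map (\<lambda>k. d (zs ! k) (ys ! k) (xs ! k)) [0..<ar i]"
  have M: "M4 y z w (F i ys) (F i xs) (F i zs) (F i vs)"
  proof (rule M4_op)
    fix k assume k: "k < ar i"
    then have "xs ! k \<in> B y" "ys ! k \<in> B y" "zs ! k \<in> B y" using l b by auto
    then show "M4 y z w (ys ! k) (xs ! k) (zs ! k) (vs ! k)"
      unfolding vs_def using k zw s y by (simp add: M4_ex section_E)
  qed (use l in \<open>auto simp: vs_def\<close>)
  have vB: "vs ! k \<in> B y" "(vs ! k, us ! k) \<in> \<theta> y" if "k < ar i" for k
  proof -
    have B: "xs ! k \<in> B y" "ys ! k \<in> B y" "zs ! k \<in> B y" "us ! k \<in> B y" using l b that by auto
    then show vB: "vs ! k \<in> B y" unfolding vs_def using that B_d by simp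
    have "c (vs ! k) = c (us ! k)" unfolding vs_def using that B section_d[OF s y] *[OF that] by simp
    then show "(vs ! k, us ! k) \<in> \<theta> y" using vB B section_atD[OF s] by blast
  qed
  have FB: "F i ws \<in> B y" if "length ws = ar i" "set ws \<subseteq> B y" for ws
    using B_Inv that unfolding subuniverse_iff[symmetric] subuniverse_def by blast
  have vs: "set vs \<subseteq> B y" using vB(1) by (auto simp: in_set_conv_nth vs_def)
  have "(F i vs, F i us) \<in> \<theta> y"
    using InvD[OF K_Inv[of y "{y}"], of i] vB(2) l unfolding preserves_bin_rel by (simp add: vs_def)
  then have "c (F i us) = c (F i vs)" using section_atD[OF s] K_B by metis
  also have "\<dots> = c (d (F i xs) (F i ys) (F i zs))"
    using M4_d[OF M zw(3-5)] section_atD[OF s] K_B by metis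
  also have "\<dots> = c (F i xs) - c (F i ys) + c (F i zs)"
    by (rule section_d[OF s y]) (use FB l b in auto)
  finally show ?thesis .
qed

text \<open>Steps at \<open>y\<close> and \<open>z\<close> are both trivial or both proper by the
  last hypothesis. \<open>val\<close> adjusts values inside classes for free, so it suffices to
  reach every pair of classes and to switch both classes at once; the forks at \<open>y\<close> and
  \<open>z\<close> do this.\<close>

lemma section_L:
  assumes s: "section_at y c" "section_at z c'" and y: "y \<in> Y" "z \<in> Y" "y \<noteq> z"
    and b: "u \<in> B y" "u' \<in> B y" "v \<in> B z" "v' \<in> B z"
    and *: "c u - c u' = c' v - c' v'"
  shows "L y z u u' v v'"
proof -
  have val: "\<exists>h\<in>T. h y = p \<and> h z = q \<and> (\<forall>x\<in>Y - {y, z}. h x = g x)"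
    if "g \<in> T" "c (g y) = c p" "c' (g z) = c' q" "p \<in> B y" "q \<in> B z" for g p q
  proof -
    have "(g y, p) \<in> \<theta> y" using section_atD[OF s(1) BI[OF that(1)] that(4)] that(2) by simp
    from theta_closed[OF that(1) this]
    obtain h where h: "h \<in> T" "h y = p" "\<And>x. x \<in> Y \<Longrightarrow> x \<noteq> y \<Longrightarrow> h x = g x" by blast
    have "h z = g z" using h(3)[OF y(2)] y(3) by simp
    then have "(h z, q) \<in> \<theta> z" using section_atD[OF s(2) BI[OF h(1)] that(5)] that(3) by simp
    from theta_closed[OF h(1) this]
    obtain h' where h': "h' \<in> T" "h' z = q" "\<And>x. x \<in> Y \<Longrightarrow> x \<noteq> z \<Longrightarrow> h' x = h x" by blast
    have "h' y = p" using h'(3)[OF y(1,3)] h(2) by simp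
    moreover have "\<forall>x\<in>Y - {y, z}. h' x = g x" using h h' by simp
    ultimately show ?thesis using h' by blast
  qed
  obtain w where w: "w \<in> Y" "w \<noteq> y" "w \<noteq> z" using third[of y z] by blast
  have GT: "G y \<in> T" "G z \<in> T" "G w \<in> T" using G w y by auto
  have Gv: "G y z = f z" "G z y = f y" "G w y = f y" "G w z = f z" using G w y by auto
  have Bs: "f y \<in> B y" "G y y \<in> B y" "f z \<in> B z" "G z z \<in> B z" using f_in_B GT y by auto
  have c: "c (f y) \<noteq> c (G y y)" "c' (f z) \<noteq> c' (G z z)" using section_fork s y by auto
  have "\<exists>h\<in>T. c (h y) = c u \<and> c' (h z) = c' v"
  proof -
    have e: "c u = c (f y) \<or> c u = c (G y y)" "c' v = c' (f z) \<or> c' v = c' (G z z)"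
      using neq2[OF c(1)] neq2[OF c(2)] by simp_all
    have T: "(\<lambda>x. d (G y x) (G w x) (G z x)) \<in> T" using GT d_term by auto
    consider "c u = c (f y)" "c' v = c' (f z)" | "c u = c (f y)" "c' v = c' (G z z)"
      | "c u = c (G y y)" "c' v = c' (f z)" | "c u = c (G y y)" "c' v = c' (G z z)" using e by blast
    then show ?thesis
    proof cases
      case 1 then show ?thesis using GT Gv by (intro bexI[of _ "G w"]) simp_all
    next
      case 2 then show ?thesis using GT Gv by (intro bexI[of _ "G z"]) simp_all
    next
      case 3 then show ?thesis using GT Gv by (intro bexI[of _ "G y"]) simp_all
    next
      case 4 then show ?thesis using Gv by (intro bexI[OF _ T]) simp
    qed
  qed
  then obtain g0 where g0: "g0 \<in> T" "c (g0 y) = c u" "c' (g0 z) = c' v" by blast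
  obtain g where g: "g \<in> T" "g y = u" "g z = v" using val[OF g0 b(1,3)] by blast
  have "\<exists>h\<in>T. c (h y) = c u' \<and> c' (h z) = c' v' \<and> (\<forall>x\<in>Y - {y, z}. h x = g x)"
  proof (cases "c u = c u'")
    case True
    then have "c' v = c' v'" using * by simp
    then show ?thesis using True g by auto
  next
    case False
    then have F2: "c' v \<noteq> c' v'" using * by auto
    \<comment> \<open>\<open>G z\<close> and \<open>G y\<close> agree off \<open>{y, z}\<close> and
      lie in different classes at \<open>y\<close> and at \<open>z\<close>, so this translate of
      \<open>g\<close> switches both classes and changes nothing else.\<close>
    have T: "(\<lambda>x. d (g x) (G z x) (G y x)) \<in> T" using GT g d_term by auto
    have "c (d u (f y) (G y y)) = c u - c (f y) + c (G y y)" using section_d[OF s(1) y(1)] b Bs by blast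
    also have "\<dots> = c u'"
      using False c by (intro two_arith2) auto
    finally have 1: "c (d u (f y) (G y y)) = c u'" .
    have "c' (d v (G z z) (f z)) = c' v - c' (G z z) + c' (f z)" using section_d[OF s(2) y(2)] b Bs by blast
    also have "\<dots> = c' v'"
      using F2 c by (intro two_arith2) auto
    finally have 2: "c' (d v (G z z) (f z)) = c' v'" .
    show ?thesis
      by (rule bexI[OF _ T]) (use 1 2 g Gv G y in auto)
  qed
  then obtain h where h: "h \<in> T" "c (h y) = c u'" "c' (h z) = c' v'" "\<forall>x\<in>Y - {y, z}. h x = g x"
    by blast
  obtain g' where g': "g' \<in> T" "g' y = u'" "g' z = v'" "\<forall>x\<in>Y - {y, z}. g' x = h x"
    using val[OF h(1-3) b(2,4)] by blast
  have "link y z g g'" unfolding link_def using g g' h by auto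
  from LI[OF this] show ?thesis using g g' by simp
qed

end

subsection \<open>Affine functions\<close>

text \<open>The error of a member of \<open>\<Gamma>\<close> against \<open>\<phi>\<close> is again
  affine. Since every scalar is a multiple of 1, agreement at the constants 0 and 1 extends to all
  constant vectors; after that, multiples of \<open>b k - b l\<close>, which vanish on constants,
  remove the error coordinate by coordinate.\<close>

lemma affine_interpolation:
  fixes \<phi> :: "(nat \<Rightarrow> 'r::comm_ring_1) \<Rightarrow> 'r" and \<Gamma> :: "((nat \<Rightarrow> 'r) \<Rightarrow> 'r) set"
  assumes gen: "\<And>x::'r. \<exists>k. x = of_nat k"
    and S: "finite S" "s \<in> S"
    and dep: "\<And>\<gamma> b b'. \<gamma> \<in> insert \<phi> \<Gamma> \<Longrightarrow> (\<And>k. k \<in> S \<Longrightarrow> b k = b' k) \<Longrightarrow> \<gamma> b = \<gamma> b'"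
    and aff: "\<And>\<gamma> a b c. \<gamma> \<in> insert \<phi> \<Gamma> \<Longrightarrow> \<gamma> (\<lambda>k. a k - b k + c k) = \<gamma> a - \<gamma> b + \<gamma> c"
    and step: "\<And>\<gamma> k l. \<gamma> \<in> \<Gamma> \<Longrightarrow> k \<in> S \<Longrightarrow> l \<in> S \<Longrightarrow> (\<lambda>b. \<gamma> b + b k - b l) \<in> \<Gamma>"
    and base: "\<gamma>0 \<in> \<Gamma>" "\<gamma>0 (\<lambda>_. 0) = \<phi> (\<lambda>_. 0)" "\<gamma>0 (\<lambda>_. 1) = \<phi> (\<lambda>_. 1)"
  shows "\<phi> \<in> \<Gamma>"
proof -
  have steps: "(\<lambda>b. \<gamma> b + of_nat m * (b k - b l)) \<in> \<Gamma>" if "\<gamma> \<in> \<Gamma>" "k \<in> S" "l \<in> S" for \<gamma> k l m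
  proof (induction m)
    case (Suc m)
    from step[OF this that(2,3)] show ?case by (simp add: algebra_simps)
  qed (use that in simp)
  define D where "D \<gamma> b = \<phi> b - \<gamma> b" for \<gamma> b
  have affD: "D \<gamma> (\<lambda>k. a k - b k + c k) = D \<gamma> a - D \<gamma> b + D \<gamma> c" if "\<gamma> \<in> \<Gamma>" for \<gamma> a b c
    using aff[of \<phi>] aff[of \<gamma>] that by (simp add: D_def)
  have line: "D \<gamma> (\<lambda>k. x * e k) = 0" if "\<gamma> \<in> \<Gamma>" "D \<gamma> (\<lambda>_. 0) = 0" "D \<gamma> e = 0" for \<gamma> x e
  proof -
    have "D \<gamma> (\<lambda>k. of_nat m * e k) = 0" for m
    proof (induction m)
      case (Suc m)
      have "D \<gamma> (\<lambda>k. of_nat m * e k - 0 + e k) = 0"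
        using affD[OF that(1), of "\<lambda>k. of_nat m * e k" "\<lambda>_. 0" e] Suc that by simp
      then show ?case by (simp add: algebra_simps)
    qed (use that in simp)
    then show ?thesis using gen[of x] by auto
  qed
  have zero: "D \<gamma>0 (\<lambda>_. 0) = 0" using base by (simp add: D_def)
  have const0: "D \<gamma>0 (\<lambda>_. x) = 0" for x
    using line[OF base(1) zero, of "\<lambda>_. 1" x] base by (simp add: D_def)
  \<comment> \<open>\<open>U\<close> is the set of coordinates already freed from being equal to the
    reference coordinate \<open>s\<close>; \<open>U = {}\<close> is the diagonal.\<close>
  have "\<exists>\<gamma>\<in>\<Gamma>. \<forall>b. (\<forall>k\<in>S - U. b k = b s) \<longrightarrow> D \<gamma> b = 0" if "U \<subseteq> S - {s}" for U
  proof -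
    have "finite U" using that S finite_subset by blast
    then show ?thesis using that
    proof (induction U)
      case empty
      have "D \<gamma>0 b = 0" if "\<forall>k\<in>S. b k = b s" for b
      proof -
        have "\<gamma> b = \<gamma> (\<lambda>_. b s)" if "\<gamma> \<in> insert \<phi> \<Gamma>" for \<gamma>
          by (rule dep[OF that]) (use \<open>\<forall>k\<in>S. b k = b s\<close> in blast)
        then have "\<phi> b = \<phi> (\<lambda>_. b s)" "\<gamma>0 b = \<gamma>0 (\<lambda>_. b s)" using base(1) by blast+
        with const0[of "b s"] show ?thesis by (simp add: D_def)
      qed
      then show ?case using base by auto
    next
      case (insert j U)
      then obtain \<gamma> where \<gamma>: "\<gamma> \<in> \<Gamma>" "\<And>b. (\<forall>k\<in>S - U. b k = b s) \<Longrightarrow> D \<gamma> b = 0" by auto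
      have j: "j \<in> S" "j \<noteq> s" "j \<notin> U" using insert by auto
      define e where "e = (\<lambda>k. if k = j then 1 else 0 :: 'r)"
      \<comment> \<open>\<open>m\<close> is the error on the unit vector at \<open>j\<close>. The
        correction by \<open>m\<close> times \<open>b j - b s\<close> removes it and vanishes
        wherever \<open>b j = b s\<close>, so agreement obtained for \<open>U\<close>
        survives.\<close>
      obtain m where m: "D \<gamma> e = of_nat m" using gen by blast
      define \<gamma>' where "\<gamma>' = (\<lambda>b. \<gamma> b + of_nat m * (b j - b s))"
      have \<gamma>': "\<gamma>' \<in> \<Gamma>" unfolding \<gamma>'_def by (rule steps) (use \<gamma> j S in auto)
      have old: "D \<gamma>' b = 0" if "\<forall>k\<in>S - U. b k = b s" for b
        using \<gamma>(2)[OF that] that j by (simp add: D_def \<gamma>'_def)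
      have const: "D \<gamma>' (\<lambda>_. x) = 0" for x by (rule old) simp
      have "D \<gamma>' e = D \<gamma> e - of_nat m"
        using j by (simp add: D_def \<gamma>'_def e_def)
      then have e: "D \<gamma>' (\<lambda>k. x * e k) = 0" for x
        by (intro line[OF \<gamma>' const[of 0]]) (simp add: m)
      have "D \<gamma>' b = 0" if b: "\<forall>k\<in>S - insert j U. b k = b s" for b
      proof -
        define b' where "b' = b(j := b s)"
        have "D \<gamma>' b' = 0" by (rule old) (use b j in \<open>auto simp: b'_def\<close>)
        moreover have "D \<gamma>' (\<lambda>k. b s - 0 + (b j - b s) * e k) = 0"
          using affD[OF \<gamma>', of "\<lambda>_. b s" "\<lambda>_. 0" "\<lambda>k. (b j - b s) * e k"] const e by simp
        moreover have "b = (\<lambda>k. b' k - b s + (b s - 0 + (b j - b s) * e k))"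
          by (auto simp: b'_def e_def)
        ultimately show ?thesis
          using affD[OF \<gamma>', of b' "\<lambda>_. b s" "\<lambda>k. b s - 0 + (b j - b s) * e k"] const by simp
      qed
      then show ?case using \<gamma>' by blast
    qed
  qed
  from this[of "S - {s}"] obtain \<gamma> where \<gamma>: "\<gamma> \<in> \<Gamma>" "\<And>b. D \<gamma> b = 0" by auto
  then have "\<phi> = \<gamma>" by (auto simp: D_def)
  with \<gamma> show ?thesis by simp
qed

text \<open>A tuple encoding the vector \<open>b\<close> on the positions \<open>S\<close> and
  frozen at \<open>z\<close> elsewhere. Freezing matters when tuples mix an affine class with a
  one-element class.\<close>

definition block :: "nat \<Rightarrow> nat set \<Rightarrow> 'a \<Rightarrow> ('r \<Rightarrow> 'a) \<Rightarrow> (nat \<Rightarrow> 'r) \<Rightarrow> 'a list" where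
  "block n S z enc b = map (\<lambda>k. if k \<in> S then enc (b k) else z) [0..<n]"

lemma length_block [simp]: "length (block n S z enc b) = n"
  by (simp add: block_def)

lemma nth_block: "k < n \<Longrightarrow> block n S z enc b ! k = (if k \<in> S then enc (b k) else z)"
  by (simp add: block_def)

lemma block_eqI: "length y = n \<Longrightarrow> (\<And>k. k < n \<Longrightarrow> k \<in> S \<Longrightarrow> y ! k = enc (b k)) \<Longrightarrow>
    (\<And>k. k < n \<Longrightarrow> k \<notin> S \<Longrightarrow> y ! k = z) \<Longrightarrow> y = block n S z enc b"
  by (intro nth_equalityI) (auto simp: nth_block)

context malcev_alg begin

text \<open>\<open>affine_interpolation\<close> for the \<open>c\<close>-coordinates of term
  operations that map the block into \<open>V\<close>; they admit the correction by
  \<open>b k - b l\<close> because of \<open>d (h xs) (xs ! l) (xs ! k)\<close>. For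
  \<open>h = f\<close>, \<open>aff\<close> is where a candidate relation enters.\<close>

lemma block_interpolation:
  fixes enc :: "'r::comm_ring_1 \<Rightarrow> 'a" and c :: "'a \<Rightarrow> 'r" and z :: 'a and n :: nat and S
  defines "e \<equiv> block n S z enc"
  assumes gen: "\<And>x::'r. \<exists>k. x = of_nat k"
    and S: "S \<subseteq> {..<n}" "s \<in> S"
    and enc: "\<And>r. c (enc r) = r" "\<And>r. enc r \<in> V"
    and d: "\<And>x1 x2 x3. x1 \<in> V \<Longrightarrow> x2 \<in> V \<Longrightarrow> x3 \<in> V \<Longrightarrow>
       d x1 x2 x3 \<in> V \<and> c (d x1 x2 x3) = c x1 - c x2 + c x3"
    and aff: "\<And>h a b b'. h = f \<or> h \<in> term_ops ar F n \<Longrightarrow> (\<And>b. h (e b) \<in> V) \<Longrightarrow>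
       c (h (e (\<lambda>k. a k - b k + b' k))) = c (h (e a)) - c (h (e b)) + c (h (e b'))"
    and f: "\<And>b. f (e b) \<in> V"
    and g: "g \<in> term_ops ar F n" "\<And>b. g (e b) \<in> V"
    and diag: "c (g (e (\<lambda>_. 0))) = c (f (e (\<lambda>_. 0)))" "c (g (e (\<lambda>_. 1))) = c (f (e (\<lambda>_. 1)))"
  shows "\<exists>g\<in>term_ops ar F n. \<forall>b. g (e b) \<in> V \<and> c (g (e b)) = c (f (e b))"
proof -
  define \<Gamma> where "\<Gamma> = {\<lambda>b. c (g (e b)) | g. g \<in> term_ops ar F n \<and> (\<forall>b. g (e b) \<in> V)}"
  have "(\<lambda>b. c (f (e b))) \<in> \<Gamma>"
  proof (rule affine_interpolation[where S = S and s = s and ?\<gamma>0.0 = "\<lambda>b. c (g (e b))"])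
    show "finite S" using S finite_subset by blast
    show "(\<lambda>b. c (g (e b))) \<in> \<Gamma>" using g by (auto simp: \<Gamma>_def)
    fix \<gamma> assume "\<gamma> \<in> insert (\<lambda>b. c (f (e b))) \<Gamma>"
    then obtain h where h: "h = f \<or> h \<in> term_ops ar F n" "\<And>b. h (e b) \<in> V" "\<gamma> = (\<lambda>b. c (h (e b)))"
      using f by (auto simp: \<Gamma>_def)
    show "\<gamma> (\<lambda>k. a k - b k + b' k) = \<gamma> a - \<gamma> b + \<gamma> b'" for a b b'
      using aff h by simp
    show "\<gamma> b = \<gamma> b'" if "\<And>k. k \<in> S \<Longrightarrow> b k = b' k" for b b'
    proof -
      have "e b = e b'" unfolding e_def block_def using that by auto
      then show ?thesis using h by simp
    qed
  next
    fix \<gamma> k l assume \<gamma>: "\<gamma> \<in> \<Gamma>" and kl: "k \<in> S" "l \<in> S"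
    then obtain h where h: "h \<in> term_ops ar F n" "\<And>b. h (e b) \<in> V" "\<gamma> = (\<lambda>b. c (h (e b)))"
      by (auto simp: \<Gamma>_def)
    have n: "k < n" "l < n" using kl S by auto
    define h' where "h' = (\<lambda>xs. d (h xs) (xs ! l) (xs ! k))"
    have "h' \<in> term_ops ar F n" unfolding h'_def using h n by (intro d_term term_ops.proj) auto
    moreover have "h' (e b) \<in> V \<and> c (h' (e b)) = \<gamma> b + b k - b l" for b
      using d[OF h(2)[of b] enc(2)[of "b l"] enc(2)[of "b k"]] n kl h(3)
      by (simp add: h'_def e_def nth_block enc algebra_simps)
    ultimately show "(\<lambda>b. \<gamma> b + b k - b l) \<in> \<Gamma>"
      unfolding \<Gamma>_def by (intro CollectI exI[of _ h']) auto
  qed (use S gen diag in auto)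
  then obtain h where "h \<in> term_ops ar F n" "\<And>b. h (e b) \<in> V" "(\<lambda>b. c (f (e b))) = (\<lambda>b. c (h (e b)))"
    unfolding \<Gamma>_def by blast
  then show ?thesis by (intro bexI[of _ h]) (auto simp: fun_eq_iff)
qed

lemma critical_exists:
  fixes f :: "'a list \<Rightarrow> 'a"
  assumes fin: "finite (UNIV :: 'a set)"
    and two: "\<And>y z. length y = n \<Longrightarrow> length z = n \<Longrightarrow> \<exists>g\<in>term_ops ar F n. g y = f y \<and> g z = f z"
    and no: "\<not> (\<exists>g\<in>term_ops ar F n. \<forall>y. length y = n \<longrightarrow> g y = f y)"
  obtains Y where "critical ar F d n f Y"
proof -
  define P where "P Y \<longleftrightarrow> Y \<subseteq> {y. length y = n} \<and> \<not> (\<exists>g\<in>term_ops ar F n. \<forall>y\<in>Y. g y = f y)" for Y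
  have finX: "finite {y :: 'a list. length y = n}"
    using finite_lists_length_eq[OF fin, of n] by simp
  have "P {y. length y = n}" using no by (auto simp: P_def)
  then obtain Y where Y: "P Y" "\<And>Z. P Z \<Longrightarrow> card Y \<le> card Z"
    using exists_least_iff[of "\<lambda>k. \<exists>Y. P Y \<and> card Y = k"] by (metis not_less)
  have finY: "finite Y" using Y finX finite_subset by (auto simp: P_def)
  have "critical ar F d n f Y"
  proof (unfold_locales)
    show "finite Y" by (rule finY)
    show "length y = n" if "y \<in> Y" for y using that Y by (auto simp: P_def)
    show "\<exists>y\<in>Y. g y \<noteq> f y" if "g \<in> term_ops ar F n" for g using that Y by (auto simp: P_def)
    show "\<exists>g\<in>term_ops ar F n. \<forall>z\<in>Y - {y}. g z = f z" if "y \<in> Y" for y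
    proof (rule ccontr)
      assume "\<not> ?thesis"
      then have "P (Y - {y})" using Y(1) by (auto simp: P_def)
      then have "card Y \<le> card (Y - {y})" by (rule Y(2))
      then show False using that finY by (metis card_Diff1_less not_less)
    qed
    show "\<exists>w\<in>Y. w \<noteq> y \<and> w \<noteq> z" for y z
    proof (rule ccontr)
      assume "\<not> ?thesis"
      then have sub: "Y \<subseteq> {y, z}" by auto
      \<comment> \<open>\<open>y\<close> and \<open>z\<close> need not lie in \<open>Y\<close>, so
        they may have the wrong length for \<open>two\<close>; outside \<open>Y\<close> an arbitrary
        tuple of length \<open>n\<close> takes their place.\<close>
      define u where "u x = (if x \<in> Y then x else replicate n undefined)" for x
      have "length (u y) = n" "length (u z) = n" using Y by (auto simp: u_def P_def)
      then obtain g where "g \<in> term_ops ar F n" "g (u y) = f (u y)" "g (u z) = f (u z)" using two by blast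
      then have "\<forall>x\<in>Y. g x = f x" using sub by (auto simp: u_def split: if_splits)
      then show False using \<open>g \<in> _\<close> Y by (auto simp: P_def)
    qed
  qed
  then show thesis by (rule that)
qed

end

subsection \<open>Simple algebras\<close>

lemma gen3: "\<exists>k. (x::3) = of_nat k"
  using ex3[of x] by (metis of_nat_0 of_nat_1 of_nat_numeral)

lemma gen2: "\<exists>k. (x::2) = of_nat k"
  using ex2[of x] by (metis of_nat_0 of_nat_1)

lemma cover3: "p \<noteq> q \<Longrightarrow> q \<noteq> r \<Longrightarrow> p \<noteq> r \<Longrightarrow> (x::3) = p \<or> x = q \<or> x = r"
proof -
  have "\<forall>p q r x :: 3. p \<noteq> q \<longrightarrow> q \<noteq> r \<longrightarrow> p \<noteq> r \<longrightarrow> x = p \<or> x = q \<or> x = r"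
    by (simp add: all3)
  then show "p \<noteq> q \<Longrightarrow> q \<noteq> r \<Longrightarrow> p \<noteq> r \<Longrightarrow> x = p \<or> x = q \<or> x = r" by blast
qed

lemma third_element3: "p \<noteq> q \<Longrightarrow> \<exists>i::3. i \<noteq> p \<and> i \<noteq> q \<and> (\<forall>x. x = p \<or> x = q \<or> x = i)"
  using ex3[of p] ex3[of q] by (elim disjE) (simp_all add: all3 ex3')

lemma equiv3_cases:
  fixes \<theta> :: "(3 \<times> 3) set"
  assumes "\<And>x. (x, x) \<in> \<theta>" "\<And>x y. (x, y) \<in> \<theta> \<Longrightarrow> (y, x) \<in> \<theta>"
    "\<And>x y z. (x, y) \<in> \<theta> \<Longrightarrow> (y, z) \<in> \<theta> \<Longrightarrow> (x, z) \<in> \<theta>"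
  shows "\<theta> = Id \<or> \<theta> = UNIV \<or> (\<exists>j. \<theta> = mu3 j)"
proof (cases "\<theta> = Id")
  case False
  then obtain p q where pq: "(p, q) \<in> \<theta>" "p \<noteq> q" using assms(1) by auto
  obtain i where i: "i \<noteq> p" "i \<noteq> q" "\<And>x. x = p \<or> x = q \<or> x = i"
    using third_element3[OF pq(2)] by blast
  show ?thesis
  proof (cases "(p, i) \<in> \<theta>")
    case True
    then have "(x, p) \<in> \<theta>" for x using i(3)[of x] pq assms by metis
    then have "(x, y) \<in> \<theta>" for x y using assms by metis
    then show ?thesis by auto
  next
    case F: False
    have "(x, y) \<in> \<theta> \<longleftrightarrow> (x = i) = (y = i)" for x y
      using i(3)[of x] i(3)[of y] i(1,2) pq F assms by metis
    then have "\<theta> = mu3 i" by (auto simp: mu3_def)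
    then show ?thesis by blast
  qed
qed simp

text \<open>Two-element domain and range can be chosen in nine ways with two bijections each. Of the
  eighteen relations three are restrictions of the identity; the list holds the three
  \<open>psi3'\<close>, then the converses of the six \<open>phi3'\<close>, then these
  themselves.\<close>

lemma doubleton3_cases: "\<forall>a b a' b' :: 3. a \<noteq> a' \<longrightarrow> b \<noteq> b' \<longrightarrow>
  {(a, b), (a', b')} = {(a, a), (a', a')} \<or> {(a, b), (a', b')} \<in> set
   [{(1, 2), (2, 1)}, {(0, 2), (2, 0)}, {(0, 1), (1, 0)},
    {(2, 1), (0, 2)}, {(1, 0), (0, 2)}, {(1, 0), (2, 1)}, {(2, 1), (0, 0)}, {(2, 0), (1, 1)}, {(1, 0), (2, 2)},
    {(1, 2), (2, 0)}, {(0, 1), (2, 0)}, {(0, 1), (1, 2)}, {(1, 2), (0, 0)}, {(0, 2), (1, 1)}, {(0, 1), (2, 2)}]"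
  by (simp only: all3)
    (simp only: distinct3 simp_thms list.set insert_iff empty_iff doubleton_eq_iff prod.inject)

lemma pair3_cases:
  fixes a b a' b' :: 3
  assumes "a \<noteq> a'" "b \<noteq> b'"
  defines "R \<equiv> {(a, b), (a', b')}"
  shows "R = {(a, a), (a', a')} \<or> (\<exists>i. R = psi3' i) \<or> (\<exists>k\<le>5. R = phi3' k \<or> R = (phi3' k)\<inverse>)"
proof -
  have psi: "psi3' 0 = {(1, 2), (2, 1)}" "psi3' 1 = {(0, 2), (2, 0)}" "psi3' 2 = {(0, 1), (1, 0)}"
    by (simp_all add: rel_eq_iff all3 psi3'_def)
  have phi: "(phi3' 0)\<inverse> = {(2, 1), (0, 2)}" "(phi3' 1)\<inverse> = {(1, 0), (0, 2)}"
      "(phi3' 2)\<inverse> = {(1, 0), (2, 1)}" "(phi3' 3)\<inverse> = {(2, 1), (0, 0)}"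
      "(phi3' 4)\<inverse> = {(2, 0), (1, 1)}" "(phi3' 5)\<inverse> = {(1, 0), (2, 2)}"
    by (auto simp: phi3'_def)
  have phi': "phi3' 0 = {(1, 2), (2, 0)}" "phi3' 1 = {(0, 1), (2, 0)}"
      "phi3' 2 = {(0, 1), (1, 2)}" "phi3' 3 = {(1, 2), (0, 0)}"
      "phi3' 4 = {(0, 2), (1, 1)}" "phi3' 5 = {(0, 1), (2, 2)}"
    by (auto simp: phi3'_def)
  let ?G = "R = {(a, a), (a', a')} \<or> (\<exists>i. R = psi3' i) \<or> (\<exists>k\<le>5. R = phi3' k \<or> R = (phi3' k)\<inverse>)"
  have I: "R = {(a, a), (a', a')} \<Longrightarrow> ?G" "R = psi3' i \<Longrightarrow> ?G"
    "k \<le> 5 \<Longrightarrow> R = phi3' k \<Longrightarrow> ?G" "k \<le> 5 \<Longrightarrow> R = (phi3' k)\<inverse> \<Longrightarrow> ?G" for i k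
    by blast+
  have k: "(0::nat) \<le> 5" "(1::nat) \<le> 5" "(2::nat) \<le> 5" "(3::nat) \<le> 5" "(4::nat) \<le> 5" "(5::nat) \<le> 5"
    by simp_all
  note J = I(1) I(2)[of 0, unfolded psi] I(2)[of 1, unfolded psi] I(2)[of 2, unfolded psi]
    k[THEN I(3), unfolded phi'] k[THEN I(4), unfolded phi]
  from doubleton3_cases[rule_format, OF assms(1,2), folded R_def] show ?thesis
    unfolding list.set insert_iff by - (elim disjE emptyE; erule J)
qed

lemma perm3_cases:
  fixes r0 r1 r2 :: 3
  assumes "r0 \<noteq> r1" "r1 \<noteq> r2" "r0 \<noteq> r2" "\<And>x y. (x, y) \<in> R \<longleftrightarrow> y = (if x = 0 then r0 else if x = 1 then r1 else r2)"
  shows "R = Id \<or> (\<exists>i. R = psi3 i) \<or> R = phi3 \<or> R = phi3\<inverse>"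
proof -
  have "R = Id \<or> R = psi3 0 \<or> R = psi3 1 \<or> R = psi3 2 \<or> R = phi3 \<or> R = phi3\<inverse>"
    unfolding rel_eq_iff assms(4) using ex3[of r0] ex3[of r1] ex3[of r2] assms(1-3)
    by (elim disjE) (simp_all add: all3 psi3_def phi3_def)
  then show ?thesis by blast
qed

locale malcev3 = malcev_alg ar F d
  for ar :: "'i \<Rightarrow> nat" and F :: "'i \<Rightarrow> 3 list \<Rightarrow> 3" and d +
  fixes n :: nat and f :: "3 list \<Rightarrow> 3" and \<Gamma> :: "3 relation set"
  assumes n: "1 \<le> n"
    and pres: "Rel \<in> subuniverse_rels ar F \<union> (\<Gamma> \<inter> Inv ar F) \<Longrightarrow> preserves n f Rel"
begin

lemma pres_unary: "unary_rel S \<in> Inv ar F \<Longrightarrow> preserves n f (unary_rel S)"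
  by (rule pres) (auto simp: subuniverse_rels_def subuniverse_iff)

lemma pres_cand: "Rel \<in> \<Gamma> \<Longrightarrow> Rel \<in> Inv ar F \<Longrightarrow> preserves n f Rel"
  by (rule pres) auto

lemma pres_Times: "bin_rel R \<in> Inv ar F \<Longrightarrow> preserves n f (bin_rel (Domain R \<times> Range R))"
  by (intro preserves_Times pres_unary Inv_Domain Inv_Range)

lemma pres_Id: "preserves n f (bin_rel Id)"
  unfolding preserves_bin_rel by (auto intro!: arg_cong[of _ _ f] nth_equalityI)

text \<open>\<open>R\<close> is the subalgebra of the square generated by the pairs
  \<open>(y ! k, z ! k)\<close>; preserving it puts \<open>(f y, f z)\<close> into it.\<close>

lemma two_points_if:
  assumes "\<And>R. bin_rel R \<in> Inv ar F \<Longrightarrow> preserves n f (bin_rel R)" "length y = n" "length z = n"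
  shows "\<exists>g\<in>term_ops ar F n. g y = f y \<and> g z = f z"
proof -
  define R where "R = {(g y, g z) | g. g \<in> term_ops ar F n}"
  have "bin_rel R \<in> Inv ar F"
  proof (rule Inv_bin_relI)
    fix i xs ys assume l: "length xs = ar i" "length ys = ar i"
      and *: "\<And>k. k < ar i \<Longrightarrow> (xs ! k, ys ! k) \<in> R"
    obtain g where g: "\<And>k. k < ar i \<Longrightarrow> g k \<in> term_ops ar F n \<and> g k y = xs ! k \<and> g k z = ys ! k"
      using *[unfolded R_def mem_Collect_eq prod.inject] by metis
    have "(\<lambda>xs. F i (map (\<lambda>g. g xs) (map g [0..<ar i]))) \<in> term_ops ar F n"
      by (rule term_ops.comp) (use g in auto)
    then have "(F i (map (\<lambda>g. g y) (map g [0..<ar i])), F i (map (\<lambda>g. g z) (map g [0..<ar i]))) \<in> R"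
      unfolding R_def mem_Collect_eq by (intro exI[of _ "\<lambda>xs. F i (map (\<lambda>g. g xs) (map g [0..<ar i]))"]) simp
    moreover have "map (\<lambda>g. g y) (map g [0..<ar i]) = xs" "map (\<lambda>g. g z) (map g [0..<ar i]) = ys"
      using g l by (auto intro!: nth_equalityI)
    ultimately show "(F i xs, F i ys) \<in> R" by simp
  qed
  then have "preserves n f (bin_rel R)" by (rule assms(1))
  moreover have "(y ! k, z ! k) \<in> R" if "k < n" for k
    unfolding R_def mem_Collect_eq using term_ops.proj[OF that] by (intro exI[of _ "\<lambda>xs. xs ! k"]) simp
  ultimately have "(f y, f z) \<in> R" using assms unfolding preserves_bin_rel by blast
  then show ?thesis unfolding R_def by force
qed

end

text \<open>Among the \<open>psi3 i\<close> only \<open>psi3 2\<close> is a candidate, so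
  \<open>norm\<close> records that the labelling has been chosen with \<open>psi3 2\<close>
  invariant whenever some \<open>psi3 i\<close> is.\<close>

locale simple3 = malcev3 ar F d n f Gamma1_candidates
  for ar :: "'i \<Rightarrow> nat" and F :: "'i \<Rightarrow> 3 list \<Rightarrow> 3" and d n f +
  assumes simple: "bin_rel (mu3 j) \<notin> Inv ar F"
    and norm: "bin_rel (psi3 i) \<in> Inv ar F \<Longrightarrow> bin_rel (psi3 2) \<in> Inv ar F"
begin

lemma equiv_cases:
  assumes "bin_rel \<theta> \<in> Inv ar F" "\<And>x. (x, x) \<in> \<theta>" "\<And>x y. (x, y) \<in> \<theta> \<Longrightarrow> (y, x) \<in> \<theta>"
    "\<And>x y z. (x, y) \<in> \<theta> \<Longrightarrow> (y, z) \<in> \<theta> \<Longrightarrow> (x, z) \<in> \<theta>"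
  shows "\<theta> = Id \<or> \<theta> = UNIV"
proof -
  have "\<theta> = Id \<or> \<theta> = UNIV \<or> (\<exists>j. \<theta> = mu3 j)"
    by (rule equiv3_cases, rule assms(2), erule assms(3), erule (1) assms(4))
  then show ?thesis using assms(1) simple by auto
qed

text \<open>\<open>R O R\<inverse>\<close> is a compatible equivalence on the domain of
  \<open>R\<close> that identifies \<open>x\<close> and \<open>x'\<close>. It is full: by simplicity
  if the domain has three elements, trivially if it is \<open>{x, x'}\<close>. Rectangularity then
  makes \<open>R\<close> a product.\<close>

lemma not_injective:
  assumes R: "bin_rel R \<in> Inv ar F" and xy: "(x, y) \<in> R" "(x', y) \<in> R" "x \<noteq> x'"
  shows "R = Domain R \<times> Range R"
proof -
  define \<theta> where "\<theta> = R O R\<inverse>"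
  have \<theta>I: "bin_rel \<theta> \<in> Inv ar F" unfolding \<theta>_def using R Inv_relcomp Inv_converse by blast
  have sym: "(v, u) \<in> \<theta>" if "(u, v) \<in> \<theta>" for u v using that by (auto simp: \<theta>_def)
  have refl: "(u, u) \<in> \<theta>" if "u \<in> Domain R" for u using that by (auto simp: \<theta>_def)
  have dom: "u \<in> Domain R \<and> v \<in> Domain R" if "(u, v) \<in> \<theta>" for u v using that by (auto simp: \<theta>_def)
  have trans: "(u, w) \<in> \<theta>" if "(u, v) \<in> \<theta>" "(v, w) \<in> \<theta>" for u v w
    using rectangular[OF \<theta>I that(1) refl that(2)] dom that by blast
  have xx': "(x, x') \<in> \<theta>" using xy by (auto simp: \<theta>_def)
  obtain i where i: "\<And>u. u = x \<or> u = x' \<or> u = i" using third_element3[OF xy(3)] by blast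
  have full: "(u, v) \<in> \<theta>" if "u \<in> Domain R" "v \<in> Domain R" for u v
  proof (cases "i \<in> Domain R")
    case True
    then have "\<And>u. u \<in> Domain R" using i dom[OF xx'] by metis
    then have "\<theta> = Id \<or> \<theta> = UNIV" by (intro equiv_cases[OF \<theta>I]) (use refl sym trans in blast)+
    then show ?thesis using xx' xy(3) by auto
  next
    case False
    then have "u = x \<or> u = x'" "v = x \<or> v = x'" using i that by metis+
    then show ?thesis using xx' sym refl that by metis
  qed
  have "(u, w) \<in> R" if "u \<in> Domain R" "(v, w) \<in> R" for u v w
  proof -
    have "(u, v) \<in> \<theta>" using full that by blast
    then obtain t where "(u, t) \<in> R" "(v, t) \<in> R" by (auto simp: \<theta>_def)
    then show ?thesis using rectangular[OF R] that by blast
  qed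
  then show ?thesis by auto
qed

text \<open>Two distinct transpositions generate all permutations: an invariant
  \<open>psi3 i\<close> with \<open>i \<noteq> 2\<close> makes \<open>phi3\<close> invariant, and
  \<open>psi3 i\<close> is a composite of the candidates \<open>psi3 2\<close> and
  \<open>phi3\<close>.\<close>

lemma pres_psi: "bin_rel (psi3 i) \<in> Inv ar F \<Longrightarrow> preserves n f (bin_rel (psi3 i))"
proof -
  assume i: "bin_rel (psi3 i) \<in> Inv ar F"
  then have 2: "bin_rel (psi3 2) \<in> Inv ar F" by (rule norm)
  have p2: "preserves n f (bin_rel (psi3 2))"
    by (rule pres_cand[OF _ 2]) (simp add: Gamma1_candidates_def)
  have phi: "preserves n f (bin_rel phi3)" if "bin_rel phi3 \<in> Inv ar F"
    by (rule pres_cand[OF _ that]) (simp add: Gamma1_candidates_def)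
  have 0: "psi3 2 O psi3 0 = phi3\<inverse>" "psi3 1 O psi3 2 = phi3\<inverse>" "psi3 2 O phi3\<inverse> = psi3 0" "phi3\<inverse> O psi3 2 = psi3 1"
    by (simp_all add: rel_eq_iff relcomp_iff all3 ex3' psi3_def phi3_def)
  have "i = 2 \<or> bin_rel (phi3\<inverse>) \<in> Inv ar F" using ex3[of i] i 2 Inv_relcomp 0(1,2) by metis
  then show ?thesis
  proof
    assume "bin_rel (phi3\<inverse>) \<in> Inv ar F"
    from phi Inv_converse[OF this] have "preserves n f (bin_rel (phi3\<inverse>))" by (simp add: preserves_converse)
    then show ?thesis using ex3[of i] p2 preserves_relcomp 0(3,4) by metis
  qed (use p2 in simp)
qed

text \<open>By \<open>not_injective\<close> for \<open>R\<close> and its converse, \<open>R\<close>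
  is a product of subuniverses or a partial bijection. A single pair is a product; two pairs and
  three pairs are classified by \<open>pair3_cases\<close> and \<open>perm3_cases\<close>.\<close>

lemma pres_binary:
  assumes R: "bin_rel R \<in> Inv ar F"
  shows "preserves n f (bin_rel R)"
proof (cases "R = Domain R \<times> Range R")
  case True
  then show ?thesis using pres_Times[OF R] by simp
next
  case F: False
  have inj1: "x = x'" if "(x, y) \<in> R" "(x', y) \<in> R" for x x' y
    using not_injective[OF R that] F by blast
  have inj2: "y = y'" if "(x, y) \<in> R" "(x, y') \<in> R" for x y y'
  proof (rule ccontr)
    assume "y \<noteq> y'"
    then have "R\<inverse> = Domain (R\<inverse>) \<times> Range (R\<inverse>)"
      by (intro not_injective[OF Inv_converse[OF R], of y x y']) (use that in simp_all)
    then have "R\<inverse> = Range R \<times> Domain R" by simp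
    then show False using F converse_Times[of "Range R" "Domain R"] by (metis converse_converse)
  qed
  have "R \<noteq> {}" using F by auto
  then obtain a b where ab: "(a, b) \<in> R" by auto
  have "\<exists>a' b'. (a', b') \<in> R \<and> a' \<noteq> a"
  proof (rule ccontr)
    assume no: "\<not> ?thesis"
    have "R \<subseteq> {(a, b)}"
    proof (rule subrelI)
      fix u v assume uv: "(u, v) \<in> R"
      then have u: "u = a" using no by blast
      from inj2[OF ab uv[unfolded u]] u show "(u, v) \<in> {(a, b)}" by simp
    qed
    then have R1: "R = {(a, b)}" using ab by blast
    show False using F unfolding R1 by simp
  qed
  then obtain a' b' where ab': "(a', b') \<in> R" "a \<noteq> a'" by blast
  have bb': "b \<noteq> b'" using inj1[of a b a'] ab ab' by auto
  show ?thesis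
  proof (cases "R = {(a, b), (a', b')}")
    case True
    from pair3_cases[OF ab'(2) bb', folded True]
    consider "R = {(a, a), (a', a')}" | i where "R = psi3' i"
      | k where "k \<le> 5" "R = phi3' k" | k where "k \<le> 5" "R = (phi3' k)\<inverse>" by blast
    then show ?thesis
    proof cases
      case 1
      have "R = (Domain R \<times> Range R) \<inter> Id" unfolding 1 by auto
      then show ?thesis using preserves_Int[OF pres_Times[OF R] pres_Id] by simp
    next
      case 2
      have "bin_rel (psi3' i) \<in> Gamma1_candidates"
        using ex3[of i] by (elim disjE) (simp_all add: Gamma1_candidates_def)
      with R show ?thesis unfolding 2 by (intro pres_cand)
    next
      case 3
      have "bin_rel (phi3' k) \<in> Gamma1_candidates"
        using 3(1) by (auto simp: Gamma1_candidates_def)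
      with R show ?thesis unfolding 3(2) by (intro pres_cand)
    next
      case 4
      have "bin_rel (phi3' k) \<in> Gamma1_candidates"
        using 4(1) by (auto simp: Gamma1_candidates_def)
      then have "preserves n f (bin_rel (phi3' k))"
        using Inv_converse[OF R] unfolding 4(2) converse_converse by (intro pres_cand)
      then show ?thesis unfolding 4(2) by (rule preserves_converse)
    qed
  next
    case False
    then obtain r where "r \<in> R" "r \<noteq> (a, b)" "r \<noteq> (a', b')"
      using ab ab'(1) by blast
    then obtain a'' b'' where c: "(a'', b'') \<in> R" "(a'', b'') \<noteq> (a, b)" "(a'', b'') \<noteq> (a', b')"
      by (cases r) blast
    have a'': "a'' \<noteq> a" "a'' \<noteq> a'"
      using c inj2[of a b b''] inj2[of a' b' b''] ab ab' by auto
    have "\<exists>y. (x, y) \<in> R" for x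
      using cover3[of a a' a'' x] ab'(2) a'' ab ab'(1) c(1) by blast
    then obtain r where r: "\<And>x. (x, r x) \<in> R" by metis
    have r': "(x, y) \<in> R \<longleftrightarrow> y = r x" for x y using r[of x] inj2[of x y "r x"] by auto
    have "r u \<noteq> r v" if "u \<noteq> v" for u v using r[of u] r[of v] inj1[of u "r u" v] that by auto
    then have "r 0 \<noteq> r 1" "r 1 \<noteq> r 2" "r 0 \<noteq> r 2" by simp_all
    moreover have "(x, y) \<in> R \<longleftrightarrow> y = (if x = 0 then r 0 else if x = 1 then r 1 else r 2)" for x y
      unfolding r' using ex3[of x] by (elim disjE) simp_all
    ultimately have "R = Id \<or> (\<exists>i. R = psi3 i) \<or> R = phi3 \<or> R = phi3\<inverse>" by (rule perm3_cases)
    then consider "R = Id" | i where "R = psi3 i" | "R = phi3" | "R = phi3\<inverse>" by blast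
    then show ?thesis
    proof cases
      case 1
      then show ?thesis using pres_Id by simp
    next
      case 2
      then show ?thesis using R pres_psi by simp
    next
      case 3
      then show ?thesis using R pres_cand[of "bin_rel phi3"] by (simp add: Gamma1_candidates_def)
    next
      case 4
      then have "bin_rel phi3 \<in> Inv ar F" using Inv_converse[OF R] by simp
      then have "preserves n f (bin_rel phi3)" by (intro pres_cand) (simp add: Gamma1_candidates_def)
      then show ?thesis unfolding 4 by (rule preserves_converse)
    qed
  qed
qed

end

lemma latin3:
  fixes d :: "3 \<Rightarrow> 3 \<Rightarrow> 3 \<Rightarrow> 3"
  assumes right: "\<And>x y. d y x x = y" and left: "\<And>x y. d x x y = y"
    and comm: "\<And>a b c. d b a c = d c a b"
    and cancel: "\<And>a b e g. d a e g = d b e g \<Longrightarrow> a = b"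
  shows "d x y z = x - y + z"
proof -
  have other: "d x y z = y" if "x \<noteq> y" "y \<noteq> z" "x \<noteq> z" for x y z
  proof -
    have "d x y z \<noteq> z" using cancel[of x y z y] left[of y z] that by auto
    moreover have "d x y z \<noteq> x" using cancel[of z y x y] left[of y x] comm[of z y x] that by auto
    ultimately show ?thesis using cover3[OF that, of "d x y z"] by blast
  qed
  have same: "d x y x = x - y + x" if "x \<noteq> y" for x y
  proof -
    have w: "x - y + x \<noteq> x \<and> x - y + x \<noteq> y"
    proof -
      have "\<forall>x y :: 3. x \<noteq> y \<longrightarrow> x - y + x \<noteq> x \<and> x - y + x \<noteq> y" by (simp add: all3)
      then show ?thesis using that by blast
    qed
    have "d x y x \<noteq> x" using cancel[of x y x y] left[of y x] that by auto
    moreover have "d x y x \<noteq> y" using cancel[of x y x "x - y + x"] other[of "x - y + x" y x] w that by auto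
    ultimately show ?thesis using cover3[of x y "x - y + x" "d x y x"] w that by metis
  qed
  have "\<forall>x y z. d x y z = x - y + z" by (simp add: all3 left right other same)
  then show ?thesis by blast
qed

section \<open>Minority on two-element subuniverses\<close>

lemma minority_color:
  assumes "p \<noteq> q" "x \<in> {p, q}" "y \<in> {p, q}" "z \<in> {p, q}" "u \<in> {p, q}"
  defines "c \<equiv> \<lambda>u. if u = p then 0 else 1 :: 2"
  shows "u = minority x y z \<longleftrightarrow> c u = c x - c y + c z"
  using assms(1-5) unfolding c_def minority_def by (elim insertE emptyE) simp_all

lemma T3'_eq: "T3' i = (4, snd (T3' i))" "r \<in> snd (T3' i) \<Longrightarrow> length r = 4"
  by (auto simp: T3'_def)

lemma mem_T3':
  assumes "p \<noteq> q" "i \<noteq> p" "i \<noteq> q"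
  defines "c \<equiv> \<lambda>u. if u = p then 0 else 1 :: 2"
  shows "[x, y, z, u] \<in> snd (T3' i) \<longleftrightarrow>
    x \<in> {p, q} \<and> y \<in> {p, q} \<and> z \<in> {p, q} \<and> u \<in> {p, q} \<and> c u = c x - c y + c z"
proof -
  have i: "v \<noteq> i \<longleftrightarrow> v \<in> {p, q}" for v
  proof -
    obtain j where "\<And>x. x = p \<or> x = q \<or> x = j" using third_element3[OF assms(1)] by blast
    from this[of i] this[of v] show ?thesis using assms(2,3) by auto
  qed
  have "[x, y, z, u] \<in> snd (T3' i) \<longleftrightarrow> x \<in> {p, q} \<and> y \<in> {p, q} \<and> z \<in> {p, q} \<and> u = minority x y z"
    by (auto simp: T3'_def i)
  also have "\<dots> \<longleftrightarrow> x \<in> {p, q} \<and> y \<in> {p, q} \<and> z \<in> {p, q} \<and> u \<in> {p, q} \<and> u = minority x y z"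
    unfolding minority_def by (cases "x = y"; cases "x = z") auto
  also have "\<dots> \<longleftrightarrow> x \<in> {p, q} \<and> y \<in> {p, q} \<and> z \<in> {p, q} \<and> u \<in> {p, q} \<and> c u = c x - c y + c z"
    unfolding c_def using minority_color[OF assms(1)] by blast
  finally show ?thesis .
qed

locale critical3 = malcev3 ar F d n f \<Gamma> + critical ar F d n f Y
  for ar :: "'i \<Rightarrow> nat" and F :: "'i \<Rightarrow> 3 list \<Rightarrow> 3" and d n f \<Gamma> Y +
  assumes pres_bin: "bin_rel R \<in> Inv ar F \<Longrightarrow> preserves n f (bin_rel R)"
begin

lemma two_points: "length y = n \<Longrightarrow> length z = n \<Longrightarrow> \<exists>g\<in>T. g y = f y \<and> g z = f z"
  by (rule two_points_if[OF pres_bin])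

lemma interp_B: "g = f \<or> g \<in> T \<Longrightarrow> unary_rel V \<in> Inv ar F \<Longrightarrow> length xs = n \<Longrightarrow> set xs \<subseteq> V \<Longrightarrow> g xs \<in> V"
  using pres_unary[of V] term_ops_preserve_unary[of g ar F n V] unfolding preserves_unary_rel by blast

lemma set_in_B: "y \<in> Y \<Longrightarrow> set y \<subseteq> B y"
proof
  fix x assume y: "y \<in> Y" and "x \<in> set y"
  then obtain k where "k < n" "x = y ! k" using len_Y by (metis in_set_conv_nth)
  then show "x \<in> B y" using BI[OF term_ops.proj, of k y] by simp
qed

lemma fork_in_B: "y \<in> Y \<Longrightarrow> f y \<in> B y" "y \<in> Y \<Longrightarrow> G y y \<in> B y" "y \<in> Y \<Longrightarrow> f y \<noteq> G y y"
proof -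
  show fB: "f y \<in> B y" if "y \<in> Y" by (rule f_in_B[OF that])
  show "G y y \<in> B y" if "y \<in> Y" by (rule BI, rule G(1)[OF that])
  show "f y \<noteq> G y y" if "y \<in> Y" using fork_theta[OF that] K_refl[OF fB[OF that]] by metis
qed

lemma two_element_B:
  assumes y: "y \<in> Y" and B: "B y \<noteq> UNIV"
  shows "B y = {f y, G y y}"
proof -
  from third_element3[OF fork_in_B(3)[OF y]]
  obtain i where i: "\<And>x. x = f y \<or> x = G y y \<or> x = i" by blast
  have "i \<notin> B y"
  proof
    assume "i \<in> B y"
    then have "x \<in> B y" for x using i[of x] fork_in_B(1,2)[OF y] by metis
    then show False using B by blast
  qed
  then have "x = f y \<or> x = G y y" if "x \<in> B y" for x using i[of x] that by metis
  then show ?thesis using fork_in_B(1,2)[OF y] by blast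
qed

lemma theta_two_element:
  assumes y: "y \<in> Y" and B: "B y \<noteq> UNIV" and uv: "(u, v) \<in> \<theta> y"
  shows "u = v"
  using two_element_B[OF y B] uv K_B[OF uv] fork_theta[OF y] K_sym[OF uv] by auto

text \<open>\<open>section_affine\<close> makes \<open>T3' i\<close> invariant, so \<open>f\<close>
  is affine on all tuples over \<open>{p, q}\<close>. The conclusion covers all these tuples and not
  just those in \<open>Y\<close>, because tuples of other coordinates get transported into
  \<open>{p, q}\<close>.\<close>

lemma two_element_interpolation:
  assumes y: "y \<in> Y" and B: "B y = {p, q}" and pq: "p \<noteq> q" "i \<noteq> p" "i \<noteq> q"
    and sec: "section_at y (\<lambda>u. if u = p then 0 else 1)"
    and cand: "T3' i \<in> \<Gamma>"
  shows "\<exists>g\<in>T. \<forall>xs. length xs = n \<and> set xs \<subseteq> {p, q} \<longrightarrow> g xs = f xs"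
proof -
  define c :: "3 \<Rightarrow> 2" where "c = (\<lambda>u. if u = p then 0 else 1)"
  define enc where "enc r = (if r = (0::2) then p else q)" for r
  have mem: "[x, y, z, u] \<in> snd (T3' i) \<longleftrightarrow>
      x \<in> {p, q} \<and> y \<in> {p, q} \<and> z \<in> {p, q} \<and> u \<in> {p, q} \<and> c u = c x - c y + c z" for x y z u
    unfolding c_def by (rule mem_T3'[OF pq])
  have inv: "T3' i \<in> Inv ar F"
    unfolding Inv_def mem_Collect_eq
  proof (intro allI, subst T3'_eq(1), subst preserves_quaternary[OF T3'_eq(2)], assumption, intro allI impI, elim conjE)
    fix j and as bs cs es :: "3 list" assume l: "length as = ar j" "length bs = ar j" "length cs = ar j" "length es = ar j"
      and *: "\<forall>k<ar j. [as ! k, bs ! k, cs ! k, es ! k] \<in> snd (T3' i)"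
    have sub: "set as \<subseteq> B y" "set bs \<subseteq> B y" "set cs \<subseteq> B y" "set es \<subseteq> B y"
      using * l unfolding mem B by (auto simp: in_set_conv_nth)
    have FB: "F j ws \<in> {p, q}" if "length ws = ar j" "set ws \<subseteq> B y" for ws
      using B_Inv[of y] that unfolding subuniverse_iff[symmetric] subuniverse_def B by blast
    have "c (F j es) = c (F j as) - c (F j bs) + c (F j cs)"
      by (rule section_affine[OF sec[folded c_def] y l sub]) (use * in \<open>simp add: mem\<close>)
    then show "[F j as, F j bs, F j cs, F j es] \<in> snd (T3' i)"
      unfolding mem using FB l sub by blast
  qed
  have inv': "(4, snd (T3' i)) \<in> Inv ar F" using inv by (subst (asm) T3'_eq(1))
  have aff: "c (h es) = c (h as) - c (h bs) + c (h cs)"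
    if h: "h = f \<or> h \<in> T" and l: "length as = n" "length bs = n" "length cs = n" "length es = n"
      and sub: "set as \<subseteq> {p, q}" "set bs \<subseteq> {p, q}" "set cs \<subseteq> {p, q}" "set es \<subseteq> {p, q}"
      and *: "\<And>k. k < n \<Longrightarrow> c (es ! k) = c (as ! k) - c (bs ! k) + c (cs ! k)" for h as bs cs es
  proof -
    have P: "preserves n h (4, snd (T3' i))"
      using h
    proof
      show "preserves n h (4, snd (T3' i))" if "h = f"
        unfolding that T3'_eq(1)[symmetric] by (rule pres_cand[OF cand inv])
      show "preserves n h (4, snd (T3' i))" if "h \<in> T"
        by (rule term_ops_preserve[OF that inv' T3'_eq(2)])
    qed
    have row: "[as ! k, bs ! k, cs ! k, es ! k] \<in> snd (T3' i)" if "k < n" for k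
    proof -
      have mm: "as ! k \<in> {p, q}" "bs ! k \<in> {p, q}" "cs ! k \<in> {p, q}" "es ! k \<in> {p, q}"
        by (rule subsetD[OF sub(1) nth_mem] subsetD[OF sub(2) nth_mem] subsetD[OF sub(3) nth_mem]
            subsetD[OF sub(4) nth_mem], use that l in simp)+
      show ?thesis unfolding mem by (intro conjI mm *[OF that])
    qed
    have "[h as, h bs, h cs, h es] \<in> snd (T3' i)"
      by (rule preserves_quaternaryD[OF P l row])
    then show ?thesis unfolding mem by (elim conjE)
  qed
  define e where "e = block n {..<n} p enc"
  have el: "length (e b) = n" "set (e b) \<subseteq> {p, q}" for b
    by (auto simp: e_def block_def enc_def)
  have BI: "unary_rel {p, q} \<in> Inv ar F" using B_Inv[of y] B by simp
  have cenc: "c (enc r) = r" "enc r \<in> {p, q}" for r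
    using ex2[of r] pq(1) by (simp_all add: c_def enc_def) metis
  have cinj: "u = v" if "c u = c v" "u \<in> {p, q}" "v \<in> {p, q}" for u v
    using that by (elim insertE emptyE) (simp_all add: c_def split: if_splits)
  \<comment> \<open>The two constant tuples are the diagonal required by
    \<open>block_interpolation\<close>.\<close>
  obtain g where g: "g \<in> T" "g (e (\<lambda>_. 0)) = f (e (\<lambda>_. 0))" "g (e (\<lambda>_. 1)) = f (e (\<lambda>_. 1))"
    using two_points[OF el(1) el(1)] by blast
  have "\<exists>g\<in>T. \<forall>b. g (e b) \<in> {p, q} \<and> c (g (e b)) = c (f (e b))"
    unfolding e_def
  proof (rule block_interpolation[where s = 0 and g = g and V = "{p, q}" and c = c], unfold e_def[symmetric])
    show "d x1 x2 x3 \<in> {p, q} \<and> c (d x1 x2 x3) = c x1 - c x2 + c x3"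
      if "x1 \<in> {p, q}" "x2 \<in> {p, q}" "x3 \<in> {p, q}" for x1 x2 x3
      using section_d[OF sec[folded c_def] y, of x1 x2 x3] B_d[of x1 y x2 x3] that unfolding B by blast
    show "c (h (e (\<lambda>k. a k - b k + b' k))) = c (h (e a)) - c (h (e b)) + c (h (e b'))"
      if "h = f \<or> h \<in> T" for h a b b'
      by (rule aff[OF that el(1) el(1) el(1) el(1) el(2) el(2) el(2) el(2)])
        (simp add: e_def nth_block cenc)
    show "f (e b) \<in> {p, q}" for b by (rule interp_B[OF disjI1[OF refl] BI el])
    show "g (e b) \<in> {p, q}" for b by (rule interp_B[OF disjI2[OF g(1)] BI el])
    show "\<exists>k. x = of_nat k" for x :: 2 by (rule gen2)
    show "c (enc r) = r" "enc r \<in> {p, q}" for r by (rule cenc)+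
    show "c (g (e (\<lambda>_. 0))) = c (f (e (\<lambda>_. 0)))" "c (g (e (\<lambda>_. 1))) = c (f (e (\<lambda>_. 1)))"
      by (simp_all only: g)
  qed (use n g in simp_all)
  then obtain h where h: "h \<in> T" "\<And>b. h (e b) \<in> {p, q} \<and> c (h (e b)) = c (f (e b))" by blast
  have "h xs = f xs" if "length xs = n \<and> set xs \<subseteq> {p, q}" for xs
  proof -
    have x: "xs ! k \<in> {p, q}" if "k < n" for k using \<open>length xs = n \<and> _\<close> that nth_mem by blast
    have "xs = e (\<lambda>k. c (xs ! k))"
      unfolding e_def by (rule block_eqI) (use that x in \<open>auto simp: enc_def c_def\<close>)
    moreover have "f xs \<in> {p, q}" by (rule interp_B[OF disjI1[OF refl] BI]) (use that in auto)
    ultimately show ?thesis using h cinj by metis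
  qed
  with h(1) show ?thesis by blast
qed

end

context simple3 begin

text \<open>If some \<open>B y\<close> is everything, \<open>d\<close> is \<open>x - y + z\<close>,
  the relation \<open>T3\<close> is invariant and \<open>f\<close> is affine everywhere. Otherwise
  all \<open>B y\<close> have two elements; a term operation right on one of them is right on any
  other, since the two share one element and are matched by an invariant bijection.\<close>

lemma no_critical: "\<not> critical ar F d n f Y"
proof
  assume "critical ar F d n f Y"
  then interpret critical ar F d n f Y .
  interpret critical3 ar F d n f Gamma1_candidates Y
    by unfold_locales (rule pres_binary)
  note BY = fork_in_B
  have K_cases: "K y Z = Id \<or> K y Z = UNIV" if "B y = UNIV" for y Z
    by (rule equiv_cases[OF K_Inv]) (use that K_refl K_sym K_trans in blast)+
  have \<theta>: "u = v" if y: "y \<in> Y" and uv: "(u, v) \<in> \<theta> y" for u v y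
  proof (cases "B y = UNIV")
    case True
    then show ?thesis using K_cases[of y "{y}"] fork_theta[OF y] uv by auto
  next
    case False
    then show ?thesis using theta_two_element[OF y False uv] by simp
  qed
  have E: "(u, v) \<in> E y z" if "y \<in> Y" "z \<in> Y" "y \<noteq> z" "u \<in> B y" "v \<in> B y" for u v y z
  proof (cases "B y = UNIV")
    case True
    then show ?thesis using K_cases[of y "{y, z}"] fork_E[OF that(1-3)] BY(3)[OF that(1)] by auto
  next
    case False
    then show ?thesis
      using two_element_B[OF that(1) False] that fork_E[OF that(1-3)] K_sym K_refl
      by (metis insertE singletonD)
  qed
  show False
  proof (cases "\<exists>y\<in>Y. B y = UNIV")
    case True
    then obtain y where y: "y \<in> Y" "B y = UNIV" by blast
    obtain z w where zw: "z \<in> Y" "w \<in> Y" "y \<noteq> z" "y \<noteq> w" "z \<noteq> w" using three[OF y(1)] .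
    have d: "d x1 x2 x3 = x1 - x2 + x3" for x1 x2 x3
    proof (rule latin3)
      show "d b a c = d c a b" for a b c
        by (rule \<theta>[OF y(1)], rule d_comm[OF _ _ zw(3-5)]) (use E y zw in auto)
      show "a = b" if "d a e g = d b e g" for a b e g
        by (rule \<theta>[OF y(1)], rule d_cancel[where e = e and g = g, OF _ _ zw(3-5)])
          (use E y zw that K_refl in auto)
    qed simp_all
    have T3: "T3 = (4, {[x, y, z, x - y + z] | x y z. True})" by (simp add: T3_def)
    have T3I: "T3 \<in> Inv ar F"
      unfolding T3 Inv_def mem_Collect_eq
    proof (intro allI, subst preserves_quaternary)
      fix i
      show "\<forall>as bs cs es. length as = ar i \<and> length bs = ar i \<and> length cs = ar i \<and> length es = ar i \<and>
        (\<forall>k<ar i. [as ! k, bs ! k, cs ! k, es ! k] \<in> {[x, y, z, x - y + z] | x y z. True}) \<longrightarrow>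
        [F i as, F i bs, F i cs, F i es] \<in> {[x, y, z, x - y + z] | x y z. True}"
      proof (intro allI impI, elim conjE)
        fix as bs cs es :: "3 list" assume l: "length as = ar i" "length bs = ar i" "length cs = ar i" "length es = ar i"
          and *: "\<forall>k<ar i. [as ! k, bs ! k, cs ! k, es ! k] \<in> {[x, y, z, x - y + z] | x y z. True}"
        have "M4 y z w (F i bs) (F i as) (F i cs) (F i es)"
        proof (rule M4_op)
          fix k assume "k < ar i"
          then have "es ! k = d (cs ! k) (bs ! k) (as ! k)" using * by (auto simp: d)
          then show "M4 y z w (bs ! k) (as ! k) (cs ! k) (es ! k)"
            using M4_ex[OF _ _ zw(3-5)] E y zw by simp
        qed (use l in auto)
        then show "[F i as, F i bs, F i cs, F i es] \<in> {[x, y, z, x - y + z] | x y z. True}"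
          using M4_d[OF _ zw(3-5)] \<theta>[OF y(1)] d by fastforce
      qed
    qed auto
    have pT3: "h (block n {..<n} 0 id (\<lambda>k. a k - b k + b' k)) =
        h (block n {..<n} 0 id a) - h (block n {..<n} 0 id b) + h (block n {..<n} 0 id b')"
      if "h = f \<or> h \<in> T" for h and a b b' :: "nat \<Rightarrow> 3"
    proof -
      have "preserves n h T3"
        using that
      proof
        show "preserves n h T3" if "h = f"
          unfolding that by (rule pres_cand[OF _ T3I]) (simp add: Gamma1_candidates_def)
        show "preserves n h T3" if "h \<in> T"
          unfolding T3 by (rule term_ops_preserve[OF that T3I[unfolded T3]]) auto
      qed
      then have "[h (block n {..<n} 0 id a), h (block n {..<n} 0 id b), h (block n {..<n} 0 id b'),
          h (block n {..<n} 0 id (\<lambda>k. a k - b k + b' k))] \<in> {[x, y, z, x - y + z] | x y z. True}"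
        unfolding T3 by (rule preserves_quaternaryD) (auto simp: nth_block)
      then show ?thesis by auto
    qed
    obtain g where g: "g \<in> T"
      "g (block n {..<n} 0 id (\<lambda>_. 0)) = f (block n {..<n} 0 id (\<lambda>_. 0))"
      "g (block n {..<n} 0 id (\<lambda>_. 1)) = f (block n {..<n} 0 id (\<lambda>_. 1 :: 3))"
      using two_points[of "block n {..<n} 0 id (\<lambda>_. 0)" "block n {..<n} 0 id (\<lambda>_. 1)"] by auto
    have "\<exists>g\<in>T. \<forall>b. g (block n {..<n} 0 id b) \<in> UNIV \<and>
        id (g (block n {..<n} 0 id b)) = id (f (block n {..<n} 0 id (b :: nat \<Rightarrow> 3)))"
      by (rule block_interpolation[where s = 0 and g = g])
        (use n g d pT3 in \<open>simp_all add: gen3 id_def\<close>)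
    then obtain h where h: "h \<in> T" "\<And>b. h (block n {..<n} 0 id b) = f (block n {..<n} 0 id b)" by auto
    have "h y = f y" if "y \<in> Y" for y
    proof -
      have "y = block n {..<n} 0 id (\<lambda>k. y ! k)" by (rule block_eqI) (use len_Y[OF that] in auto)
      then show ?thesis using h by metis
    qed
    then show False using no_interp h(1) by blast
  next
    case False
    then have nU: "B y \<noteq> UNIV" if "y \<in> Y" for y using that by blast
    have B2: "B y = {f y, G y y}" if "y \<in> Y" for y
      by (rule two_element_B[OF that nU[OF that]])
    have sec: "section_at y c" if "y \<in> Y" "inj_on c (B y)" for y c
      unfolding section_at_def
    proof (intro ballI)
      fix u v assume "u \<in> B y" "v \<in> B y"
      then show "(u, v) \<in> \<theta> y \<longleftrightarrow> c u = c v" using \<theta>[OF that(1)] K_refl inj_onD[OF that(2)] by metis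
    qed
    obtain y0 where y0: "y0 \<in> Y" using third by blast
    define p q where "p = f y0" and "q = G y0 y0"
    have pq: "p \<noteq> q" "B y0 = {p, q}" using BY(3) B2 y0 by (auto simp: p_def q_def)
    obtain i where i: "i \<noteq> p" "i \<noteq> q" "\<And>x. x = p \<or> x = q \<or> x = i"
      using third_element3[OF pq(1)] by blast
    have cand: "T3' i \<in> Gamma1_candidates"
      using ex3[of i] by (auto simp: Gamma1_candidates_def)
    have "section_at y0 (\<lambda>u. if u = p then 0 else 1)"
      by (rule sec[OF y0]) (use pq in \<open>auto simp: inj_on_def\<close>)
    from two_element_interpolation[OF y0 pq(2,1) i(1,2) this cand]
    obtain g where g: "g \<in> T" "\<And>xs. length xs = n \<Longrightarrow> set xs \<subseteq> {p, q} \<Longrightarrow> g xs = f xs" by blast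
    have "g y = f y" if y: "y \<in> Y" for y
    proof (cases "B y = {p, q}")
      case True
      then show ?thesis using g(2)[OF len_Y[OF y]] set_in_B[OF y] by simp
    next
      case False
      have fi: "f y = i \<or> G y y = i"
      proof (rule ccontr)
        assume no: "\<not> (f y = i \<or> G y y = i)"
        have "(f y = p \<or> f y = q) \<and> (G y y = p \<or> G y y = q)"
          using i(3)[of "f y"] i(3)[of "G y y"] no by blast
        then have "{f y, G y y} = {p, q}" using BY(3)[OF y] by (elim conjE disjE) auto
        then show False using False B2[OF y] by simp
      qed
      define o' where "o' = (if f y = i then G y y else f y)"
      have o': "B y = {i, o'}" "o' \<noteq> i"
        using B2[OF y] BY(3)[OF y] fi by (auto simp: o'_def)
      have o'pq: "o' = p \<or> o' = q" using i(3)[of o'] o'(2) by blast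
      define v where "v = (if o' = p then q else p)"
      have v: "B y0 = {o', v}" "v \<noteq> o'" "v \<noteq> i" "v = p \<or> v = q"
        using o'pq pq i(1,2) by (auto simp: v_def)
      have yy0: "y \<noteq> y0" using False pq(2) by blast
      define c where "c u = (if u = o' then 0 else 1 :: 2)" for u
      have s1: "section_at y c" by (rule sec[OF y]) (use o' in \<open>auto simp: inj_on_def c_def\<close>)
      have s2: "section_at y0 c" by (rule sec[OF y0]) (use v in \<open>auto simp: inj_on_def c_def\<close>)
      \<comment> \<open>The bijection from \<open>B y\<close> to \<open>B y0\<close> that fixes the
        common element \<open>o'\<close>. It consists of the possible steps to \<open>o'\<close> on
        both sides, so \<open>L\<close> makes it invariant.\<close>
      define I where "I = {(i, v), (o', o')}"
      have Lo: "L y y0 u o' w o'" if "(u, w) \<in> I" for u w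
        by (rule section_L[OF s1 s2 y y0 yy0]) (use that o' v in \<open>auto simp: I_def c_def\<close>)
      \<comment> \<open>The intersection of \<open>B y\<close> and \<open>B y0\<close> is the
        subuniverse \<open>{o'}\<close>.\<close>
      have sub: "F j ws = o'" if "length ws = ar j" "set ws \<subseteq> {o'}" for j ws
      proof -
        have "set ws \<subseteq> B y" "set ws \<subseteq> B y0" using that o' v by auto
        then have "F j ws \<in> B y" "F j ws \<in> B y0"
          using B_Inv[of y] B_Inv[of y0] that unfolding subuniverse_iff[symmetric] subuniverse_def by blast+
        then show ?thesis using o' v by auto
      qed
      have I: "bin_rel I \<in> Inv ar F"
      proof (rule Inv_bin_relI)
        fix j xs ys assume l: "length xs = ar j" "length ys = ar j" and *: "\<And>k. k < ar j \<Longrightarrow> (xs ! k, ys ! k) \<in> I"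
        have F: "F j (replicate (ar j) o') = o'" by (rule sub) auto
        have "L y y0 (F j xs) (F j (replicate (ar j) o')) (F j ys) (F j (replicate (ar j) o'))"
          by (rule L_op) (use l * Lo in auto)
        then have L: "L y y0 (F j xs) o' (F j ys) o'" unfolding F .
        have "F j xs \<in> {i, o'}" "F j ys \<in> {o', v}" using L_B[OF L] o' v by auto
        moreover have "(F j xs, o') \<in> \<theta> y \<longleftrightarrow> (F j ys, o') \<in> \<theta> y0" by (rule L_theta[OF L yy0 y y0])
        then have "F j xs = o' \<longleftrightarrow> F j ys = o'" 
          using \<theta>[OF y, of "F j xs" o'] \<theta>[OF y0, of "F j ys" o'] K_refl[of o' y] K_refl[of o' y0] o' v by auto
        ultimately show "(F j xs, F j ys) \<in> I" unfolding I_def using o'(2) v(2) by auto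
      qed
      define y' where "y' = map (\<lambda>x. if x = o' then o' else v) y"
      have y'l: "length y' = n" "set y' \<subseteq> {p, q}" using len_Y[OF y] v pq by (auto simp: y'_def)
      have yI: "(y ! k, y' ! k) \<in> I" if "k < n" for k
      proof -
        have "y ! k \<in> {i, o'}"
          using subsetD[OF set_in_B[OF y] nth_mem[of k y]] that o'(1) len_Y[OF y] by simp
        then show ?thesis using that len_Y[OF y] o'(2) by (auto simp: I_def y'_def)
      qed
      have "(f y, f y') \<in> I" "(g y, g y') \<in> I"
        using pres_bin[OF I] term_ops_preserve_bin[OF g(1) I] yI y'l len_Y[OF y]
        unfolding preserves_bin_rel by blast+
      moreover have "g y' = f y'" using g(2) y'l by blast
      ultimately show ?thesis unfolding I_def using v(2) by auto
    qed
    then show False using no_interp g(1) by blast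
  qed
qed

end

subsection \<open>Algebras with monolith \<open>mu3 2\<close>\<close>

definition top_color :: "3 \<Rightarrow> 2" where
  "top_color u = (if u = 2 then 1 else 0)"

definition low_color :: "3 \<Rightarrow> 2" where
  "low_color u = (if u = 0 then 0 else 1)"

lemma mu3_iff: "(u, v) \<in> mu3 2 \<longleftrightarrow> top_color u = top_color v"
  by (simp add: mem_mu3_2 top_color_def)

lemma top_color_0: "top_color u = 0 \<longleftrightarrow> u \<in> {0, 1}"
  using ex3[of u] by (auto simp: top_color_def)

lemma (in malcev_alg) Inv_rectangular: "bin_rel R \<in> Inv ar F \<Longrightarrow> rectangular_rel R"
  unfolding rectangular_rel_def using rectangular by blast

locale mono3 = malcev3 ar F d n f Gamma2_candidates
  for ar :: "'i \<Rightarrow> nat" and F :: "'i \<Rightarrow> 3 list \<Rightarrow> 3" and d n f +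
  assumes mu: "bin_rel (mu3 2) \<in> Inv ar F"
begin

lemma pres_binary:
  assumes R: "bin_rel R \<in> Inv ar F"
  shows "preserves n f (bin_rel R)"
proof -
  have I: "bin_rel (mu3 2 O R) \<in> Inv ar F" "bin_rel (R O mu3 2) \<in> Inv ar F"
    "bin_rel (mu3 2 O R O mu3 2) \<in> Inv ar F"
    by (intro Inv_relcomp mu R)+
  have cand: "bin_rel (mu3 2) \<in> Gamma2_candidates" "bin_rel (rho3 2) \<in> Gamma2_candidates"
    "bin_rel tau3_0 \<in> Gamma2_candidates" "bin_rel tau3_1 \<in> Gamma2_candidates"
    "bin_rel (psi3 2) \<in> Gamma2_candidates" "bin_rel (psi3' 2) \<in> Gamma2_candidates"
    by (simp_all add: Gamma2_candidates_def)
  have Int: "preserves n f (bin_rel R)" if "R = (Domain R \<times> Range R) \<inter> X" "preserves n f (bin_rel X)" for X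
    using preserves_Int[OF pres_Times[OF R] that(2)] that(1) by simp
  from rel3_cases[OF Inv_rectangular[OF R] Inv_rectangular[OF I(1)] Inv_rectangular[OF I(2)] Inv_rectangular[OF I(3)]]
  show ?thesis
  proof (elim disjE conjE)
    assume "R = Domain R \<times> Range R"
    then show ?thesis using pres_Times[OF R] by simp
  next
    assume "R = (Domain R \<times> Range R) \<inter> mu3 2"
    then show ?thesis by (rule Int) (rule pres_cand[OF cand(1) mu])
  next
    assume e: "R = psi3 2"
    show ?thesis using R unfolding e by (rule pres_cand[OF cand(5)])
  next
    assume e: "R = psi3' 2"
    show ?thesis using R unfolding e by (rule pres_cand[OF cand(6)])
  next
    assume "R = (Domain R \<times> Range R) \<inter> Id"
    then show ?thesis by (rule Int) (rule pres_Id)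
  next
    assume "R = (Domain R \<times> Range R) \<inter> rho3 2" "mu3 2 O R O mu3 2 = rho3 2"
    then show ?thesis using pres_cand[OF cand(2)] I(3) by (intro Int[of "rho3 2"]) simp_all
  next
    assume "R = (Domain R \<times> Range R) \<inter> tau3_0" "mu3 2 O R = tau3_0"
    then show ?thesis using pres_cand[OF cand(3)] I(1) by (intro Int[of tau3_0]) simp_all
  next
    assume "R = (Domain R \<times> Range R) \<inter> tau3_1" "mu3 2 O R = tau3_1"
    then show ?thesis using pres_cand[OF cand(4)] I(1) by (intro Int[of tau3_1]) simp_all
  next
    assume *: "R = (Domain R \<times> Range R) \<inter> tau3_0\<inverse>" "R O mu3 2 = tau3_0\<inverse>"
    have "bin_rel tau3_0 \<in> Inv ar F" using Inv_converse[OF I(2)] unfolding *(2) by simp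
    then show ?thesis by (intro Int[OF *(1)] preserves_converse pres_cand[OF cand(3)])
  next
    assume *: "R = (Domain R \<times> Range R) \<inter> tau3_1\<inverse>" "R O mu3 2 = tau3_1\<inverse>"
    have "bin_rel tau3_1 \<in> Inv ar F" using Inv_converse[OF I(2)] unfolding *(2) by simp
    then show ?thesis by (intro Int[OF *(1)] preserves_converse pres_cand[OF cand(4)])
  qed
qed

text \<open>Modulo \<open>mu3 2\<close> the value \<open>d j k 2\<close> is congruent to
  \<open>d k k 2 = 2\<close>, modulo \<open>mu3 j\<close> to \<open>d j k k = j\<close>; both are
  one-element classes, so the value would be \<open>2\<close> and \<open>j\<close>.\<close>

lemma mu_unique:
  assumes j: "bin_rel (mu3 j) \<in> Inv ar F"
  shows "j = 2"
proof (rule ccontr)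
  assume "j \<noteq> 2"
  then obtain k where k: "k \<noteq> j" "k \<noteq> 2" using third_element3[of j 2] by blast
  have "(d j k 2, d k k 2) \<in> mu3 2"
    by (rule d_bin[OF mu]) (use k \<open>j \<noteq> 2\<close> in \<open>simp_all add: mu3_def\<close>)
  moreover have "(d j k 2, d j k k) \<in> mu3 j"
    by (rule d_bin[OF j]) (use k \<open>j \<noteq> 2\<close> in \<open>simp_all add: mu3_def\<close>)
  ultimately show False using \<open>j \<noteq> 2\<close> by (simp add: mu3_def)
qed

lemma equiv_cases:
  assumes "bin_rel \<theta> \<in> Inv ar F" "\<And>x. (x, x) \<in> \<theta>" "\<And>x y. (x, y) \<in> \<theta> \<Longrightarrow> (y, x) \<in> \<theta>"
    "\<And>x y z. (x, y) \<in> \<theta> \<Longrightarrow> (y, z) \<in> \<theta> \<Longrightarrow> (x, z) \<in> \<theta>"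
  shows "\<theta> = Id \<or> \<theta> = UNIV \<or> \<theta> = mu3 2"
proof -
  have "\<theta> = Id \<or> \<theta> = UNIV \<or> (\<exists>j. \<theta> = mu3 j)"
    by (rule equiv3_cases, rule assms(2), erule assms(3), erule (1) assms(4))
  then show ?thesis using assms(1) mu_unique by blast
qed

lemma d_top: "top_color x1 = top_color y1 \<Longrightarrow> top_color x2 = top_color y2 \<Longrightarrow> top_color x3 = top_color y3 \<Longrightarrow>
    top_color (d x1 x2 x3) = top_color (d y1 y2 y3)"
  using d_bin[OF mu] unfolding mu3_iff by blast

lemma op_top:
  assumes "length xs = ar i" "length ys = ar i" "\<And>k. k < ar i \<Longrightarrow> top_color (xs ! k) = top_color (ys ! k)"
  shows "top_color (F i xs) = top_color (F i ys)"
  using InvD[OF mu, of i] assms unfolding preserves_bin_rel mu3_iff by blast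

end

locale mono_critical3 = mono3 ar F d n f + critical ar F d n f Y
  for ar :: "'i \<Rightarrow> nat" and F :: "'i \<Rightarrow> 3 list \<Rightarrow> 3" and d n f Y

sublocale mono_critical3 \<subseteq> critical3 ar F d n f Gamma2_candidates Y
  by unfold_locales (rule pres_binary)

context mono_critical3 begin

lemma h_top:
  assumes "h = f \<or> h \<in> T" "length xs = n" "length ys = n"
    "\<And>k. k < n \<Longrightarrow> top_color (xs ! k) = top_color (ys ! k)"
  shows "top_color (h xs) = top_color (h ys)"
proof -
  have "preserves n h (bin_rel (mu3 2))"
    using assms(1) pres_bin[OF mu] term_ops_preserve_bin[OF _ mu] by blast
  then show ?thesis using assms(2-) unfolding preserves_bin_rel mu3_iff by blast
qed

lemma K_cases:
  assumes "B y = UNIV"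
  shows "K y Z = Id \<or> K y Z = UNIV \<or> K y Z = mu3 2"
  by (rule equiv_cases[OF K_Inv]) (use assms K_refl K_sym K_trans in blast)+

text \<open>On a full coordinate \<open>\<theta> y\<close> is trivial or \<open>mu3 2\<close>, as
  the fork excludes the full congruence. On a two-element one it is trivial, and
  \<open>top_color\<close> separates the elements exactly when \<open>2\<close> occurs.\<close>

lemma section_types:
  assumes y: "y \<in> Y"
  shows "(B y = UNIV \<and> \<theta> y = Id) \<or> (B y = {0, 1} \<and> section_at y low_color) \<or>
    (2 \<in> B y \<and> (\<exists>u\<in>B y. u \<noteq> 2) \<and> section_at y top_color)"
proof (cases "B y = UNIV")
  case True
  have "\<theta> y \<noteq> UNIV" using fork_theta[OF y] by blast
  moreover have "section_at y top_color" if "\<theta> y = mu3 2"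
    unfolding section_at_def that mu3_iff by blast
  moreover have "2 \<in> B y" "\<exists>u\<in>B y. u \<noteq> 2" using True by (simp, intro bexI[of _ 0]) simp_all
  ultimately show ?thesis using K_cases[OF True, of "{y}"] True by (elim disjE) simp_all
next
  case False
  have \<theta>: "(u, v) \<in> \<theta> y \<longleftrightarrow> u = v" if "u \<in> B y" for u v
    using theta_two_element[OF y False, of u v] K_refl[OF that] by metis
  have sec: "section_at y c" if "\<And>u v. u \<in> B y \<Longrightarrow> v \<in> B y \<Longrightarrow> c u = c v \<Longrightarrow> u = v" for c
    unfolding section_at_def
  proof (intro ballI)
    fix u v assume uv: "u \<in> B y" "v \<in> B y"
    show "(u, v) \<in> \<theta> y \<longleftrightarrow> c u = c v" unfolding \<theta>[OF uv(1)] using that[OF uv] by metis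
  qed
  note two = two_element_B[OF y False] and fork = fork_in_B[OF y]
  show ?thesis
  proof (cases "2 \<in> B y")
    case True
    have "\<exists>u\<in>B y. u \<noteq> 2" using fork by metis
    moreover have "section_at y top_color"
    proof (rule sec)
      fix u v assume "u \<in> B y" "v \<in> B y" "top_color u = top_color v"
      then show "u = v" using two True by (auto simp: top_color_def split: if_splits)
    qed
    ultimately show ?thesis using True by blast
  next
    case F: False
    have "f y \<noteq> 2" "G y y \<noteq> 2" using F fork by auto
    then have "(f y = 0 \<and> G y y = 1) \<or> (f y = 1 \<and> G y y = 0)"
      using ex3[of "f y"] ex3[of "G y y"] fork(3) by metis
    then have "B y = {0, 1}" unfolding two by (elim disjE conjE) auto
    moreover from this have "section_at y low_color"
      by (intro sec) (auto simp: low_color_def)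
    ultimately show ?thesis by blast
  qed
qed

end

lemma T3i_eq: "T3i 2 = (4, snd (T3i 2))" "r \<in> snd (T3i 2) \<Longrightarrow> length r = 4"
  by (auto simp: T3i_def T3'_def)

lemma mem_T3i: "[x, y, z, u] \<in> snd (T3i 2) \<longleftrightarrow>
    (x = 2 \<and> y = 2 \<and> z = 2 \<and> u = 2) \<or>
    (x \<in> {0, 1} \<and> y \<in> {0, 1} \<and> z \<in> {0, 1} \<and> u \<in> {0, 1} \<and>
      low_color u = low_color x - low_color y + low_color z)"
proof -
  have "[x, y, z, u] \<in> snd (T3i 2) \<longleftrightarrow> [x, y, z, u] \<in> snd (T3' 2) \<or> (x = 2 \<and> y = 2 \<and> z = 2 \<and> u = 2)"
    by (simp add: T3i_def disj_commute)
  moreover have "[x, y, z, u] \<in> snd (T3' 2) \<longleftrightarrow> x \<in> {0, 1} \<and> y \<in> {0, 1} \<and> z \<in> {0, 1} \<and> u \<in> {0, 1} \<and>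
      low_color u = low_color x - low_color y + low_color z"
    unfolding low_color_def by (rule mem_T3') simp_all
  ultimately show ?thesis by (simp only: disj_commute)
qed

context mono_critical3 begin

text \<open>A coordinate on which \<open>\<theta>\<close> is trivial and all three elements occur: the fork must lie inside
  the monolith, and then all coordinates are of this kind and are linked along the two classes.\<close>

lemma full_section:
  assumes y: "y \<in> Y" "B y = UNIV" "\<theta> y = Id" and z: "z \<in> Y" "z \<noteq> y"
  shows "E y z = mu3 2"
proof -
  obtain w where w: "w \<in> Y" "w \<noteq> y" "w \<noteq> z" using third[of y z] by blast
  have notId: "E y x \<noteq> Id" if "x \<in> Y" "x \<noteq> y" for x
    using fork_E[OF y(1) that(1)] fork_in_B(3)[OF y(1)] that(2) by auto
  have "(0, 2) \<notin> E y z"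
  proof
    assume 02: "(0, 2) \<in> E y z"
    have 01: "(0, 1) \<in> E y w"
      using K_cases[OF y(2), of "{y, w}"] notId[OF w(1,2)] by (elim disjE) (simp_all add: mem_mu3_2)
    \<comment> \<open>\<open>0\<close> and \<open>1\<close> are congruent and \<open>{2}\<close> is
      a class, so translation by \<open>(0, 2)\<close> sends both \<open>0\<close> and
      \<open>1\<close> to \<open>2\<close>, against cancellation.\<close>
    have "top_color (d 1 0 2) = top_color (d 0 0 2)" by (rule d_top) (simp_all add: top_color_def)
    then have "d 1 0 2 = 2" unfolding d_left by (simp add: top_color_def split: if_splits)
    then have "(d 0 0 2, d 1 0 2) \<in> \<theta> y" using y(3) by simp
    from d_cancel[OF 02 01 z(2)[symmetric] w(2)[symmetric] w(3)[symmetric] this]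
    show False using y(3) by simp
  qed
  then show ?thesis using K_cases[OF y(2), of "{y, z}"] notId[OF z] by (elim disjE) simp_all
qed

lemma d_top_2:
  assumes "(p, p') \<in> mu3 2"
  shows "d 2 p p' = 2"
proof -
  have "top_color (d 2 p p') = top_color (d 2 p p)"
    by (rule d_top) (use assms in \<open>simp_all add: mu3_iff\<close>)
  then show ?thesis by (simp add: top_color_def split: if_splits)
qed

text \<open>Translations along \<open>mu3 2\<close> fix \<open>2\<close>, so
  \<open>E_trivial\<close> applies as soon as \<open>g y = 2\<close>: nothing can move at
  \<open>z\<close> together with \<open>y\<close>.\<close>

lemma full_section_trivial:
  assumes y: "y \<in> Y" "B y = UNIV" "\<theta> y = Id" and z: "z \<in> Y" "z \<noteq> y"
    and g: "g \<in> T" "g y = 2" "(g z, v) \<in> E z y"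
  shows "(g z, v) \<in> \<theta> z"
  by (rule E_trivial[OF y(1) z(1) z(2)[symmetric] g(1,3)])
    (simp add: g(2) d_top_2 full_section[OF y z])

text \<open>A two-class section at \<open>z\<close> would let any value \<open>g z\<close> move to
  the other class jointly with \<open>y\<close>, also for a \<open>g\<close> with
  \<open>g y = 2\<close>.\<close>

lemma full_section_all:
  assumes y: "y \<in> Y" "B y = UNIV" "\<theta> y = Id" and z: "z \<in> Y"
  shows "B z = UNIV \<and> \<theta> z = Id"
proof (rule ccontr)
  assume no: "\<not> (B z = UNIV \<and> \<theta> z = Id)"
  then obtain c where c: "section_at z c" using section_types[OF z] by blast
  have zy: "z \<noteq> y" using no y by blast
  have "2 \<in> B y" using y(2) by simp
  then obtain g where g: "g \<in> T" "g y = 2" unfolding B_def by force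
  have "c (f z) \<noteq> c (g z) \<or> c (G z z) \<noteq> c (g z)" using section_fork[OF c z] by metis
  then obtain v where v: "v \<in> B z" "c v \<noteq> c (g z)" using fork_in_B[OF z] by blast
  have "(g z, v) \<in> E z y" by (rule section_E[OF c z y(1) zy BI[OF g(1)] v(1)])
  then have "(g z, v) \<in> \<theta> z" by (rule full_section_trivial[OF y z zy g])
  then show False using section_atD[OF c BI[OF g(1)] v(1)] v(2) by simp
qed

text \<open>Term operations take the value \<open>2\<close> at all coordinates in \<open>Y\<close>
  or at none, so the tuples of \<open>Y\<close> have their entries \<open>2\<close> in common
  positions and vary over \<open>{0, 1}\<close> elsewhere. There \<open>T3i 2\<close> makes
  \<open>f\<close> affine.\<close>

lemma no_full_section:
  assumes y0: "y0 \<in> Y" "B y0 = UNIV" "\<theta> y0 = Id"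
  shows False
proof -
  note A = full_section_all[OF y0]
  have E: "E y z = mu3 2" if "y \<in> Y" "z \<in> Y" "z \<noteq> y" for y z
    using full_section A that by blast
  have link2: "g z = 2" if "g \<in> T" "g y = 2" "y \<in> Y" "z \<in> Y" for g y z
  proof (rule ccontr)
    assume z2: "g z \<noteq> 2"
    then have zy: "z \<noteq> y" using that by blast
    obtain v where v: "v \<noteq> g z" "v \<noteq> 2" using third_element3[OF z2] by blast
    have "(g z, v) \<in> E z y" unfolding E[OF that(4,3) zy[symmetric]] using z2 v by (simp add: mem_mu3_2)
    then have "(g z, v) \<in> \<theta> z"
      using full_section_trivial[OF that(3) _ _ that(4) zy that(1,2)] A[OF that(3)] by blast
    then show False using A[OF that(4)] v by simp
  qed
  \<comment> \<open>A value \<open>f y = 2\<close> would be shared by \<open>G w\<close> and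
    \<open>G z\<close>, hence spread to \<open>z\<close> by \<open>link2\<close>: both prongs of the
    fork at \<open>z\<close> would be \<open>2\<close>.\<close>
  have f2: "f y \<noteq> 2" if y: "y \<in> Y" for y
  proof
    assume 2: "f y = 2"
    obtain z where z: "z \<in> Y" "z \<noteq> y" using third[of y y] by blast
    obtain w where w: "w \<in> Y" "w \<noteq> y" "w \<noteq> z" using third[of y z] by blast
    have "G w y = 2" "G w z = f z" using G(2) w y z 2 by auto
    then have fz: "f z = 2" using link2[OF G(1)[OF w(1)] _ y z(1)] by simp
    have "G z y = 2" using G(2)[OF z(1) y] z 2 by auto
    then have "G z z = 2" using link2[OF G(1)[OF z(1)] _ y z(1)] by simp
    then show False using fork_in_B(3)[OF z(1)] fz by simp
  qed
  have proj2: "y ! k = 2 \<longleftrightarrow> z ! k = 2" if "y \<in> Y" "z \<in> Y" "k < n" for y z k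
    using link2[OF term_ops.proj[OF that(3)]] that by blast
  obtain z where z: "z \<in> Y" "z \<noteq> y0" using third[of y0 y0] by blast
  obtain w where w: "w \<in> Y" "w \<noteq> y0" "w \<noteq> z" using third[of y0 z] by blast
  note ne = z(2)[symmetric] w(2)[symmetric] w(3)[symmetric]
  have EE: "(u, v) \<in> E y0 z" "(u, v) \<in> E y0 w" if "top_color u = top_color v" for u v
    using E[OF y0(1)] z w that by (simp_all add: mu3_iff)
  define V :: "3 set" where "V = {0, 1}"
  have V: "u \<in> V \<longleftrightarrow> top_color u = 0" "u \<in> V \<longleftrightarrow> u \<noteq> 2" for u
    using ex3[of u] by (auto simp: V_def top_color_def)
  have dV: "d x1 x2 x3 \<in> V" if "x1 \<in> V" "x2 \<in> V" "x3 \<in> V" for x1 x2 x3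
    using d_top[of x1 x1 x2 x1 x3 x1] that unfolding V(1) by simp
  have low_inj: "u = v" if "low_color u = low_color v" "u \<in> V" "v \<in> V" for u v
    using that by (auto simp: V_def low_color_def)
  have dlow: "low_color (d x1 x2 x3) = low_color x1 - low_color x2 + low_color x3"
    if x: "x1 \<in> V" "x2 \<in> V" "x3 \<in> V" for x1 x2 x3
  proof (cases "x1 = x2 \<or> x2 = x3")
    case True
    then show ?thesis by auto
  next
    case False
    then have x12: "x1 \<noteq> x2" "x2 \<noteq> x3" by auto
    then have x13: "x1 = x3" using x by (auto simp: V_def)
    have "d x1 x2 x3 \<noteq> x3"
    proof
      assume "d x1 x2 x3 = x3"
      then have eq: "(d x1 x2 x3, d x2 x2 x3) \<in> \<theta> y0" using y0(3) by simp
      have "top_color x2 = top_color x3" "top_color x1 = top_color x2"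
        using x unfolding V(1) by simp_all
      from d_cancel[OF EE(1)[OF this(1)] EE(2)[OF this(2)] ne eq]
      show False using y0(3) x12 by simp
    qed
    then have "low_color (d x1 x2 x3) \<noteq> low_color x3" using low_inj dV[OF x] x(3) by blast
    moreover have "low_color x1 \<noteq> low_color x2" "low_color x2 \<noteq> low_color x3" using low_inj x x12 by blast+
    ultimately show ?thesis by (intro two_arith1)
  qed
  have inv: "(4, snd (T3i 2)) \<in> Inv ar F"
    unfolding Inv_def mem_Collect_eq
  proof (intro allI, subst preserves_quaternary[OF T3i_eq(2)], assumption, intro allI impI, elim conjE)
    fix j and as bs cs es :: "3 list" assume l: "length as = ar j" "length bs = ar j" "length cs = ar j" "length es = ar j"
      and *: "\<forall>k<ar j. [as ! k, bs ! k, cs ! k, es ! k] \<in> snd (T3i 2)"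
    have top: "top_color (as ! k) = top_color (bs ! k)" "top_color (cs ! k) = top_color (bs ! k)"
      "top_color (es ! k) = top_color (bs ! k)" and es: "es ! k = d (cs ! k) (bs ! k) (as ! k)"
      if "k < ar j" for k
    proof -
      from *[rule_format, OF that] consider
          "as ! k = 2" "bs ! k = 2" "cs ! k = 2" "es ! k = 2"
        | "as ! k \<in> V" "bs ! k \<in> V" "cs ! k \<in> V" "es ! k \<in> V"
          "low_color (es ! k) = low_color (as ! k) - low_color (bs ! k) + low_color (cs ! k)"
        unfolding mem_T3i V_def by blast
      then have "top_color (as ! k) = top_color (bs ! k) \<and> top_color (cs ! k) = top_color (bs ! k) \<and>
        top_color (es ! k) = top_color (bs ! k) \<and> es ! k = d (cs ! k) (bs ! k) (as ! k)"
      proof cases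
        case 2
        have "es ! k = d (cs ! k) (bs ! k) (as ! k)"
          by (rule low_inj[OF _ 2(4) dV[OF 2(3,2,1)]]) (simp add: dlow[OF 2(3,2,1)] 2(5))
        then show ?thesis using 2 by (simp add: V(1))
      qed simp
      then show "top_color (as ! k) = top_color (bs ! k)" "top_color (cs ! k) = top_color (bs ! k)"
        "top_color (es ! k) = top_color (bs ! k)" "es ! k = d (cs ! k) (bs ! k) (as ! k)" by blast+
    qed
    have "M4 y0 z w (F j bs) (F j as) (F j cs) (F j es)"
    proof (rule M4_op)
      fix k assume k: "k < ar j"
      show "M4 y0 z w (bs ! k) (as ! k) (cs ! k) (es ! k)"
        unfolding es[OF k] by (rule M4_ex[OF EE(1) EE(2) ne]) (use top[OF k] in simp_all)
    qed (use l in auto)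
    from M4_d[OF this ne] have Fes: "F j es = d (F j as) (F j bs) (F j cs)" using y0(3) by simp
    have Ftop: "top_color (F j as) = top_color (F j bs)" "top_color (F j cs) = top_color (F j bs)"
      "top_color (F j es) = top_color (F j bs)"
      by (rule op_top; use l top in simp)+
    show "[F j as, F j bs, F j cs, F j es] \<in> snd (T3i 2)"
    proof (cases "F j bs = 2")
      case True
      then show ?thesis using Ftop unfolding mem_T3i by (simp add: top_color_def split: if_splits)
    next
      case False
      then have inV: "F j bs \<in> V" "F j as \<in> V" "F j cs \<in> V" "F j es \<in> V" using Ftop V by metis+
      then show ?thesis unfolding mem_T3i Fes using dlow by (simp add: V_def)
    qed
  qed
  define S where "S = {k. k < n \<and> y0 ! k \<noteq> 2}"
  define enc where "enc r = (if r = (0::2) then 0 else 1 :: 3)" for r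
  define e where "e = block n S 2 enc"
  have el: "length (e b) = n" for b by (simp add: e_def)
  have enc: "low_color (enc r) = r" "enc r \<in> V" for r
    using ex2[of r] by (auto simp: low_color_def enc_def V_def)
  have etop: "top_color (e b ! k) = top_color (y0 ! k)" if "k < n" for b k
    using that enc(2)[of "b k"] unfolding V(1) by (auto simp: e_def nth_block S_def top_color_def split: if_splits)
  have Y_block: "y = e (\<lambda>k. low_color (y ! k))" if y: "y \<in> Y" for y
    unfolding e_def
  proof (rule block_eqI[OF len_Y[OF y]])
    fix k assume k: "k < n"
    show "y ! k = enc (low_color (y ! k))" if "k \<in> S"
    proof (rule low_inj)
      show "y ! k \<in> V" using that proj2[OF y0(1) y k] unfolding V(2) S_def by simp
    qed (simp_all add: enc)
    show "y ! k = 2" if "k \<notin> S" using that proj2[OF y0(1) y k] k unfolding S_def by simp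
  qed
  have fV: "f (e b) \<in> V" for b
  proof -
    have "top_color (f (e b)) = top_color (f y0)"
      by (rule h_top) (use el len_Y[OF y0(1)] etop in simp_all)
    then show ?thesis using f2[OF y0(1)] V by metis
  qed
  have "S \<noteq> {}"
  proof
    assume "S = {}"
    then have "y0 = e (\<lambda>_. 0)" "z = e (\<lambda>_. 0)"
      using Y_block[OF y0(1)] Y_block[OF z(1)] unfolding e_def block_def by simp_all
    then show False using z(2) by simp
  qed
  then obtain s where s: "s \<in> S" by blast
  obtain g where g: "g \<in> T" "g (e (\<lambda>_. 0)) = f (e (\<lambda>_. 0))" "g (e (\<lambda>_. 1)) = f (e (\<lambda>_. 1))"
    using two_points[OF el el] by blast
  have gV: "g (e b) \<in> V" for b
  proof -
    have "top_color (g (e b)) = top_color (g (e (\<lambda>_. 0)))"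
      by (rule h_top) (use el etop g(1) in simp_all)
    then show ?thesis using fV[of "\<lambda>_. 0"] unfolding V(1) g(2) by simp
  qed
  have "\<exists>g\<in>T. \<forall>b. g (e b) \<in> V \<and> low_color (g (e b)) = low_color (f (e b))"
    unfolding e_def
  proof (rule block_interpolation[where s = s and g = g and V = V and c = low_color], unfold e_def[symmetric])
    show "d x1 x2 x3 \<in> V \<and> low_color (d x1 x2 x3) = low_color x1 - low_color x2 + low_color x3"
      if "x1 \<in> V" "x2 \<in> V" "x3 \<in> V" for x1 x2 x3
      using dV[OF that] dlow[OF that] by blast
    show "low_color (h (e (\<lambda>k. a k - b k + b' k))) = low_color (h (e a)) - low_color (h (e b)) + low_color (h (e b'))"
      if h: "h = f \<or> h \<in> T" and hV: "\<And>b. h (e b) \<in> V" for h a b b'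
    proof -
      have P: "preserves n h (4, snd (T3i 2))"
        using h
      proof
        show "preserves n h (4, snd (T3i 2))" if "h = f"
          unfolding that by (rule pres_cand[OF _ inv]) (simp add: Gamma2_candidates_def T3i_eq(1)[symmetric])
        show "preserves n h (4, snd (T3i 2))" if "h \<in> T"
          by (rule term_ops_preserve[OF that inv T3i_eq(2)])
      qed
      have "[h (e a), h (e b), h (e b'), h (e (\<lambda>k. a k - b k + b' k))] \<in> snd (T3i 2)"
      proof (rule preserves_quaternaryD[OF P el el el el])
        fix k assume k: "k < n"
        show "[e a ! k, e b ! k, e b' ! k, e (\<lambda>k. a k - b k + b' k) ! k] \<in> snd (T3i 2)"
        proof (cases "k \<in> S")
          case True
          then have "e b ! k = enc (b k)" for b using k by (simp add: e_def nth_block)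
          then show ?thesis unfolding mem_T3i V_def[symmetric] by (simp add: enc)
        next
          case False
          then have "e b ! k = 2" for b using k by (simp add: e_def nth_block)
          then show ?thesis unfolding mem_T3i by simp
        qed
      qed
      then show ?thesis unfolding mem_T3i using hV[of a] unfolding V(2) by blast
    qed
    show "\<exists>k. x = of_nat k" for x :: 2 by (rule gen2)
    show "low_color (enc r) = r" "enc r \<in> V" for r by (rule enc)+
    show "low_color (g (e (\<lambda>_. 0))) = low_color (f (e (\<lambda>_. 0)))"
      "low_color (g (e (\<lambda>_. 1))) = low_color (f (e (\<lambda>_. 1)))"
      by (simp_all only: g)
    show "S \<subseteq> {..<n}" by (auto simp: S_def)
  qed (use s g gV fV in simp_all)
  then obtain h where h: "h \<in> T" "\<And>b. h (e b) \<in> V \<and> low_color (h (e b)) = low_color (f (e b))" by blast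
  have "h y = f y" if y: "y \<in> Y" for y
    using low_inj h(2) fV Y_block[OF y] by metis
  then show False using no_interp h(1) by blast
qed

end

section \<open>The quotient by \<open>mu3 2\<close> and its link with the class of 0 and 1\<close>

lemma two_sub_iff: "(a::2) - b = c \<longleftrightarrow> (a = b \<longleftrightarrow> c = 0)"
proof -
  have "\<forall>a b c :: 2. a - b = c \<longleftrightarrow> (a = b \<longleftrightarrow> c = 0)"
  proof -
    have all2: "(\<forall>x::2. P x) \<longleftrightarrow> P 0 \<and> P 1" for P using ex2 by metis
    show ?thesis by (simp add: all2)
  qed
  then show ?thesis by blast
qed

lemma S01_eq: "S01 = (3, snd S01)" "r \<in> snd S01 \<Longrightarrow> length r = 3"
  by (auto simp: S01_def)

text \<open>This explains the six triples: \<open>S01\<close> identifies differences in the class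
  \<open>{0, 1}\<close> with elements of the quotient by \<open>mu3 2\<close>, the class
  \<open>{0, 1}\<close> being its zero.\<close>

lemma mem_S01: "[x, y, z] \<in> snd S01 \<longleftrightarrow> x \<in> {0, 1} \<and> y \<in> {0, 1} \<and> low_color x - low_color y = top_color z"
proof -
  have "\<forall>x y z. [x, y, z] \<in> snd S01 \<longleftrightarrow> x \<in> {0, 1} \<and> y \<in> {0, 1} \<and> low_color x - low_color y = top_color z"
    by (simp add: all3 S01_def low_color_def top_color_def)
  then show ?thesis by blast
qed

lemma T3_mu2_eq: "T3_mu2 = (4, snd T3_mu2)" "r \<in> snd T3_mu2 \<Longrightarrow> length r = 4"
  by (auto simp: T3_mu2_def)

lemma mem_T3_mu2: "[x, y, z, u] \<in> snd T3_mu2 \<longleftrightarrow> top_color u = top_color x - top_color y + top_color z"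
proof -
  have "\<forall>a b c e. (e = minority a b c) \<longleftrightarrow>
      (if e then 1 else 0 :: 2) = (if a then 1 else 0) - (if b then 1 else 0) + (if c then 1 else 0)"
    by (simp add: all_bool_eq minority_def)
  then show ?thesis by (simp add: T3_mu2_def top_color_def)
qed

context mono_critical3 begin

text \<open>The section at \<open>y\<close> is a copy of the quotient by \<open>mu3 2\<close>, so
  the quotient is affine and \<open>T3_mu2\<close> is invariant; interpolation then takes place
  modulo \<open>mu3 2\<close>, over the whole power.\<close>

lemma quotient_interpolation:
  assumes y: "y \<in> Y" and o': "2 \<in> B y" "o' \<in> B y" "o' \<noteq> 2" and sec: "section_at y top_color"
  shows "\<exists>g\<in>T. \<forall>xs. length xs = n \<longrightarrow> top_color (g xs) = top_color (f xs)"
proof -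
  \<comment> \<open>\<open>section_affine\<close> speaks only of arguments in \<open>B y\<close>;
    \<open>rep\<close> chooses them there without changing their class, hence without changing the
    class of the value.\<close>
  define rep where "rep u = (if u = 2 then 2 else o')" for u :: 3
  have rep: "rep u \<in> B y" "top_color (rep u) = top_color u" for u
    using o' by (simp_all add: rep_def top_color_def)
  have repF: "top_color (F i (map rep xs)) = top_color (F i xs)" if "length xs = ar i" for i xs
    by (rule op_top) (use that rep in simp_all)
  have inv: "(4, snd T3_mu2) \<in> Inv ar F"
    unfolding Inv_def mem_Collect_eq
  proof (intro allI, subst preserves_quaternary[OF T3_mu2_eq(2)], assumption, intro allI impI, elim conjE)
    fix j and as bs cs es :: "3 list" assume l: "length as = ar j" "length bs = ar j" "length cs = ar j" "length es = ar j"
      and *: "\<forall>k<ar j. [as ! k, bs ! k, cs ! k, es ! k] \<in> snd T3_mu2"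
    have set_rep: "set (map rep xs) \<subseteq> B y" for xs using rep by auto
    have "top_color (F j (map rep es)) = top_color (F j (map rep as)) - top_color (F j (map rep bs)) + top_color (F j (map rep cs))"
    proof (rule section_affine[OF sec y _ _ _ _ set_rep set_rep set_rep set_rep])
      show "top_color (map rep es ! k) = top_color (map rep as ! k) - top_color (map rep bs ! k) + top_color (map rep cs ! k)"
        if "k < ar j" for k
        using * l that by (simp add: rep mem_T3_mu2)
    qed (use l in simp_all)
    then show "[F j as, F j bs, F j cs, F j es] \<in> snd T3_mu2"
      unfolding mem_T3_mu2 repF[OF l(1)] repF[OF l(2)] repF[OF l(3)] repF[OF l(4)] .
  qed
  have dtop: "top_color (d x1 x2 x3) = top_color x1 - top_color x2 + top_color x3" for x1 x2 x3
  proof -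
    have "top_color (d x1 x2 x3) = top_color (d (rep x1) (rep x2) (rep x3))"
      by (rule d_top) (simp_all add: rep)
    then show ?thesis using section_d[OF sec y rep(1) rep(1) rep(1), of x1 x2 x3] by (simp add: rep)
  qed
  define enc where "enc r = (if r = (0::2) then 0 else 2 :: 3)" for r
  have enc: "top_color (enc r) = r" for r using ex2[of r] by (auto simp: top_color_def enc_def)
  define e where "e = block n {..<n} 0 enc"
  have el: "length (e b) = n" for b by (simp add: e_def)
  obtain g where g: "g \<in> T" "g (e (\<lambda>_. 0)) = f (e (\<lambda>_. 0))" "g (e (\<lambda>_. 1)) = f (e (\<lambda>_. 1))"
    using two_points[OF el el] by blast
  have "\<exists>g\<in>T. \<forall>b. g (e b) \<in> UNIV \<and> top_color (g (e b)) = top_color (f (e b))"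
    unfolding e_def
  proof (rule block_interpolation[where s = 0 and g = g and V = UNIV and c = top_color], unfold e_def[symmetric])
    show "d x1 x2 x3 \<in> UNIV \<and> top_color (d x1 x2 x3) = top_color x1 - top_color x2 + top_color x3" for x1 x2 x3
      using dtop by simp
    show "top_color (h (e (\<lambda>k. a k - b k + b' k))) = top_color (h (e a)) - top_color (h (e b)) + top_color (h (e b'))"
      if h: "h = f \<or> h \<in> T" for h a b b'
    proof -
      have P: "preserves n h (4, snd T3_mu2)"
        using h
      proof
        show "preserves n h (4, snd T3_mu2)" if "h = f"
          unfolding that by (rule pres_cand[OF _ inv]) (simp add: Gamma2_candidates_def T3_mu2_eq(1)[symmetric])
        show "preserves n h (4, snd T3_mu2)" if "h \<in> T"
          by (rule term_ops_preserve[OF that inv T3_mu2_eq(2)])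
      qed
      have "[h (e a), h (e b), h (e b'), h (e (\<lambda>k. a k - b k + b' k))] \<in> snd T3_mu2"
        by (rule preserves_quaternaryD[OF P el el el el]) (simp add: e_def nth_block mem_T3_mu2 enc)
      then show ?thesis unfolding mem_T3_mu2 .
    qed
    show "\<exists>k. x = of_nat k" for x :: 2 by (rule gen2)
    show "top_color (enc r) = r" for r by (rule enc)
    show "top_color (g (e (\<lambda>_. 0))) = top_color (f (e (\<lambda>_. 0)))"
      "top_color (g (e (\<lambda>_. 1))) = top_color (f (e (\<lambda>_. 1)))"
      by (simp_all only: g)
  qed (use n g in simp_all)
  then obtain h where h: "h \<in> T" "\<And>b. top_color (h (e b)) = top_color (f (e b))" by blast
  have "top_color (h xs) = top_color (f xs)" if "length xs = n" for xs
  proof -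
    define b where "b k = top_color (xs ! k)" for k
    have "top_color (h' xs) = top_color (h' (e b))" if "h' = f \<or> h' \<in> T" for h'
      by (rule h_top[OF that]) (use \<open>length xs = n\<close> el in \<open>simp_all add: e_def nth_block enc b_def\<close>)
    then show ?thesis using h by simp
  qed
  then show ?thesis using h(1) by blast
qed

text \<open>\<open>section_L\<close> couples differences at \<open>y\<close> with classes at
  \<open>z\<close>, which makes \<open>S01\<close> invariant. Through \<open>S01\<close> the class
  of a value at any tuple is the difference of two values at tuples over \<open>{0, 1}\<close>,
  where \<open>g\<close> and \<open>f\<close> agree.\<close>

lemma low_determines_top:
  assumes y: "y \<in> Y" "B y = {0, 1}" "section_at y low_color"
    and z: "z \<in> Y" "2 \<in> B z" "o' \<in> B z" "o' \<noteq> 2" "section_at z top_color"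
    and g: "g \<in> T" "\<And>xs. length xs = n \<Longrightarrow> set xs \<subseteq> {0, 1} \<Longrightarrow> g xs = f xs"
    and xs: "length xs = n"
  shows "top_color (g xs) = top_color (f xs)"
proof -
  have yz: "y \<noteq> z" using y(2) z(2) by auto
  define rep where "rep u = (if u = 2 then 2 else o')" for u :: 3
  have rep: "rep u \<in> B z" "top_color (rep u) = top_color u" for u
    using z by (simp_all add: rep_def top_color_def)
  have o01: "o' \<in> {0, 1}" "top_color o' = 0" using ex3[of o'] z(4) by (auto simp: top_color_def)
  have subD: "F j ws \<in> {0, 1}" if "length ws = ar j" "set ws \<subseteq> {0, 1}" for j ws
    using B_Inv[of y] that unfolding subuniverse_iff[symmetric] subuniverse_def y(2) by blast
  have inv: "(3, snd S01) \<in> Inv ar F"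
    unfolding Inv_def mem_Collect_eq
  proof (intro allI, subst preserves_ternary[OF S01_eq(2)], assumption, intro allI impI, elim conjE)
    fix j and as bs cs :: "3 list" assume l: "length as = ar j" "length bs = ar j" "length cs = ar j"
      and *: "\<forall>k<ar j. [as ! k, bs ! k, cs ! k] \<in> snd S01"
    define os where "os = replicate (ar j) o'"
    have L: "L y z (F j as) (F j bs) (F j (map rep cs)) (F j os)"
    proof (rule L_op)
      fix k assume k: "k < ar j"
      show "L y z (as ! k) (bs ! k) (map rep cs ! k) (os ! k)"
      proof (rule section_L[OF y(3) z(5) y(1) z(1) yz])
        show "low_color (as ! k) - low_color (bs ! k) = top_color (map rep cs ! k) - top_color (os ! k)"
          using *[rule_format, OF k] k l unfolding mem_S01 by (simp add: rep os_def o01(2))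
        show "as ! k \<in> B y" "bs ! k \<in> B y" using *[rule_format, OF k] unfolding mem_S01 y(2) by simp_all
        show "map rep cs ! k \<in> B z" "os ! k \<in> B z" using k l rep z(3) by (simp_all add: os_def)
      qed
    qed (use l in \<open>simp_all add: os_def\<close>)
    have Fos: "top_color (F j os) = 0"
      unfolding top_color_0 by (rule subD) (use o01 in \<open>auto simp: os_def\<close>)
    have rF: "top_color (F j (map rep cs)) = top_color (F j cs)"
      by (rule op_top) (use l rep in simp_all)
    note LB = L_B[OF L]
    have "(low_color (F j as) = low_color (F j bs)) \<longleftrightarrow> (F j as, F j bs) \<in> \<theta> y"
      using section_atD[OF y(3)] LB by blast
    also have "\<dots> \<longleftrightarrow> (F j (map rep cs), F j os) \<in> \<theta> z" by (rule L_theta[OF L yz y(1) z(1)])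
    also have "\<dots> \<longleftrightarrow> top_color (F j (map rep cs)) = top_color (F j os)"
      using section_atD[OF z(5)] LB by blast
    finally have "(low_color (F j as) = low_color (F j bs)) \<longleftrightarrow> top_color (F j cs) = 0"
      unfolding Fos rF .
    then show "[F j as, F j bs, F j cs] \<in> snd S01"
      unfolding mem_S01 two_sub_iff using LB unfolding y(2) by blast
  qed
  \<comment> \<open>Chosen so that each triple of entries of \<open>zs\<close>, \<open>ws\<close>,
    \<open>xs\<close> lies in \<open>S01\<close>: \<open>ws\<close> differs from the zero tuple
    exactly where \<open>xs\<close> is \<open>2\<close>.\<close>
  define zs where "zs = replicate n (0::3)"
  define ws where "ws = map (\<lambda>u. if u = 2 then 1 else 0 :: 3) xs"
  have l: "length zs = n" "length ws = n" using xs by (simp_all add: zs_def ws_def)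
  have sub: "set zs \<subseteq> {0, 1}" "set ws \<subseteq> {0, 1}" by (auto simp: zs_def ws_def)
  have top: "top_color (h xs) = low_color (h zs) - low_color (h ws)" if h: "h = f \<or> h \<in> T" for h
  proof -
    have P: "preserves n h (3, snd S01)"
      using h
    proof
      show "preserves n h (3, snd S01)" if "h = f"
        unfolding that by (rule pres_cand[OF _ inv]) (simp add: Gamma2_candidates_def S01_eq(1)[symmetric])
      show "preserves n h (3, snd S01)" if "h \<in> T"
        by (rule term_ops_preserve[OF that inv S01_eq(2)])
    qed
    have "[h zs, h ws, h xs] \<in> snd S01"
    proof (rule preserves_ternaryD[OF P l xs])
      fix k assume "k < n"
      then show "[zs ! k, ws ! k, xs ! k] \<in> snd S01"
        unfolding mem_S01 using xs by (simp add: zs_def ws_def low_color_def top_color_def)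
    qed
    then show ?thesis unfolding mem_S01 by simp
  qed
  show ?thesis using top g l sub by simp
qed

text \<open>A term operation right on all tuples over \<open>{0, 1}\<close> serves both types of
  coordinates, the quotient type by \<open>low_determines_top\<close>. If only the quotient type
  occurs, \<open>quotient_interpolation\<close> suffices. \<open>sweep\<close> concludes in both
  cases.\<close>

lemma contradiction: False
proof (cases "\<exists>y\<in>Y. B y = UNIV \<and> \<theta> y = Id")
  case True
  then show False using no_full_section by blast
next
  case no: False
  have types: "(B y = {0, 1} \<and> section_at y low_color) \<or>
      (2 \<in> B y \<and> (\<exists>u\<in>B y. u \<noteq> 2) \<and> section_at y top_color)" if "y \<in> Y" for y
    using section_types[OF that] no that by blast
  have top_theta: "(g y, f y) \<in> \<theta> y"
    if "section_at y top_color" "y \<in> Y" "g \<in> T" "top_color (g y) = top_color (f y)" for g y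
    using section_atD[OF that(1) BI[OF that(3)] f_in_B[OF that(2)]] that(4) by simp
  show False
  proof (cases "\<exists>y\<in>Y. B y = {0, 1} \<and> section_at y low_color")
    case True
    then obtain y where y: "y \<in> Y" "B y = {0, 1}" "section_at y low_color" by blast
    have sec: "section_at y (\<lambda>u. if u = 0 then 0 else 1)"
      using y(3) unfolding low_color_def by simp
    have cand: "T3' 2 \<in> Gamma2_candidates" by (simp add: Gamma2_candidates_def)
    have "\<exists>g\<in>T. \<forall>xs. length xs = n \<and> set xs \<subseteq> {0, 1} \<longrightarrow> g xs = f xs"
      by (rule two_element_interpolation[OF y(1,2) _ _ _ sec cand]) simp_all
    then obtain g where g: "g \<in> T" "\<And>xs. length xs = n \<Longrightarrow> set xs \<subseteq> {0, 1} \<Longrightarrow> g xs = f xs" by blast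
    show False
    proof (rule sweep[OF g(1)])
      fix x assume x: "x \<in> Y"
      from types[OF x] show "(g x, f x) \<in> \<theta> x"
      proof (elim disjE conjE bexE)
        assume "B x = {0, 1}"
        then have "g x = f x" using g(2)[OF len_Y[OF x]] set_in_B[OF x] by simp
        then show ?thesis using K_refl[OF f_in_B[OF x]] by simp
      next
        fix u assume "2 \<in> B x" "u \<in> B x" "u \<noteq> 2" "section_at x top_color"
        then show ?thesis
          using top_theta[OF _ x g(1)] low_determines_top[OF y x _ _ _ _ g len_Y[OF x]] by blast
      qed
    qed
  next
    case False
    then have Q: "2 \<in> B y \<and> (\<exists>u\<in>B y. u \<noteq> 2) \<and> section_at y top_color" if "y \<in> Y" for y
      using types[OF that] that by blast
    obtain y where y: "y \<in> Y" using third by blast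
    from Q[OF y] obtain u where "2 \<in> B y" "u \<in> B y" "u \<noteq> 2" "section_at y top_color" by blast
    from quotient_interpolation[OF y this]
    obtain g where g: "g \<in> T" "\<And>xs. length xs = n \<Longrightarrow> top_color (g xs) = top_color (f xs)" by blast
    show False
      by (rule sweep[OF g(1)]) (use top_theta[OF _ _ g(1) g(2)[OF len_Y]] Q in blast)
  qed
qed

end

lemma (in mono3) no_critical: "\<not> critical ar F d n f Y"
proof
  assume "critical ar F d n f Y"
  then interpret critical ar F d n f Y .
  interpret mono_critical3 ar F d n f Y by unfold_locales
  show False by (rule contradiction)
qed

subsection \<open>From interpolation to clones\<close>

lemma (in simple3) interpolation: "\<exists>g\<in>term_ops ar F n. \<forall>xs. length xs = n \<longrightarrow> g xs = f xs"
  using critical_exists[OF _ two_points_if[OF pres_binary]] no_critical by (metis finite)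

lemma (in mono3) interpolation: "\<exists>g\<in>term_ops ar F n. \<forall>xs. length xs = n \<longrightarrow> g xs = f xs"
  using critical_exists[OF _ two_points_if[OF pres_binary]] no_critical by (metis finite)

lemma preserves_cong:
  assumes "\<And>xs. length xs = n \<Longrightarrow> f xs = g xs"
  shows "preserves n f Rel = preserves n g Rel"
proof (cases Rel)
  case (Pair m R)
  define X where "X h rs = map (\<lambda>j. h (map (\<lambda>r. r ! j) rs)) [0..<m]" for h :: "'a list \<Rightarrow> 'a" and rs
  have X: "X f rs = X g rs" if "length rs = n" for rs
    unfolding X_def by (rule map_cong[OF refl]) (use assms that in simp)
  show ?thesis unfolding preserves_def Pair prod.case X_def[symmetric] using X by metis
qed

lemma Clo_eq_Pol:
  assumes wf: "\<And>Rel r. Rel \<in> \<Gamma> \<Longrightarrow> r \<in> snd Rel \<Longrightarrow> length r = fst Rel"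
    and interp: "\<And>n f. 1 \<le> n \<Longrightarrow> (\<And>Rel. Rel \<in> subuniverse_rels ar F \<union> (\<Gamma> \<inter> Inv ar F) \<Longrightarrow> preserves n f Rel) \<Longrightarrow>
      \<exists>g\<in>term_ops ar F n. \<forall>xs. length xs = n \<longrightarrow> g xs = f xs"
  shows "Clo ar F = Pol (subuniverse_rels ar F \<union> (\<Gamma> \<inter> Inv ar F))"
proof (intro equalityI subsetI)
  fix p assume "p \<in> Clo ar F"
  then obtain n f g where p: "p = (n, f)" "1 \<le> n" "g \<in> term_ops ar F n" "\<And>xs. length xs = n \<Longrightarrow> f xs = g xs"
    by (auto simp: Clo_def)
  have "preserves n f Rel" if Rel: "Rel \<in> subuniverse_rels ar F \<union> (\<Gamma> \<inter> Inv ar F)" for Rel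
  proof -
    have "preserves n g Rel"
      using Rel
    proof
      assume "Rel \<in> subuniverse_rels ar F"
      then show ?thesis
        using term_ops_preserve_unary[OF p(3)] by (auto simp: subuniverse_rels_def subuniverse_iff)
    next
      assume "Rel \<in> \<Gamma> \<inter> Inv ar F"
      then show ?thesis
        using term_ops_preserve[OF p(3), of "fst Rel" "snd Rel"] wf[of Rel] by simp
    qed
    then show ?thesis using preserves_cong[of n f g, OF p(4)] by simp
  qed
  then show "p \<in> Pol (subuniverse_rels ar F \<union> (\<Gamma> \<inter> Inv ar F))" using p by (simp add: Pol_def)
next
  fix p assume "p \<in> Pol (subuniverse_rels ar F \<union> (\<Gamma> \<inter> Inv ar F))"
  then obtain n f where p: "p = (n, f)" "1 \<le> n"
    "\<And>Rel. Rel \<in> subuniverse_rels ar F \<union> (\<Gamma> \<inter> Inv ar F) \<Longrightarrow> preserves n f Rel"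
    by (cases p) (auto simp: Pol_def)
  from interp[OF p(2,3)] obtain g where "g \<in> term_ops ar F n" "\<And>xs. length xs = n \<Longrightarrow> g xs = f xs" by blast
  then show "p \<in> Clo ar F" using p(1,2) by (auto simp: Clo_def intro!: bexI[of _ g])
qed

lemma length_bin_rel: "r \<in> snd (bin_rel R) \<Longrightarrow> length r = fst (bin_rel R)"
  by (auto simp: bin_rel_def)

lemma Gamma1_wf: "Rel \<in> Gamma1_candidates \<Longrightarrow> r \<in> snd Rel \<Longrightarrow> length r = fst Rel"
  unfolding Gamma1_candidates_def
  by (elim UnE insertE CollectE exE conjE emptyE) (auto dest: length_bin_rel simp: T3_def T3'_def)

lemma Gamma2_wf: "Rel \<in> Gamma2_candidates \<Longrightarrow> r \<in> snd Rel \<Longrightarrow> length r = fst Rel"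
  unfolding Gamma2_candidates_def
  by (elim insertE emptyE) (auto dest: length_bin_rel simp: T3i_def T3'_def T3_mu2_def S01_def)

lemma congruence_cases:
  fixes \<theta> :: "(3 \<times> 3) set"
  assumes "congruence ar F \<theta>"
  shows "bin_rel \<theta> \<in> Inv ar F" "\<theta> = Id \<or> \<theta> = UNIV \<or> (\<exists>j. \<theta> = mu3 j)"
proof -
  show "bin_rel \<theta> \<in> Inv ar F" using assms by (simp add: congruence_def Inv_def)
  have "equiv UNIV \<theta>" using assms by (simp add: congruence_def)
  then show "\<theta> = Id \<or> \<theta> = UNIV \<or> (\<exists>j. \<theta> = mu3 j)"
    by (intro equiv3_cases) (auto simp: equiv_def refl_on_def dest: symD transD)
qed

lemma mono_clone:
  assumes "malcev_alg ar F d" and mu: "bin_rel (mu3 2) \<in> Inv ar F"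
  shows "is_monolith ar F (mu3 2)"
    and "Clo ar F = Pol (subuniverse_rels ar F \<union> (Gamma2_candidates \<inter> Inv ar F))"
proof -
  interpret malcev_alg ar F d by (rule assms(1))
  show "Clo ar F = Pol (subuniverse_rels ar F \<union> (Gamma2_candidates \<inter> Inv ar F))"
  proof (rule Clo_eq_Pol[OF Gamma2_wf])
    fix n f assume *: "1 \<le> n" "\<And>Rel. Rel \<in> subuniverse_rels ar F \<union> (Gamma2_candidates \<inter> Inv ar F) \<Longrightarrow> preserves n f Rel"
    interpret mono3 ar F d n f by unfold_locales (use * mu in auto)
    show "\<exists>g\<in>term_ops ar F n. \<forall>xs. length xs = n \<longrightarrow> g xs = f xs" by (rule interpolation)
  qed
  \<comment> \<open>\<open>mu_unique\<close> belongs to a locale with a fixed operation preserving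
    the relations; the unary projection serves as that operation.\<close>
  interpret mono3 ar F d 1 "\<lambda>xs. xs ! 0"
  proof unfold_locales
    show "preserves 1 (\<lambda>xs. xs ! 0) Rel"
      if "Rel \<in> subuniverse_rels ar F \<union> (Gamma2_candidates \<inter> Inv ar F)" for Rel
      using that
    proof
      have proj: "(\<lambda>xs. xs ! 0) \<in> term_ops ar F 1" by (rule term_ops.proj) simp
      show ?thesis if "Rel \<in> subuniverse_rels ar F"
        using that term_ops_preserve_unary[OF proj] by (auto simp: subuniverse_rels_def subuniverse_iff)
      show ?thesis if "Rel \<in> Gamma2_candidates \<inter> Inv ar F"
        using that term_ops_preserve[OF proj, of "fst Rel" "snd Rel"] Gamma2_wf[of Rel] by simp
    qed
  qed (simp_all add: mu)
  have "equiv UNIV (mu3 2)"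
    by (auto simp: equiv_def refl_on_def sym_def trans_def mu3_def)
  moreover have "(0, 1) \<in> mu3 2" "(0, 1 :: 3) \<notin> Id" by (simp_all add: mem_mu3_2)
  then have "mu3 2 \<noteq> Id" by blast
  moreover have "mu3 2 \<subseteq> \<theta>" if "congruence ar F \<theta>" "\<theta> \<noteq> Id" for \<theta>
    using congruence_cases[OF that(1)] that(2) mu_unique by auto
  ultimately show "is_monolith ar F (mu3 2)"
    using mu by (simp add: is_monolith_def congruence_def Inv_def)
qed

lemma simple_clone:
  assumes "malcev_alg ar F d" and simple: "\<And>j. bin_rel (mu3 j) \<notin> Inv ar F"
    and norm: "\<And>i. bin_rel (psi3 i) \<in> Inv ar F \<Longrightarrow> bin_rel (psi3 2) \<in> Inv ar F"
  shows "is_monolith ar F UNIV"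
    and "Clo ar F = Pol (subuniverse_rels ar F \<union> (Gamma1_candidates \<inter> Inv ar F))"
proof -
  interpret malcev_alg ar F d by (rule assms(1))
  show "Clo ar F = Pol (subuniverse_rels ar F \<union> (Gamma1_candidates \<inter> Inv ar F))"
  proof (rule Clo_eq_Pol[OF Gamma1_wf])
    fix n f assume *: "1 \<le> n" "\<And>Rel. Rel \<in> subuniverse_rels ar F \<union> (Gamma1_candidates \<inter> Inv ar F) \<Longrightarrow> preserves n f Rel"
    interpret simple3 ar F d n f by unfold_locales (use * simple norm in auto)
    show "\<exists>g\<in>term_ops ar F n. \<forall>xs. length xs = n \<longrightarrow> g xs = f xs" by (rule interpolation)
  qed
  have "(0, 1 :: 3) \<notin> Id" by simp
  then have "(UNIV :: (3 \<times> 3) set) \<noteq> Id" by blast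
  moreover have "\<theta> = UNIV" if "congruence ar F \<theta>" "\<theta> \<noteq> Id" for \<theta>
    using congruence_cases[OF that(1)] that(2) simple by auto
  moreover have "congruence ar F UNIV"
    by (auto simp: congruence_def preserves_bin_rel equiv_def refl_on_def sym_def trans_def)
  ultimately show "is_monolith ar F UNIV"
    unfolding is_monolith_def by blast
qed

subsection \<open>Transport along bijections\<close>

definition transport :: "('a \<Rightarrow> 'b) \<Rightarrow> ('i \<Rightarrow> 'a list \<Rightarrow> 'a) \<Rightarrow> 'i \<Rightarrow> 'b list \<Rightarrow> 'b" where
  "transport h F i xs = h (F i (map (inv h) xs))"

lemma isomorphism_transport: "bij h \<Longrightarrow> isomorphism ar F (transport h F) h"
  by (simp add: isomorphism_def transport_def o_def bij_is_inj)

lemma transport_term: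
  assumes "bij h" "t \<in> term_ops ar F n"
  shows "\<exists>t'\<in>term_ops ar (transport h F) n. \<forall>xs. length xs = n \<longrightarrow> t' xs = h (t (map (inv h) xs))"
  using assms(2)
proof induction
  case (proj k)
  then show ?case
    using assms(1) by (intro bexI[OF _ term_ops.proj[of k]]) (auto simp: bij_is_surj surj_f_inv_f)
next
  case (comp gs i)
  define \<tau> where "\<tau> g = (SOME g'. g' \<in> term_ops ar (transport h F) n \<and>
      (\<forall>xs. length xs = n \<longrightarrow> g' xs = h (g (map (inv h) xs))))" for g
  have \<tau>: "\<tau> g \<in> term_ops ar (transport h F) n" "\<And>xs. length xs = n \<Longrightarrow> \<tau> g xs = h (g (map (inv h) xs))"
    if "g \<in> set gs" for g
  proof -
    have "\<exists>g'. g' \<in> term_ops ar (transport h F) n \<and> (\<forall>xs. length xs = n \<longrightarrow> g' xs = h (g (map (inv h) xs)))"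
      using comp that by blast
    from someI_ex[OF this] show "\<tau> g \<in> term_ops ar (transport h F) n"
      "\<And>xs. length xs = n \<Longrightarrow> \<tau> g xs = h (g (map (inv h) xs))"
      unfolding \<tau>_def by blast+
  qed
  have "(\<lambda>xs. transport h F i (map (\<lambda>g. g xs) (map \<tau> gs))) \<in> term_ops ar (transport h F) n"
    using comp \<tau> by (intro term_ops.comp) auto
  moreover have "transport h F i (map (\<lambda>g. g xs) (map \<tau> gs)) = h (F i (map (\<lambda>g. g (map (inv h) xs)) gs))"
    if "length xs = n" for xs
  proof -
    have eq: "map (inv h) (map (\<lambda>g. g xs) (map \<tau> gs)) = map (\<lambda>g. g (map (inv h) xs)) gs"
      using \<tau>(2) that assms(1) by (simp add: bij_is_inj)
    show ?thesis unfolding transport_def eq ..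
  qed
  ultimately show ?case by (intro bexI) auto
qed

lemma transport_malcev:
  assumes "bij h" "malcev ar F"
  obtains d where "malcev_alg ar (transport h F) d"
proof -
  from assms(2) obtain t where t: "t \<in> term_ops ar F 3" "\<And>x y. t [y, x, x] = y" "\<And>x y. t [x, x, y] = y"
    unfolding malcev_def Clo_def by fastforce
  from transport_term[OF assms(1) t(1)] obtain t' where
    t': "t' \<in> term_ops ar (transport h F) 3" "\<And>xs. length xs = 3 \<Longrightarrow> t' xs = h (t (map (inv h) xs))" by blast
  have "malcev_alg ar (transport h F) (\<lambda>x y z. t' [x, y, z])"
  proof
    show "(\<lambda>xs. t' [g1 xs, g2 xs, g3 xs]) \<in> term_ops ar (transport h F) n"
      if "g1 \<in> term_ops ar (transport h F) n" "g2 \<in> term_ops ar (transport h F) n" "g3 \<in> term_ops ar (transport h F) n"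
      for n g1 g2 g3
      using term_ops_subst[OF t'(1), of "[g1, g2, g3]" n] that by simp
  qed (use t t'(2) assms(1) in \<open>simp_all add: bij_is_surj surj_f_inv_f\<close>)
  then show thesis by (rule that)
qed

definition swap2 :: "3 \<Rightarrow> 3 \<Rightarrow> 3" where
  "swap2 j x = (if x = j then 2 else if x = 2 then j else x)"

lemma swap2_swap2: "swap2 j (swap2 j x) = x"
  by (simp add: swap2_def)

lemma bij_swap2: "bij (swap2 j)"
  by (rule o_bij[of "swap2 j"]) (auto simp: swap2_swap2)

lemma transport_Inv:
  assumes "bij p" "bij h" "bin_rel R \<in> Inv ar (transport h F)"
  shows "bin_rel {(p x, p y) | x y. (x, y) \<in> R} \<in> Inv ar (transport (p \<circ> h) F)"
proof -
  have "transport (p \<circ> h) F i = (\<lambda>xs. p (transport h F i (map (inv p) xs)))" for i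
    using assms(1,2) by (auto simp: transport_def o_inv_distrib)
  then show ?thesis using preserves_image[OF assms(1)] assms(3) by (simp add: Inv_def)
qed

lemma transport_swap2:
  assumes "bij h"
  shows "bin_rel (mu3 j) \<in> Inv ar (transport h F) \<Longrightarrow> bin_rel (mu3 2) \<in> Inv ar (transport (swap2 j \<circ> h) F)"
    and "bin_rel (psi3 j) \<in> Inv ar (transport h F) \<Longrightarrow> bin_rel (psi3 2) \<in> Inv ar (transport (swap2 j \<circ> h) F)"
proof -
  have *: "{(swap2 j x, swap2 j y) | x y. (x, y) \<in> R} = {(x, y). (swap2 j x, swap2 j y) \<in> R}" for R
    by (auto simp: swap2_swap2) (metis swap2_swap2)
  have mu: "{(swap2 j x, swap2 j y) | x y. (x, y) \<in> mu3 j} = mu3 2"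
    unfolding * by (auto simp: mu3_def swap2_def split: if_splits)
  have psi: "{(swap2 j x, swap2 j y) | x y. (x, y) \<in> psi3 j} = psi3 2"
    unfolding * by (auto simp: psi3_def swap2_def split: if_splits)
  show "bin_rel (mu3 j) \<in> Inv ar (transport h F) \<Longrightarrow> bin_rel (mu3 2) \<in> Inv ar (transport (swap2 j \<circ> h) F)"
    using transport_Inv[OF bij_swap2 assms, of "mu3 j" ar F j] unfolding mu .
  show "bin_rel (psi3 j) \<in> Inv ar (transport h F) \<Longrightarrow> bin_rel (psi3 2) \<in> Inv ar (transport (swap2 j \<circ> h) F)"
    using transport_Inv[OF bij_swap2 assms, of "psi3 j" ar F j] unfolding psi .
qed

theorem theorem4p8:
  fixes ar :: "'i \<Rightarrow> nat" and FB :: "'i \<Rightarrow> 'b list \<Rightarrow> 'b"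
  assumes "CARD('b) = 3"
    and "malcev ar FB"
  shows "\<exists>(FA :: 'i \<Rightarrow> 3 list \<Rightarrow> 3) h.
     isomorphism ar FB FA h \<and>
     ((is_monolith ar FA UNIV \<and>
        Clo ar FA = Pol (subuniverse_rels ar FA \<union> (Gamma1_candidates \<inter> Inv ar FA))) \<or>
      (is_monolith ar FA (mu3 2) \<and>
        Clo ar FA = Pol (subuniverse_rels ar FA \<union> (Gamma2_candidates \<inter> Inv ar FA))))"
proof (cases "\<exists>h :: 'b \<Rightarrow> 3. bij h \<and> bin_rel (mu3 2) \<in> Inv ar (transport h FB)")
  case True
  then obtain h :: "'b \<Rightarrow> 3" where h: "bij h" "bin_rel (mu3 2) \<in> Inv ar (transport h FB)" by blast
  obtain d where d: "malcev_alg ar (transport h FB) d" using transport_malcev[OF h(1) assms(2)] .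
  show ?thesis
    by (intro exI conjI disjI2, rule isomorphism_transport[OF h(1)]) (rule mono_clone[OF d h(2)])+
next
  case False
  \<comment> \<open>Relabelling by \<open>swap2 j\<close> would turn an invariant
    \<open>mu3 j\<close> into an invariant \<open>mu3 2\<close>, which this case excludes for every
    labelling.\<close>
  have simple: "bin_rel (mu3 j) \<notin> Inv ar (transport h FB)" if "bij h" for h :: "'b \<Rightarrow> 3" and j
    using False transport_swap2(1)[OF that] bij_comp[OF that bij_swap2] by blast
  have "finite (UNIV :: 'b set)" using assms(1) by (metis card.infinite zero_neq_numeral)
  then obtain h0 :: "'b \<Rightarrow> 3" where h0: "bij h0"
    using finite_same_card_bij[of "UNIV :: 'b set" "UNIV :: 3 set"] assms(1) by auto
  \<comment> \<open>A labelling with \<open>psi3 2\<close> invariant is taken if there is one.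
    Otherwise any labelling satisfies \<open>norm\<close>, since \<open>swap2 i\<close> would turn
    an invariant \<open>psi3 i\<close> into an invariant \<open>psi3 2\<close>.\<close>
  obtain h :: "'b \<Rightarrow> 3" where h: "bij h"
    and norm: "\<And>i. bin_rel (psi3 i) \<in> Inv ar (transport h FB) \<Longrightarrow> bin_rel (psi3 2) \<in> Inv ar (transport h FB)"
  proof (cases "\<exists>h :: 'b \<Rightarrow> 3. bij h \<and> bin_rel (psi3 2) \<in> Inv ar (transport h FB)")
    case True
    then show thesis using that by blast
  next
    case F: False
    show thesis
      by (rule that[OF h0]) (use F transport_swap2(2)[OF h0] bij_comp[OF h0 bij_swap2] in blast)
  qed
  obtain d where d: "malcev_alg ar (transport h FB) d" using transport_malcev[OF h assms(2)] .
  show ?thesis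
    by (intro exI conjI disjI1, rule isomorphism_transport[OF h]) (rule simple_clone[OF d simple[OF h] norm]; assumption)+
qed

end
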